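(* Let $q\in\mathbb{C}\setminus\{0\}$ be not a root of unity, and let $a_0\in\mathbb{C}\setminus\{0\}$, $s,t\in\mathbb{C}$. Consider the $U_q(\mathfrak{sl}_2)$-module algebra structure on the quantum plane $\mathbb{C}_q[x,y]$ given by $$\mathsf{k}(x)=q^{-2}x,\quad \mathsf{k}(y)=q^{-1}y,\quad \mathsf{e}(x)=a_0,\quad \mathsf{e}(y)=0,$$ $$\mathsf{f}(x)=-qa_0^{-1}x^2+ty^4,\quad \mathsf{f}(y)=-qa_0^{-1}xy+sy^3,$$ viewed as a representation of $U_q(\mathfrak{sl}_2)$ in the vector space $\mathbb{C}_q[x,y]$. Then it splits into the direct sum of subrepresentations $\mathbb{C}_q[x,y]=\bigoplus_{n=0}^\infty\mathcal{V}_n$, where $\mathcal{V}_n$ is a submodule generated by its highest weight vector $y^n$. Each $\mathcal{V}_n$ with $n\ge 1$ is isomorphic to a simple highest weight Verma module $\mathcal{V}(q^{-n})$. The submodule $\mathcal{V}_0$ admits a composition series of the form $0\subset\mathcal{J}_0\subset\mathcal{V}_0$, where $\mathcal{J}_0=\mathbb{C}\mathbf{1}$. The submodule $\mathcal{J}_0$ is not a direct summand in the category of $U_q(\mathfrak{sl}_2)$-modules (there exists no submodule $\mathcal{W}$ such that $\mathcal{V}_0=\mathcal{J}_0\oplus\mathcal{W}$). The quotient module $\mathcal{V}_0/\mathcal{J}_0$ is isomorphic to the (simple) Verma module $\mathcal{V}(q^{-2})$.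
   Context: The quantum plane $\mathbb{C}_q[x,y]$ is the unital associative $\mathbb{C}$-algebra with generators $x,y$ and the single relation $yx=qxy$; the monomials $x^my^n$ ($m,n\ge 0$) form a basis. $U_q(\mathfrak{sl}_2)$ is the unital associative $\mathbb{C}$-algebra with generators $\mathsf{k},\mathsf{k}^{-1},\mathsf{e},\mathsf{f}$ and relations $\mathsf{k}^{-1}\mathsf{k}=\mathsf{k}\mathsf{k}^{-1}=\mathbf{1}$, $\mathsf{k}\mathsf{e}=q^2\mathsf{e}\mathsf{k}$, $\mathsf{k}\mathsf{f}=q^{-2}\mathsf{f}\mathsf{k}$, $\mathsf{e}\mathsf{f}-\mathsf{f}\mathsf{e}=\frac{\mathsf{k}-\mathsf{k}^{-1}}{q-q^{-1}}$, with comultiplication $\Delta(\mathsf{k})=\mathsf{k}\otimes\mathsf{k}$, $\Delta(\mathsf{e})=\mathbf{1}\otimes\mathsf{e}+\mathsf{e}\otimes\mathsf{k}$, $\Delta(\mathsf{f})=\mathsf{f}\otimes\mathbf{1}+\mathsf{k}^{-1}\otimes\mathsf{f}$ and counit $\varepsilon(\mathsf{k})=1$, $\varepsilon(\mathsf{e})=\varepsilon(\mathsf{f})=0$. A $U_q(\mathfrak{sl}_2)$-module algebra structure on $A=\mathbb{C}_q[x,y]$ is an algebra homomorphism $\pi:U_q(\mathfrak{sl}_2)\to\operatorname{End}_{\mathbb{C}}A$ such that $\pi(h)(ab)=\sum_i\pi(h_i')(a)\,\pi(h_i'')(b)$ (where $\Delta(h)=\sum_i h_i'\otimes h_i''$)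 and $\pi(h)(\mathbf{1})=\varepsilon(h)\mathbf{1}$ for all $h$ and all $a,b\in A$; one writes $h(a)$ for $\pi(h)(a)$. It is uniquely determined by the values of $\mathsf{k},\mathsf{e},\mathsf{f}$ on $x,y$; the values above do define such a structure. A highest weight vector of weight $\lambda$ is a nonzero vector $v$ with $\mathsf{e}v=0$ and $\mathsf{k}v=\lambda v$. For $\lambda\in\mathbb{C}\setminus\{0\}$ the (highest weight) Verma module $\mathcal{V}(\lambda)$ has basis $\{v_i\mid i\ge 0\}$ with $\mathsf{k}v_i=\lambda q^{-2i}v_i$, $\mathsf{k}^{-1}v_i=\lambda^{-1}q^{2i}v_i$, $\mathsf{e}v_0=0$, $\mathsf{e}v_{i+1}=\frac{\lambda q^{-i}-\lambda^{-1}q^i}{q-q^{-1}}v_i$, $\mathsf{f}v_i=\frac{q^{i+1}-q^{-i-1}}{q-q^{-1}}v_{i+1}$.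
   Formalization: The claim that V_n is generated by y^n is stated only for n ≥ 1: the submodule generated by y^0 = 1 is C1 = J_0, which contradicts J_0 being properly contained in V_0. V_0 is asserted to exist with 1 as a highest weight vector and all the other listed properties. *)

theory Defs
  imports
    "HOL-Algebra.Algebraic_Closure_Type"
    "HOL-Library.Poly_Mapping"
    "HOL-Library.Product_Plus"
begin

section \<open>Linear algebra over the complex numbers\<close>

abbreviation \<CC> :: "complex ring"
  where "\<CC> \<equiv> ring_of_type_algebra"

text \<open>
  Vector spaces and associative unital algebras over \<^term>\<open>\<CC>\<close> are both given as records of
  type \<^typ>\<open>(complex, 'v) module\<close>.  For a mere vector space the ring fields
  \<^const>\<open>monoid.mult\<close> and \<^const>\<open>one\<close> are irrelevant, exactly as in \<^locale>\<open>module\<close>.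
\<close>

definition linear_map ::
    "(complex, 'v, 'm) module_scheme \<Rightarrow> (complex, 'w, 'n) module_scheme \<Rightarrow> ('v \<Rightarrow> 'w) \<Rightarrow> bool"
  where "linear_map V W f \<longleftrightarrow>
    f \<in> carrier V \<rightarrow> carrier W \<and>
    (\<forall>u\<in>carrier V. \<forall>v\<in>carrier V. f (u \<oplus>\<^bsub>V\<^esub> v) = f u \<oplus>\<^bsub>W\<^esub> f v) \<and>
    (\<forall>c. \<forall>v\<in>carrier V. f (c \<odot>\<^bsub>V\<^esub> v) = c \<odot>\<^bsub>W\<^esub> f v)"

definition End_alg :: "(complex, 'v, 'm) module_scheme \<Rightarrow> (complex, 'v \<Rightarrow> 'v) module"
  where "End_alg V =
    \<lparr>carrier = {f \<in> extensional (carrier V). linear_map V V f},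
     monoid.mult = compose (carrier V),
     one = (\<lambda>v\<in>carrier V. v),
     ring.zero = (\<lambda>v\<in>carrier V. \<zero>\<^bsub>V\<^esub>),
     add = (\<lambda>f g. \<lambda>v\<in>carrier V. f v \<oplus>\<^bsub>V\<^esub> g v),
     module.smult = (\<lambda>c f. \<lambda>v\<in>carrier V. c \<odot>\<^bsub>V\<^esub> f v)\<rparr>"

definition alg_hom ::
    "(complex, 'a, 'm) module_scheme \<Rightarrow> (complex, 'b, 'n) module_scheme \<Rightarrow> ('a \<Rightarrow> 'b) set"
  where "alg_hom A B =
    {\<phi> \<in> ring_hom A B. \<forall>c. \<forall>a\<in>carrier A. \<phi> (c \<odot>\<^bsub>A\<^esub> a) = c \<odot>\<^bsub>B\<^esub> \<phi> a}"

definition internal_direct_sum ::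
    "(complex, 'v, 'm) module_scheme \<Rightarrow> 'i set \<Rightarrow> ('i \<Rightarrow> 'v set) \<Rightarrow> bool"
  where "internal_direct_sum M I V \<longleftrightarrow>
    (\<forall>i\<in>I. V i \<subseteq> carrier M) \<and>
    (\<forall>m\<in>carrier M. \<exists>!f. f \<in> (\<Pi>\<^sub>E i\<in>I. V i) \<and> finite {i\<in>I. f i \<noteq> \<zero>\<^bsub>M\<^esub>} \<and>
       m = (\<Oplus>\<^bsub>M\<^esub>i\<in>{i\<in>I. f i \<noteq> \<zero>\<^bsub>M\<^esub>}. f i))"


section \<open>Algebras given by generators and relations\<close>

text \<open>
  Words are wrapped in a datatype of their own so that \<^class>\<open>monoid_add\<close> can be instantiated with
  concatenation.  With the convolution product of \<^theory>\<open>HOL-Library.Poly_Mapping\<close>, finitely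
  supported functions on words then form the free algebra, and finitely supported functions on
  pairs of words form the tensor product of two free algebras.
\<close>

datatype 'g word = Word (letters: "'g list")

instantiation word :: (type) monoid_add
begin

definition zero_word :: "'a word"
  where "0 = Word []"

definition plus_word :: "'a word \<Rightarrow> 'a word \<Rightarrow> 'a word"
  where "u + v = Word (letters u @ letters v)"

instance
  by standard (simp_all add: zero_word_def plus_word_def)

end

type_synonym 'g free_algebra = "'g word \<Rightarrow>\<^sub>0 complex"

abbreviation scale :: "complex \<Rightarrow> ('i \<Rightarrow>\<^sub>0 complex) \<Rightarrow> ('i \<Rightarrow>\<^sub>0 complex)"
  where "scale c \<equiv> Poly_Mapping.map ((*) c)"

definition monoid_algebra :: "(complex, 'm::monoid_add \<Rightarrow>\<^sub>0 complex) module"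
  where "monoid_algebra =
    \<lparr>carrier = UNIV, monoid.mult = (*), one = 1, ring.zero = 0, add = (+), module.smult = scale\<rparr>"

definition gen :: "'g \<Rightarrow> 'g free_algebra"
  where "gen g = Poly_Mapping.single (Word [g]) 1"

text \<open>
  The class of \<^term>\<open>p\<close> modulo the two-sided ideal generated by \<^term>\<open>R\<close>, and the quotient algebra.
\<close>

definition pres_class :: "('m::monoid_add \<Rightarrow>\<^sub>0 complex) set \<Rightarrow> ('m \<Rightarrow>\<^sub>0 complex) \<Rightarrow> ('m \<Rightarrow>\<^sub>0 complex) set"
  where "pres_class R p = genideal monoid_algebra R +>\<^bsub>monoid_algebra\<^esub> p"

definition presented_algebra ::
    "('m::monoid_add \<Rightarrow>\<^sub>0 complex) set \<Rightarrow> (complex, ('m \<Rightarrow>\<^sub>0 complex) set) module"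
  where "presented_algebra R =
    ring.extend (monoid_algebra Quot genideal monoid_algebra R)
      (module.fields (\<lambda>c S. \<Union>p\<in>S. pres_class R (scale c p)))"

text \<open>
  The algebra homomorphism out of a free algebra with prescribed values \<^term>\<open>\<phi>\<close> on the generators;
  \<^term>\<open>\<iota>\<close> embeds the scalars into the target.
\<close>

definition free_lift :: "(complex \<Rightarrow> 'b::ring_1) \<Rightarrow> ('g \<Rightarrow> 'b) \<Rightarrow> 'g free_algebra \<Rightarrow> 'b"
  where "free_lift \<iota> \<phi> p =
    (\<Sum>w\<in>Poly_Mapping.keys p. \<iota> (Poly_Mapping.lookup p w) * prod_list (map \<phi> (letters w)))"

definition tensor :: "'g free_algebra \<Rightarrow> 'g free_algebra \<Rightarrow> ('g word \<times> 'g word \<Rightarrow>\<^sub>0 complex)"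
  where "tensor p r =
    (\<Sum>u\<in>Poly_Mapping.keys p. \<Sum>v\<in>Poly_Mapping.keys r.
       Poly_Mapping.single (u, v) (Poly_Mapping.lookup p u * Poly_Mapping.lookup r v))"


section \<open>The quantum plane\<close>

datatype qp_gen = GenX | GenY

definition qp_relators :: "complex \<Rightarrow> qp_gen free_algebra set"
  where "qp_relators q = {gen GenY * gen GenX - scale q (gen GenX * gen GenY)}"

definition quantum_plane :: "complex \<Rightarrow> (complex, qp_gen free_algebra set) module"
  where "quantum_plane q = presented_algebra (qp_relators q)"

definition qp_x :: "complex \<Rightarrow> qp_gen free_algebra set"
  where "qp_x q = pres_class (qp_relators q) (gen GenX)"

definition qp_y :: "complex \<Rightarrow> qp_gen free_algebra set"
  where "qp_y q = pres_class (qp_relators q) (gen GenY)"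


section \<open>The quantum universal enveloping algebra of sl(2)\<close>

datatype uq_gen = GenK | GenKinv | GenE | GenF

definition uq_relators :: "complex \<Rightarrow> uq_gen free_algebra set"
  where "uq_relators q =
    {gen GenKinv * gen GenK - 1,
     gen GenK * gen GenKinv - 1,
     gen GenK * gen GenE - scale (q\<^sup>2) (gen GenE * gen GenK),
     gen GenK * gen GenF - scale (inverse (q\<^sup>2)) (gen GenF * gen GenK),
     gen GenE * gen GenF - gen GenF * gen GenE
       - scale (1 / (q - inverse q)) (gen GenK - gen GenKinv)}"

definition uq :: "complex \<Rightarrow> (complex, uq_gen free_algebra set) module"
  where "uq q = presented_algebra (uq_relators q)"

definition uq_class :: "complex \<Rightarrow> uq_gen free_algebra \<Rightarrow> uq_gen free_algebra set"
  where "uq_class q = pres_class (uq_relators q)"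

abbreviation uq_k :: "complex \<Rightarrow> uq_gen free_algebra set"
  where "uq_k q \<equiv> uq_class q (gen GenK)"

abbreviation uq_e :: "complex \<Rightarrow> uq_gen free_algebra set"
  where "uq_e q \<equiv> uq_class q (gen GenE)"

abbreviation uq_f :: "complex \<Rightarrow> uq_gen free_algebra set"
  where "uq_f q \<equiv> uq_class q (gen GenF)"

text \<open>
  If the ideal \<^term>\<open>I\<close> is generated by \<^term>\<open>R\<close> in the free algebra \<^term>\<open>A\<close>, then
  \<open>A/I \<otimes> A/I = (A \<otimes> A)/(I \<otimes> A + A \<otimes> I)\<close>, and the ideal \<open>I \<otimes> A + A \<otimes> I\<close> is generated by the
  elements \<open>r \<otimes> 1\<close> and \<open>1 \<otimes> r\<close> with \<open>r\<close> in \<^term>\<open>R\<close>.  So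
  \<^term>\<open>presented_algebra (uq_tensor_relators q)\<close> is the tensor square of \<^term>\<open>uq q\<close>; an element
  of it is the set of all its representatives as combinations of pure tensors of words.
\<close>

definition uq_tensor_relators :: "complex \<Rightarrow> (uq_gen word \<times> uq_gen word \<Rightarrow>\<^sub>0 complex) set"
  where "uq_tensor_relators q =
    (\<lambda>r. tensor r 1) ` uq_relators q \<union> (\<lambda>r. tensor 1 r) ` uq_relators q"

text \<open>The value on \<^const>\<open>GenKinv\<close> is forced by multiplicativity.\<close>

fun comult_gen :: "uq_gen \<Rightarrow> (uq_gen word \<times> uq_gen word \<Rightarrow>\<^sub>0 complex)"
  where
    "comult_gen GenK = tensor (gen GenK) (gen GenK)"
  | "comult_gen GenKinv = tensor (gen GenKinv) (gen GenKinv)"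
  | "comult_gen GenE = tensor 1 (gen GenE) + tensor (gen GenE) (gen GenK)"
  | "comult_gen GenF = tensor (gen GenF) 1 + tensor (gen GenKinv) (gen GenF)"

fun counit_gen :: "uq_gen \<Rightarrow> complex"
  where
    "counit_gen GenK = 1"
  | "counit_gen GenKinv = 1"
  | "counit_gen GenE = 0"
  | "counit_gen GenF = 0"

text \<open>
  Both maps are first defined on the free algebra and then pushed down to the quotient; here
  elements of \<^term>\<open>uq q\<close> are cosets.
\<close>

definition uq_comult ::
    "complex \<Rightarrow> uq_gen free_algebra set \<Rightarrow> (uq_gen word \<times> uq_gen word \<Rightarrow>\<^sub>0 complex) set"
  where "uq_comult q h =
    (\<Union>p\<in>h. pres_class (uq_tensor_relators q) (free_lift (Poly_Mapping.single 0) comult_gen p))"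

definition uq_counit :: "uq_gen free_algebra set \<Rightarrow> complex"
  where "uq_counit h = the_elem (free_lift id counit_gen ` h)"

text \<open>
  In the compatibility condition, \<^term>\<open>z\<close> runs through all expressions
  \<open>\<Sum> z(u, v) u \<otimes> v\<close> (with \<open>u\<close>, \<open>v\<close> words in the generators) representing \<open>\<Delta>(h)\<close>.
\<close>

definition module_algebra ::
    "complex \<Rightarrow> (complex, 'a) module \<Rightarrow> (uq_gen free_algebra set \<Rightarrow> 'a \<Rightarrow> 'a) \<Rightarrow> bool"
  where "module_algebra q A \<pi> \<longleftrightarrow>
    \<pi> \<in> alg_hom (uq q) (End_alg A) \<and>
    (\<forall>h\<in>carrier (uq q). \<forall>a\<in>carrier A. \<forall>b\<in>carrier A. \<forall>z\<in>uq_comult q h.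
       \<pi> h (a \<otimes>\<^bsub>A\<^esub> b) =
         finsum A (\<lambda>(u, v). Poly_Mapping.lookup z (u, v) \<odot>\<^bsub>A\<^esub>
             (\<pi> (uq_class q (Poly_Mapping.single u 1)) a \<otimes>\<^bsub>A\<^esub>
              \<pi> (uq_class q (Poly_Mapping.single v 1)) b))
           (Poly_Mapping.keys z)) \<and>
    (\<forall>h\<in>carrier (uq q). \<pi> h \<one>\<^bsub>A\<^esub> = uq_counit h \<odot>\<^bsub>A\<^esub> \<one>\<^bsub>A\<^esub>)"


section \<open>Representations of an algebra\<close>

record ('u, 'v) rep = "(complex, 'v) module" +
  act :: "'u \<Rightarrow> 'v \<Rightarrow> 'v"

definition rep_of :: "(complex, 'v) module \<Rightarrow> ('u \<Rightarrow> 'v \<Rightarrow> 'v) \<Rightarrow> ('u, 'v) rep"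
  where "rep_of V \<pi> = module.extend V (rep.fields \<pi>)"

definition is_rep :: "(complex, 'u) module \<Rightarrow> ('u, 'v) rep \<Rightarrow> bool"
  where "is_rep U M \<longleftrightarrow> Module.module \<CC> M \<and> act M \<in> alg_hom U (End_alg M)"

definition subrep :: "(complex, 'u) module \<Rightarrow> ('u, 'v) rep \<Rightarrow> 'v set \<Rightarrow> bool"
  where "subrep U M N \<longleftrightarrow> submodule N \<CC> M \<and> (\<forall>h\<in>carrier U. \<forall>v\<in>N. act M h v \<in> N)"

definition sub_rep :: "('u, 'v) rep \<Rightarrow> 'v set \<Rightarrow> ('u, 'v) rep"
  where "sub_rep M N = M\<lparr>carrier := N, act := (\<lambda>h. restrict (act M h) N)\<rparr>"

definition quot_rep :: "('u, 'v) rep \<Rightarrow> 'v set \<Rightarrow> ('u, 'v set) rep"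
  where "quot_rep M N =
    \<lparr>carrier = a_rcosets\<^bsub>M\<^esub> N,
     monoid.mult = undefined,
     one = undefined,
     ring.zero = N,
     add = set_add M,
     module.smult = (\<lambda>c S. \<Union>x\<in>S. N +>\<^bsub>M\<^esub> (c \<odot>\<^bsub>M\<^esub> x)),
     act = (\<lambda>h. \<lambda>S\<in>a_rcosets\<^bsub>M\<^esub> N. \<Union>x\<in>S. N +>\<^bsub>M\<^esub> act M h x)\<rparr>"

definition generated_subrep :: "(complex, 'u) module \<Rightarrow> ('u, 'v) rep \<Rightarrow> 'v set \<Rightarrow> 'v set"
  where "generated_subrep U M S = \<Inter>{N. subrep U M N \<and> S \<subseteq> N}"

definition rep_iso :: "(complex, 'u) module \<Rightarrow> ('u, 'v) rep \<Rightarrow> ('u, 'w) rep \<Rightarrow> bool"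
  where "rep_iso U M N \<longleftrightarrow>
    (\<exists>\<phi>. linear_map M N \<phi> \<and> bij_betw \<phi> (carrier M) (carrier N) \<and>
       (\<forall>h\<in>carrier U. \<forall>v\<in>carrier M. \<phi> (act M h v) = act N h (\<phi> v)))"

definition simple_rep :: "(complex, 'u) module \<Rightarrow> ('u, 'v) rep \<Rightarrow> bool"
  where "simple_rep U M \<longleftrightarrow>
    is_rep U M \<and> carrier M \<noteq> {\<zero>\<^bsub>M\<^esub>} \<and>
    (\<forall>N. subrep U M N \<longrightarrow> N = {\<zero>\<^bsub>M\<^esub>} \<or> N = carrier M)"

definition composition_series :: "(complex, 'u) module \<Rightarrow> ('u, 'v) rep \<Rightarrow> 'v set list \<Rightarrow> bool"
  where "composition_series U M Ns \<longleftrightarrow>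
    Ns \<noteq> [] \<and> hd Ns = {\<zero>\<^bsub>M\<^esub>} \<and> last Ns = carrier M \<and>
    (\<forall>N\<in>set Ns. subrep U M N) \<and>
    (\<forall>i. Suc i < length Ns \<longrightarrow>
       Ns ! i \<subset> Ns ! Suc i \<and> simple_rep U (quot_rep (sub_rep M (Ns ! Suc i)) (Ns ! i)))"

definition direct_summand :: "(complex, 'u) module \<Rightarrow> ('u, 'v) rep \<Rightarrow> 'v set \<Rightarrow> bool"
  where "direct_summand U M N \<longleftrightarrow>
    subrep U M N \<and>
    (\<exists>W. subrep U M W \<and> N \<inter> W = {\<zero>\<^bsub>M\<^esub>} \<and> N <+>\<^bsub>M\<^esub> W = carrier M)"


section \<open>Highest weight vectors and Verma modules\<close>

definition highest_weight_vector ::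
    "complex \<Rightarrow> (uq_gen free_algebra set, 'v) rep \<Rightarrow> complex \<Rightarrow> 'v \<Rightarrow> bool"
  where "highest_weight_vector q M l v \<longleftrightarrow>
    v \<in> carrier M \<and> v \<noteq> \<zero>\<^bsub>M\<^esub> \<and>
    act M (uq_e q) v = \<zero>\<^bsub>M\<^esub> \<and> act M (uq_k q) v = l \<odot>\<^bsub>M\<^esub> v"

text \<open>
  The Verma module lives on the finitely supported functions on \<^typ>\<open>nat\<close>, with basis vectors
  \<open>v\<^sub>i\<close> given by \<^term>\<open>Poly_Mapping.single i 1\<close>.
\<close>

fun verma_gen :: "complex \<Rightarrow> complex \<Rightarrow> uq_gen \<Rightarrow> nat \<Rightarrow> (nat \<Rightarrow>\<^sub>0 complex)"
  where
    "verma_gen q l GenK i = Poly_Mapping.single i (l * q powi (- 2 * int i))"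
  | "verma_gen q l GenKinv i = Poly_Mapping.single i (inverse l * q powi (2 * int i))"
  | "verma_gen q l GenE 0 = 0"
  | "verma_gen q l GenE (Suc i) =
       Poly_Mapping.single i ((l * q powi (- int i) - inverse l * q powi int i) / (q - inverse q))"
  | "verma_gen q l GenF i =
       Poly_Mapping.single (Suc i)
         ((q powi (int i + 1) - q powi (- int i - 1)) / (q - inverse q))"

definition linear_ext :: "('i \<Rightarrow> ('j \<Rightarrow>\<^sub>0 complex)) \<Rightarrow> ('i \<Rightarrow>\<^sub>0 complex) \<Rightarrow> ('j \<Rightarrow>\<^sub>0 complex)"
  where "linear_ext b v = (\<Sum>i\<in>Poly_Mapping.keys v. scale (Poly_Mapping.lookup v i) (b i))"

definition free_act ::
    "('g \<Rightarrow> ('i \<Rightarrow>\<^sub>0 complex) \<Rightarrow> ('i \<Rightarrow>\<^sub>0 complex)) \<Rightarrow> 'g free_algebra \<Rightarrow> ('i \<Rightarrow>\<^sub>0 complex) \<Rightarrow> ('i \<Rightarrow>\<^sub>0 complex)"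
  where "free_act ops p v =
    (\<Sum>w\<in>Poly_Mapping.keys p. scale (Poly_Mapping.lookup p w) (foldr ops (letters w) v))"

definition verma :: "complex \<Rightarrow> complex \<Rightarrow> (uq_gen free_algebra set, nat \<Rightarrow>\<^sub>0 complex) rep"
  where "verma q l =
    \<lparr>carrier = UNIV,
     monoid.mult = undefined,
     one = undefined,
     ring.zero = 0,
     add = (+),
     module.smult = scale,
     act = (\<lambda>h v. the_elem ((\<lambda>p. free_act (\<lambda>g. linear_ext (verma_gen q l g)) p v) ` h))\<rparr>"

end

theory Submission
  imports Defs
begin

text \<open>
  The raising operator \<open>f\<close> is complicated on monomials, but \<open>e\<close> is not: since
  \<open>e(ab) = a e(b) + e(a) k(b)\<close>, it sends \<open>x\<^sup>m y\<^sup>n\<close> to \<open>x\<^bsup>m-1\<^esup> y\<^sup>n\<close> times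
  \<open>a\<^sub>0 q\<^bsup>-n\<^esup> (1 + q\<^bsup>-2\<^esup> + \<dots> + q\<^bsup>-2(m-1)\<^esup>)\<close>, which is nonzero for \<open>m > 0\<close> because \<open>q\<close> is not a
  root of unity.  So \<open>e\<close> is surjective and locally nilpotent, and its kernel has the basis \<open>y\<^sup>n\<close>.
  Any family \<open>b(i, n)\<close> with \<open>b(0, n) = y\<^sup>n\<close> and \<open>e b(i+1, n)\<close> a nonzero multiple of \<open>b(i, n)\<close> is
  then a basis as well (\<open>lowering_basis\<close>), and the spans of its columns decompose the plane
  (\<open>internal_direct_sum_columns\<close>).

  Representation theory supplies such a family.  For \<open>n \<ge> 1\<close> the vector \<open>y\<^sup>n\<close> is a highest weight
  vector of weight \<open>q\<^bsup>-n\<^esup>\<close>, so its divided powers under \<open>f\<close> satisfy the formulas of the Verma module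
  (\<open>verma_vec_E\<close>, \<open>verma_hom\<close>), where the coefficients of \<open>e\<close> vanish nowhere; this also makes
  the Verma module simple (\<open>simple_rep_verma\<close>).  For \<open>n = 0\<close> the vector \<open>1\<close> is killed by \<open>f\<close>, so the
  column is continued through \<open>x\<close>: from \<open>e x = a\<^sub>0 1\<close> and \<open>f 1 = 0\<close> one gets \<open>f e x = 0\<close>, and
  this suffices for the Verma formulas above \<open>x\<close>.  The column \<open>1, x, f x, f\<^sup>2 x, \<dots>\<close> spans \<open>V\<^sub>0\<close>.  Modulo
  the constants \<open>x\<close> is a highest weight vector of weight \<open>q\<^bsup>-2\<^esup>\<close>, so the quotient is a simple Verma
  module.  A complement of the constants in \<open>V\<^sub>0\<close> would contain some \<open>x + d 1\<close>, and hence
  \<open>e (x + d 1) = a\<^sub>0 1\<close>, a constant.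

  Both the Verma module and the linear independence of the monomials come from one construction:
  operators that satisfy the relators of a presented algebra make a space of finitely supported
  functions into a representation (\<open>free_act_ideal\<close>, \<open>is_rep_free_act\<close>).  The operators of left
  multiplication by \<open>x\<close> and \<open>y\<close>, written on formal monomials, separate the monomials
  (\<open>inj_qp_poly\<close>).
\<close>

section \<open>Finitely supported functions as free vector spaces\<close>

lemma lookup_scale [simp]:
  "Poly_Mapping.lookup (scale c v) i = c * Poly_Mapping.lookup v i"
  by (simp add: map.rep_eq when_def)

lemma scale_add_right: "scale c (u + v) = scale c u + scale c v"
  by (rule poly_mapping_eqI) (simp add: lookup_add ring_distribs)

lemma scale_add_left: "scale (c + d) v = scale c v + scale d v"
  by (rule poly_mapping_eqI) (simp add: lookup_add ring_distribs)

lemma scale_scale: "scale c (scale d v) = scale (c * d) v"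
  by (rule poly_mapping_eqI) simp

lemma scale_one [simp]: "scale 1 v = v"
  by (rule poly_mapping_eqI) simp

lemma map_ident [simp]: "Poly_Mapping.map (\<lambda>a. a) v = v"
  by (rule poly_mapping_eqI) (simp add: map.rep_eq when_def)

lemma scale_zero_left [simp]: "scale 0 v = 0"
  by (rule poly_mapping_eqI) simp

lemma scale_zero_right [simp]: "scale c 0 = 0"
  by (rule poly_mapping_eqI) simp

lemma scale_single [simp]: "scale c (Poly_Mapping.single i d) = Poly_Mapping.single i (c * d)"
  by (rule poly_mapping_eqI) (simp add: lookup_single when_def)

lemma scale_minus_one: "scale (- 1) v = - v"
  by (rule poly_mapping_eqI) simp

lemma scale_diff_right: "scale c (u - v) = scale c u - scale c v"
  by (rule poly_mapping_eqI) (simp add: lookup_minus ring_distribs)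

lemma scale_mult_left: "scale c p * r = scale c (p * r)"
  by (simp add: mult_map_scale_conv_mult mult.assoc)

text \<open>
  Even over a non-commutative index monoid scalars commute with everything, because they sit at the
  neutral element.
\<close>

lemma single_zero_central:
  "p * Poly_Mapping.single 0 c = Poly_Mapping.single 0 c * (p :: 'm::monoid_add \<Rightarrow>\<^sub>0 complex)"
proof (induction p rule: update_induct)
  case const
  then show ?case by simp
next
  case (update f a b)
  have "Poly_Mapping.update a b f = f + Poly_Mapping.single a b"
    using update(1) by (intro poly_mapping_eqI)
      (auto simp: lookup_update lookup_add lookup_single when_def in_keys_iff)
  then show ?case
    using update(3) by (simp add: distrib_left distrib_right mult_single mult.commute)
qed

lemma scale_mult_right: "p * scale c r = scale c (p * r)"
  by (simp add: mult_map_scale_conv_mult mult.assoc[symmetric] single_zero_central)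

lemma finitely_supported_induct [case_names single add]:
  assumes single: "\<And>i c. P (Poly_Mapping.single i c)"
    and add: "\<And>u v. P u \<Longrightarrow> P v \<Longrightarrow> P (u + v)"
  shows "P (v :: 'i \<Rightarrow>\<^sub>0 complex)"
proof (induction v rule: update_induct)
  case const
  then show ?case using single[of undefined 0] by simp
next
  case (update f a b)
  have "Poly_Mapping.update a b f = f + Poly_Mapping.single a b"
    using update(1) by (intro poly_mapping_eqI)
      (auto simp: lookup_update lookup_add lookup_single when_def in_keys_iff)
  then show ?case using update(3) single add by simp
qed

definition clinear :: "(('i \<Rightarrow>\<^sub>0 complex) \<Rightarrow> ('j \<Rightarrow>\<^sub>0 complex)) \<Rightarrow> bool"
  where "clinear T \<longleftrightarrow> (\<forall>u v. T (u + v) = T u + T v) \<and> (\<forall>c v. T (scale c v) = scale c (T v))"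

lemma clinearI:
  "(\<And>u v. T (u + v) = T u + T v) \<Longrightarrow> (\<And>c v. T (scale c v) = scale c (T v)) \<Longrightarrow> clinear T"
  by (simp add: clinear_def)

lemma clinear_add: "clinear T \<Longrightarrow> T (u + v) = T u + T v"
  and clinear_scale: "clinear T \<Longrightarrow> T (scale c v) = scale c (T v)"
  by (simp_all add: clinear_def)

lemma clinear_zero: "clinear T \<Longrightarrow> T 0 = 0"
  using clinear_scale[of T 0 0] by simp

lemma clinear_diff: "clinear T \<Longrightarrow> T (u - v) = T u - T v"
  using clinear_add[of T u "scale (- 1) v"] clinear_scale[of T "- 1" v]
  by (simp add: scale_minus_one)

lemma clinear_eqI:
  assumes "clinear S" "clinear T" "\<And>i. S (Poly_Mapping.single i 1) = T (Poly_Mapping.single i 1)"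
  shows "S = T"
proof
  fix v show "S v = T v"
  proof (induction v rule: finitely_supported_induct)
    case (single i c)
    have "Poly_Mapping.single i c = scale c (Poly_Mapping.single i 1)" by simp
    then show ?case using assms by (metis clinear_scale)
  qed (simp add: assms clinear_add)
qed

lemma clinear_comp: "clinear S \<Longrightarrow> clinear T \<Longrightarrow> clinear (\<lambda>v. S (T v))"
  by (simp add: clinear_def)

lemma linear_ext_superset:
  assumes "finite A" "Poly_Mapping.keys v \<subseteq> A"
  shows "linear_ext b v = (\<Sum>i\<in>A. scale (Poly_Mapping.lookup v i) (b i))"
  unfolding linear_ext_def
  by (rule sum.mono_neutral_left) (use assms in \<open>auto simp: in_keys_iff\<close>)

lemma scale_sum_right: "scale c (\<Sum>i\<in>A. f i) = (\<Sum>i\<in>A. scale c (f i))"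
  by (induction A rule: infinite_finite_induct) (simp_all add: scale_add_right)

lemma clinear_linear_ext: "clinear (linear_ext b)"
proof (rule clinearI)
  fix u v :: "'a \<Rightarrow>\<^sub>0 complex" and c
  let ?A = "Poly_Mapping.keys u \<union> Poly_Mapping.keys v"
  show "linear_ext b (u + v) = linear_ext b u + linear_ext b v"
    by (subst (1 2 3) linear_ext_superset[where A = ?A])
      (use keys_add[of u v] in \<open>auto simp: lookup_add scale_add_left sum.distrib\<close>)
  show "linear_ext b (scale c v) = scale c (linear_ext b v)"
    by (subst (1 2) linear_ext_superset[where A = "Poly_Mapping.keys v"])
      (auto simp: in_keys_iff scale_sum_right scale_scale)
qed

lemma linear_ext_single [simp]: "linear_ext b (Poly_Mapping.single i c) = scale c (b i)"
  by (cases "c = 0") (simp_all add: linear_ext_def)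

section \<open>Complex vector spaces as records\<close>

lemma complex_ring_simps [simp]:
  "carrier \<CC> = UNIV" "\<one>\<^bsub>\<CC>\<^esub> = (1 :: complex)" "\<zero>\<^bsub>\<CC>\<^esub> = (0 :: complex)"
  "a \<otimes>\<^bsub>\<CC>\<^esub> b = (a * b :: complex)" "a \<oplus>\<^bsub>\<CC>\<^esub> b = (a + b :: complex)"
  by (simp_all add: ring_of_type_algebra_def)

locale complex_space = module "\<CC> :: complex ring" M
  for M :: "(complex, 'v, 'm) module_scheme" (structure)
begin

lemma smult_in [simp, intro]: "v \<in> carrier M \<Longrightarrow> c \<odot> v \<in> carrier M"
  by (rule smult_closed) simp_all

lemma smult_add: "v \<in> carrier M \<Longrightarrow> (c + d) \<odot> v = c \<odot> v \<oplus> d \<odot> v"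
  using smult_l_distr[of c d v] by simp

lemma smult_vadd: "u \<in> carrier M \<Longrightarrow> v \<in> carrier M \<Longrightarrow> c \<odot> (u \<oplus> v) = c \<odot> u \<oplus> c \<odot> v"
  using smult_r_distr[of c u v] by simp

lemma smult_smult: "v \<in> carrier M \<Longrightarrow> c \<odot> (d \<odot> v) = (c * d) \<odot> v"
  using smult_assoc1[of c d v] by simp

lemma smult_1 [simp]: "v \<in> carrier M \<Longrightarrow> 1 \<odot> v = v"
  using smult_one[of v] by simp

lemma smult_0 [simp]: "v \<in> carrier M \<Longrightarrow> 0 \<odot> v = \<zero>"
  using smult_l_null[of v] by simp

lemma smult_zero [simp]: "c \<odot> \<zero> = \<zero>"
  using smult_r_null[of c] by simp

lemma smult_minus_one: "v \<in> carrier M \<Longrightarrow> (- 1) \<odot> v = \<ominus> v"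
  using smult_add[of v "-1" 1] M.minus_equality[of "(-1) \<odot> v" v] by simp

lemma smult_eq_zeroD: "v \<in> carrier M \<Longrightarrow> c \<odot> v = \<zero> \<Longrightarrow> c = 0 \<or> v = \<zero>"
  using smult_smult[of v "inverse c" c] by (cases "c = 0") simp_all

lemma complex_submoduleI:
  assumes "N \<subseteq> carrier M" "\<zero> \<in> N" "\<And>u v. u \<in> N \<Longrightarrow> v \<in> N \<Longrightarrow> u \<oplus> v \<in> N"
    and smult: "\<And>c v. v \<in> N \<Longrightarrow> c \<odot> v \<in> N"
  shows "submodule N \<CC> M"
proof (rule submoduleI)
  show "\<ominus> v \<in> N" if "v \<in> N" for v
    using smult[OF that, of "- 1"] smult_minus_one[of v] assms(1) that by auto
qed (use assms in auto)

lemma submodule_zero: "submodule N \<CC> M \<Longrightarrow> \<zero> \<in> N"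
  using submodule.axioms(1) subgroup.one_closed by fastforce

lemma submodule_smult: "submodule N \<CC> M \<Longrightarrow> v \<in> N \<Longrightarrow> c \<odot> v \<in> N"
  using submoduleE(4) by simp

end

text \<open>
  The axioms of a vector space are equations, so they pass to the image of a map that respects the
  operations.  Quotients by submodules and by relators are treated in this way.
\<close>

lemma complex_space_image:
  assumes M: "complex_space M"
    and carr: "carrier N = f ` carrier M"
    and add: "\<And>u v. u \<in> carrier M \<Longrightarrow> v \<in> carrier M \<Longrightarrow> f u \<oplus>\<^bsub>N\<^esub> f v = f (u \<oplus>\<^bsub>M\<^esub> v)"
    and zeroN: "\<zero>\<^bsub>N\<^esub> = f \<zero>\<^bsub>M\<^esub>"
    and smult: "\<And>c v. v \<in> carrier M \<Longrightarrow> c \<odot>\<^bsub>N\<^esub> f v = f (c \<odot>\<^bsub>M\<^esub> v)"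
  shows "complex_space N"
proof -
  interpret complex_space M by fact
  show ?thesis
    unfolding complex_space_def
  proof (rule moduleI)
    show "cring (\<CC> :: complex ring)" by (rule R.is_cring)
    show "abelian_group N"
    proof (rule abelian_groupI)
      fix x assume "x \<in> carrier N"
      then obtain u where u: "u \<in> carrier M" "x = f u" using carr by auto
      show "\<exists>y\<in>carrier N. y \<oplus>\<^bsub>N\<^esub> x = \<zero>\<^bsub>N\<^esub>"
        using u by (intro bexI[of _ "f (\<ominus>\<^bsub>M\<^esub> u)"]) (auto simp: add zeroN carr M.l_neg)
    qed (auto simp: carr add zeroN M.a_ac)
  qed (auto simp: carr add smult smult_add smult_vadd smult_smult)
qed

lemma linear_mapI:
  assumes "\<And>v. v \<in> carrier V \<Longrightarrow> f v \<in> carrier W"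
    and "\<And>u v. u \<in> carrier V \<Longrightarrow> v \<in> carrier V \<Longrightarrow> f (u \<oplus>\<^bsub>V\<^esub> v) = f u \<oplus>\<^bsub>W\<^esub> f v"
    and "\<And>c v. v \<in> carrier V \<Longrightarrow> f (c \<odot>\<^bsub>V\<^esub> v) = c \<odot>\<^bsub>W\<^esub> f v"
  shows "linear_map V W f"
  using assms by (auto simp: linear_map_def)

lemma linear_map_closed: "linear_map V W f \<Longrightarrow> v \<in> carrier V \<Longrightarrow> f v \<in> carrier W"
  and linear_map_add: "linear_map V W f \<Longrightarrow> u \<in> carrier V \<Longrightarrow> v \<in> carrier V \<Longrightarrow>
    f (u \<oplus>\<^bsub>V\<^esub> v) = f u \<oplus>\<^bsub>W\<^esub> f v"
  and linear_map_smult: "linear_map V W f \<Longrightarrow> v \<in> carrier V \<Longrightarrow> f (c \<odot>\<^bsub>V\<^esub> v) = c \<odot>\<^bsub>W\<^esub> f v"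
  by (auto simp: linear_map_def)

lemma linear_map_zero:
  assumes "complex_space V" "complex_space W" "linear_map V W f"
  shows "f \<zero>\<^bsub>V\<^esub> = \<zero>\<^bsub>W\<^esub>"
proof -
  interpret V: complex_space V by fact
  interpret W: complex_space W by fact
  have "f (0 \<odot>\<^bsub>V\<^esub> \<zero>\<^bsub>V\<^esub>) = 0 \<odot>\<^bsub>W\<^esub> f \<zero>\<^bsub>V\<^esub>"
    using assms(3) V.M.zero_closed by (rule linear_map_smult)
  then show ?thesis using linear_map_closed[OF assms(3) V.M.zero_closed] by simp
qed

lemma monoid_algebra_simps [simp]:
  "carrier monoid_algebra = UNIV" "p \<otimes>\<^bsub>monoid_algebra\<^esub> r = p * r" "\<one>\<^bsub>monoid_algebra\<^esub> = 1"
  "\<zero>\<^bsub>monoid_algebra\<^esub> = 0" "p \<oplus>\<^bsub>monoid_algebra\<^esub> r = p + r" "c \<odot>\<^bsub>monoid_algebra\<^esub> p = scale c p"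
  by (simp_all add: monoid_algebra_def)

lemma complex_space_poly_mapping:
  assumes [simp]: "carrier V = UNIV" "\<And>u v. u \<oplus>\<^bsub>V\<^esub> v = u + v" "\<zero>\<^bsub>V\<^esub> = 0"
    "\<And>c v. c \<odot>\<^bsub>V\<^esub> v = scale c v"
  shows "complex_space V"
  unfolding complex_space_def
proof (rule moduleI)
  show "cring (\<CC> :: complex ring)" by (rule cring_from_type_algebra)
  show "abelian_group V"
  proof (rule abelian_groupI)
    show "\<exists>y\<in>carrier V. y \<oplus>\<^bsub>V\<^esub> x = \<zero>\<^bsub>V\<^esub>" for x
      by (rule bexI[of _ "- x"]) simp_all
  qed (simp_all add: add.assoc add.commute)
qed (simp_all add: scale_add_left scale_add_right scale_scale)

lemma complex_space_monoid_algebra: "complex_space monoid_algebra"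
  by (rule complex_space_poly_mapping) simp_all

text \<open>
  As a vector space, \<^const>\<open>monoid_algebra\<close> is the free space on its index type; this is the role
  it has as the source of linear maps below.
\<close>

lemma linear_map_monoid_algebra_iff:
  "linear_map monoid_algebra M f \<longleftrightarrow>
    (\<forall>v. f v \<in> carrier M) \<and> (\<forall>u v. f (u + v) = f u \<oplus>\<^bsub>M\<^esub> f v) \<and>
    (\<forall>c v. f (scale c v) = c \<odot>\<^bsub>M\<^esub> f v)"
  by (auto simp: linear_map_def)

lemma linear_map_monoid_algebra_eqI:
  fixes f g :: "('i::monoid_add \<Rightarrow>\<^sub>0 complex) \<Rightarrow> 'v"
  assumes f: "linear_map monoid_algebra M f" and g: "linear_map monoid_algebra M g"
    and eq: "\<And>i. f (Poly_Mapping.single i 1) = g (Poly_Mapping.single i 1)"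
  shows "f v = g v"
proof (induction v rule: finitely_supported_induct)
  case (single i c)
  have "f (scale c (Poly_Mapping.single i 1)) = g (scale c (Poly_Mapping.single i 1))"
    using f g eq[of i] by (simp only: linear_map_monoid_algebra_iff)
  then show ?case by simp
next
  case (add u v)
  then show ?case using f g by (simp only: linear_map_monoid_algebra_iff)
qed

lemma linear_map_comp:
  assumes f: "linear_map V W f" and g: "linear_map W Z g"
  shows "linear_map V Z (\<lambda>v. g (f v))"
  by (intro linear_mapI)
    (simp_all add: linear_map_closed[OF f] linear_map_add[OF f] linear_map_smult[OF f]
      linear_map_closed[OF g] linear_map_add[OF g] linear_map_smult[OF g])

lemma linear_map_clinear:
  "clinear T \<Longrightarrow> linear_map monoid_algebra monoid_algebra T"
  by (simp add: linear_map_monoid_algebra_iff clinear_def)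

text \<open>
  The counterpart of \<^const>\<open>linear_ext\<close> for an abstract target space.
\<close>

definition lin_comb :: "(complex, 'v, 'm) module_scheme \<Rightarrow> ('i \<Rightarrow> 'v) \<Rightarrow> ('i \<Rightarrow>\<^sub>0 complex) \<Rightarrow> 'v"
  where "lin_comb M b v =
    (\<Oplus>\<^bsub>M\<^esub>i\<in>Poly_Mapping.keys v. Poly_Mapping.lookup v i \<odot>\<^bsub>M\<^esub> b i)"

context complex_space
begin

lemma lin_comb_superset:
  assumes "\<And>i. b i \<in> carrier M" "finite A" "Poly_Mapping.keys v \<subseteq> A"
  shows "lin_comb M b v = (\<Oplus>i\<in>A. Poly_Mapping.lookup v i \<odot> b i)"
  unfolding lin_comb_def
  by (rule M.add.finprod_mono_neutral_cong_left) (use assms in \<open>auto simp: in_keys_iff\<close>)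

lemma lin_comb_single [simp]:
  assumes "\<And>i. b i \<in> carrier M"
  shows "lin_comb M b (Poly_Mapping.single i c) = c \<odot> b i"
  using lin_comb_superset[OF assms, of "{i}" "Poly_Mapping.single i c"] assms by simp

lemma linear_map_lin_comb:
  fixes b :: "'i::monoid_add \<Rightarrow> 'v"
  assumes b: "\<And>i. b i \<in> carrier M"
  shows "linear_map monoid_algebra M (lin_comb M b)"
proof (rule linear_mapI)
  fix u v :: "'i \<Rightarrow>\<^sub>0 complex" and c
  let ?A = "Poly_Mapping.keys u \<union> Poly_Mapping.keys v"
  show "lin_comb M b v \<in> carrier M"
    using b by (auto simp: lin_comb_def)
  have "lin_comb M b (u + v) = lin_comb M b u \<oplus> lin_comb M b v"
    using keys_add[of u v] b
    by (simp add: lin_comb_superset[OF b, where A = ?A] lookup_add smult_add Pi_def)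
  then show "lin_comb M b (u \<oplus>\<^bsub>monoid_algebra\<^esub> v) = lin_comb M b u \<oplus> lin_comb M b v" by simp
  have "lin_comb M b (scale c v) = c \<odot> lin_comb M b v"
    using b lin_comb_superset[OF b, of "Poly_Mapping.keys v"]
    by (simp add: lin_comb_superset[OF b, where A = "Poly_Mapping.keys v"] subset_iff in_keys_iff
        finsum_smult_ldistr smult_smult Pi_def)
  then show "lin_comb M b (c \<odot>\<^bsub>monoid_algebra\<^esub> v) = c \<odot> lin_comb M b v" by simp
qed

lemma lin_comb_in_submodule:
  assumes "submodule N \<CC> M" "\<And>i. i \<in> Poly_Mapping.keys v \<Longrightarrow> b i \<in> N"
  shows "lin_comb M b v \<in> N"
proof -
  have "(\<Oplus>i\<in>A. Poly_Mapping.lookup v i \<odot> b i) \<in> N" if "finite A" "\<And>i. i \<in> A \<Longrightarrow> b i \<in> N" for A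
    using that
  proof (induction A rule: finite_induct)
    case empty
    then show ?case using submodule_zero[OF assms(1)] by simp
  next
    case (insert i A)
    then have "b j \<in> carrier M" if "j \<in> insert i A" for j
      using that submoduleE(1)[OF assms(1)] by auto
    then show ?case
      using insert submoduleE(5)[OF assms(1)] submodule_smult[OF assms(1)]
      by (subst M.finsum_insert) auto
  qed
  then show ?thesis using assms(2) by (simp add: lin_comb_def)
qed

end

context complex_space
begin

lemma submodule_abelian_subgroup: "submodule N \<CC> M \<Longrightarrow> abelian_subgroup N M"
  by (intro abelian_subgroupI3 additive_subgroupI submodule.axioms(1) M.abelian_group_axioms)

lemma coset_self: "submodule N \<CC> M \<Longrightarrow> v \<in> carrier M \<Longrightarrow> v \<in> N +> v"
  by (rule abelian_subgroup.a_rcos_self[OF submodule_abelian_subgroup])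

lemma coset_eq_iff:
  assumes N: "submodule N \<CC> M" and "u \<in> carrier M" "v \<in> carrier M"
  shows "N +> u = N +> v \<longleftrightarrow> u \<oplus> (- 1) \<odot> v \<in> N"
proof
  assume "N +> u = N +> v"
  then have "u \<in> N +> v" using coset_self[OF N assms(2)] by simp
  then obtain n where n: "n \<in> N" "u = n \<oplus> v" by (auto simp: a_r_coset_def')
  then have "n \<in> carrier M" using submoduleE(1)[OF N] by auto
  then show "u \<oplus> (- 1) \<odot> v \<in> N"
    using n assms by (simp add: smult_minus_one M.a_assoc M.r_neg)
next
  assume "u \<oplus> (- 1) \<odot> v \<in> N"
  moreover have "u = (u \<oplus> (- 1) \<odot> v) \<oplus> v"
    using assms by (simp add: smult_minus_one M.a_assoc M.l_neg)
  ultimately have "u \<in> N +> v" by (auto simp: a_r_coset_def')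
  then show "N +> u = N +> v"
    using M.a_repr_independence[OF _ assms(3) submodule.axioms(1)[OF N]] by simp
qed

lemma coset_add:
  assumes "submodule N \<CC> M" and "u \<in> carrier M" "v \<in> carrier M"
  shows "(N +> u) <+> (N +> v) = N +> (u \<oplus> v)"
  by (rule abelian_subgroup.a_rcos_sum[OF submodule_abelian_subgroup]) fact+

lemma coset_zero: "submodule N \<CC> M \<Longrightarrow> N +> \<zero> = N"
  by (rule abelian_subgroup.a_rcos_const[OF submodule_abelian_subgroup submodule_zero])

text \<open>
  The operations of a quotient representation are given as unions over a coset; for a linear map
  that preserves the submodule, all members of the union coincide.
\<close>

lemma coset_map:
  assumes N: "submodule N \<CC> M" and f: "linear_map M M f" "f ` N \<subseteq> N" and v: "v \<in> carrier M"
  shows "(\<Union>x\<in>N +> v. N +> f x) = N +> f v"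
proof -
  have "N +> f x = N +> f v" if x: "x \<in> N +> v" for x
  proof -
    obtain n where n: "n \<in> N" "x = n \<oplus> v" using x by (auto simp: a_r_coset_def')
    then have nc: "n \<in> carrier M" using submoduleE(1)[OF N] by auto
    have "f x = f n \<oplus> f v" using n nc v linear_map_add[OF f(1)] by simp
    moreover have "f n \<in> N" using n f(2) by auto
    ultimately have "f x \<in> N +> f v" by (auto simp: a_r_coset_def')
    then show ?thesis
      using M.a_repr_independence[OF _ linear_map_closed[OF f(1) v] submodule.axioms(1)[OF N]]
      by simp
  qed
  then show ?thesis using coset_self[OF N v] by blast
qed

end

section \<open>Representations\<close>

lemma is_rep_space: "is_rep U M \<Longrightarrow> complex_space M"
  by (simp add: is_rep_def complex_space_def)

lemma is_repI:
  assumes "complex_space M"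
    and "\<And>h. h \<in> carrier U \<Longrightarrow> linear_map M M (act M h)"
    and "\<And>h. h \<in> carrier U \<Longrightarrow> act M h \<in> extensional (carrier M)"
    and "\<And>h h' v. h \<in> carrier U \<Longrightarrow> h' \<in> carrier U \<Longrightarrow> v \<in> carrier M \<Longrightarrow>
      act M (h \<otimes>\<^bsub>U\<^esub> h') v = act M h (act M h' v)"
    and "\<And>h h' v. h \<in> carrier U \<Longrightarrow> h' \<in> carrier U \<Longrightarrow> v \<in> carrier M \<Longrightarrow>
      act M (h \<oplus>\<^bsub>U\<^esub> h') v = act M h v \<oplus>\<^bsub>M\<^esub> act M h' v"
    and "\<And>c h v. h \<in> carrier U \<Longrightarrow> v \<in> carrier M \<Longrightarrow>
      act M (c \<odot>\<^bsub>U\<^esub> h) v = c \<odot>\<^bsub>M\<^esub> act M h v"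
    and "\<And>v. v \<in> carrier M \<Longrightarrow> act M \<one>\<^bsub>U\<^esub> v = v"
    and U: "\<And>h h'. h \<in> carrier U \<Longrightarrow> h' \<in> carrier U \<Longrightarrow> h \<otimes>\<^bsub>U\<^esub> h' \<in> carrier U"
      "\<And>h h'. h \<in> carrier U \<Longrightarrow> h' \<in> carrier U \<Longrightarrow> h \<oplus>\<^bsub>U\<^esub> h' \<in> carrier U"
      "\<And>c h. h \<in> carrier U \<Longrightarrow> c \<odot>\<^bsub>U\<^esub> h \<in> carrier U" "\<one>\<^bsub>U\<^esub> \<in> carrier U"
  shows "is_rep U M"
  unfolding is_rep_def alg_hom_def
proof (intro conjI CollectI ring_hom_memI allI ballI)
  show "Module.module \<CC> M" using assms(1) by (simp add: complex_space_def)
  fix h h' c assume h: "h \<in> carrier U"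
  then show "act M h \<in> carrier (End_alg M)" by (simp add: End_alg_def assms)
  show "act M (c \<odot>\<^bsub>U\<^esub> h) = c \<odot>\<^bsub>End_alg M\<^esub> act M h"
    by (rule extensionalityI[where A = "carrier M"]) (simp_all add: End_alg_def assms h)
  assume h': "h' \<in> carrier U"
  show "act M (h \<otimes>\<^bsub>U\<^esub> h') = act M h \<otimes>\<^bsub>End_alg M\<^esub> act M h'"
    by (rule extensionalityI[where A = "carrier M"]) (simp_all add: End_alg_def assms h h' compose_def)
  show "act M (h \<oplus>\<^bsub>U\<^esub> h') = act M h \<oplus>\<^bsub>End_alg M\<^esub> act M h'"
    by (rule extensionalityI[where A = "carrier M"]) (simp_all add: End_alg_def assms h h')
next
  show "act M \<one>\<^bsub>U\<^esub> = \<one>\<^bsub>End_alg M\<^esub>"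
    by (rule extensionalityI[where A = "carrier M"]) (simp_all add: End_alg_def assms)
qed

lemma
  assumes M: "is_rep U M" and h: "h \<in> carrier U"
  shows act_linear: "linear_map M M (act M h)"
    and act_smult: "v \<in> carrier M \<Longrightarrow> act M (c \<odot>\<^bsub>U\<^esub> h) v = c \<odot>\<^bsub>M\<^esub> act M h v"
    and act_mult: "h' \<in> carrier U \<Longrightarrow> v \<in> carrier M \<Longrightarrow>
      act M (h \<otimes>\<^bsub>U\<^esub> h') v = act M h (act M h' v)"
    and act_add: "h' \<in> carrier U \<Longrightarrow> v \<in> carrier M \<Longrightarrow>
      act M (h \<oplus>\<^bsub>U\<^esub> h') v = act M h v \<oplus>\<^bsub>M\<^esub> act M h' v"
proof -
  have R: "act M \<in> ring_hom U (End_alg M)"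
    and S: "act M (c \<odot>\<^bsub>U\<^esub> h) = c \<odot>\<^bsub>End_alg M\<^esub> act M h"
    using M h by (auto simp: is_rep_def alg_hom_def)
  show "linear_map M M (act M h)"
    using ring_hom_closed[OF R h] by (simp add: End_alg_def)
  show "v \<in> carrier M \<Longrightarrow> act M (c \<odot>\<^bsub>U\<^esub> h) v = c \<odot>\<^bsub>M\<^esub> act M h v"
    by (simp add: S End_alg_def)
  show "h' \<in> carrier U \<Longrightarrow> v \<in> carrier M \<Longrightarrow> act M (h \<otimes>\<^bsub>U\<^esub> h') v = act M h (act M h' v)"
    using ring_hom_mult[OF R h] by (simp add: End_alg_def compose_def)
  show "h' \<in> carrier U \<Longrightarrow> v \<in> carrier M \<Longrightarrow>
      act M (h \<oplus>\<^bsub>U\<^esub> h') v = act M h v \<oplus>\<^bsub>M\<^esub> act M h' v"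
    using ring_hom_add[OF R h] by (simp add: End_alg_def)
qed

lemma act_one: "is_rep U M \<Longrightarrow> v \<in> carrier M \<Longrightarrow> act M \<one>\<^bsub>U\<^esub> v = v"
  by (auto simp: is_rep_def alg_hom_def End_alg_def dest: ring_hom_one)

lemma act_closed: "is_rep U M \<Longrightarrow> h \<in> carrier U \<Longrightarrow> v \<in> carrier M \<Longrightarrow> act M h v \<in> carrier M"
  by (rule linear_map_closed[OF act_linear])

text \<open>
  The acting algebra enters the transport of representations through the closure of its carrier under
  the operations, which for presented algebras is immediate.
\<close>

locale algebra_ops =
  fixes U :: "(complex, 'u) module"
  assumes mult_in: "\<And>h h'. h \<in> carrier U \<Longrightarrow> h' \<in> carrier U \<Longrightarrow> h \<otimes>\<^bsub>U\<^esub> h' \<in> carrier U"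
    and add_in: "\<And>h h'. h \<in> carrier U \<Longrightarrow> h' \<in> carrier U \<Longrightarrow> h \<oplus>\<^bsub>U\<^esub> h' \<in> carrier U"
    and smult_in: "\<And>c h. h \<in> carrier U \<Longrightarrow> c \<odot>\<^bsub>U\<^esub> h \<in> carrier U"
    and one_in: "\<one>\<^bsub>U\<^esub> \<in> carrier U"
begin

lemma is_rep_image:
  assumes M: "is_rep U M"
    and carr: "carrier N = f ` carrier M"
    and add: "\<And>u v. u \<in> carrier M \<Longrightarrow> v \<in> carrier M \<Longrightarrow> f u \<oplus>\<^bsub>N\<^esub> f v = f (u \<oplus>\<^bsub>M\<^esub> v)"
    and zeroN: "\<zero>\<^bsub>N\<^esub> = f \<zero>\<^bsub>M\<^esub>"
    and smult: "\<And>c v. v \<in> carrier M \<Longrightarrow> c \<odot>\<^bsub>N\<^esub> f v = f (c \<odot>\<^bsub>M\<^esub> v)"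
    and act: "\<And>h v. h \<in> carrier U \<Longrightarrow> v \<in> carrier M \<Longrightarrow> act N h (f v) = f (act M h v)"
    and ext: "\<And>h. h \<in> carrier U \<Longrightarrow> act N h \<in> extensional (carrier N)"
  shows "is_rep U N"
proof (rule is_repI)
  interpret M: complex_space M using M by (rule is_rep_space)
  note simps = M.smult_in act add smult act_closed[OF M] act_mult[OF M] act_add[OF M] act_smult[OF M]
    act_one[OF M] mult_in add_in smult_in one_in
  show "complex_space N"
    using M.complex_space_axioms carr add zeroN smult by (rule complex_space_image)
  show "linear_map N N (act N h)" if "h \<in> carrier U" for h
  proof (rule linear_mapI)
    fix v assume "v \<in> carrier N"
    then obtain v' where v: "v' \<in> carrier M" "v = f v'" using carr by auto
    show "act N h v \<in> carrier N" using v that by (simp add: carr act act_closed[OF M])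
    show "act N h (c \<odot>\<^bsub>N\<^esub> v) = c \<odot>\<^bsub>N\<^esub> act N h v" for c
      using v that by (simp only: simps linear_map_smult[OF act_linear[OF M that]])
    fix u assume "u \<in> carrier N"
    then obtain u' where u: "u' \<in> carrier M" "u = f u'" using carr by auto
    show "act N h (u \<oplus>\<^bsub>N\<^esub> v) = act N h u \<oplus>\<^bsub>N\<^esub> act N h v"
      using u v that by (simp only: simps M.M.a_closed linear_map_add[OF act_linear[OF M that]])
  qed
  show "act N h \<in> extensional (carrier N)" if "h \<in> carrier U" for h
    using that by (rule ext)
  fix h h' v c assume h: "h \<in> carrier U" and "v \<in> carrier N"
  then obtain u where u: "u \<in> carrier M" "v = f u" using carr by auto
  show "act N (c \<odot>\<^bsub>U\<^esub> h) v = c \<odot>\<^bsub>N\<^esub> act N h v"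
    using h u by (simp only: simps)
  assume h': "h' \<in> carrier U"
  show "act N (h \<otimes>\<^bsub>U\<^esub> h') v = act N h (act N h' v)"
    "act N (h \<oplus>\<^bsub>U\<^esub> h') v = act N h v \<oplus>\<^bsub>N\<^esub> act N h' v"
    using h h' u by (simp_all only: simps)
next
  show "act N \<one>\<^bsub>U\<^esub> v = v" if "v \<in> carrier N" for v
    using that unfolding carr by (auto simp only: act one_in act_one[OF M])
qed (fact mult_in add_in smult_in one_in)+

end

lemma
  assumes M: "is_rep U M" and N: "subrep U M N"
  shows subrep_submodule: "submodule N \<CC> M"
    and subrep_subset: "N \<subseteq> carrier M"
    and subrep_act: "h \<in> carrier U \<Longrightarrow> v \<in> N \<Longrightarrow> act M h v \<in> N"
proof -
  interpret complex_space M using M by (rule is_rep_space)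
  show *: "submodule N \<CC> M" using N by (simp add: subrep_def)
  show "N \<subseteq> carrier M" using submoduleE(1)[OF *] .
  show "h \<in> carrier U \<Longrightarrow> v \<in> N \<Longrightarrow> act M h v \<in> N" using N by (simp add: subrep_def)
qed

lemma sub_rep_simps [simp]:
  "carrier (sub_rep M N) = N" "\<zero>\<^bsub>sub_rep M N\<^esub> = \<zero>\<^bsub>M\<^esub>" "u \<oplus>\<^bsub>sub_rep M N\<^esub> v = u \<oplus>\<^bsub>M\<^esub> v"
  "c \<odot>\<^bsub>sub_rep M N\<^esub> v = c \<odot>\<^bsub>M\<^esub> v" "act (sub_rep M N) h = restrict (act M h) N"
  by (simp_all add: sub_rep_def)

lemma
  fixes M :: "('u, 'v) rep" (structure)
  assumes M: "is_rep U M" and N: "subrep U M N"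
  shows quot_rep_carrier: "carrier (quot_rep M N) = (\<lambda>v. N +>\<^bsub>M\<^esub> v) ` carrier M"
    and quot_rep_add: "u \<in> carrier M \<Longrightarrow> v \<in> carrier M \<Longrightarrow>
      (N +>\<^bsub>M\<^esub> u) \<oplus>\<^bsub>quot_rep M N\<^esub> (N +>\<^bsub>M\<^esub> v) = N +>\<^bsub>M\<^esub> (u \<oplus>\<^bsub>M\<^esub> v)"
    and quot_rep_zero: "\<zero>\<^bsub>quot_rep M N\<^esub> = N +>\<^bsub>M\<^esub> \<zero>\<^bsub>M\<^esub>"
    and quot_rep_smult: "v \<in> carrier M \<Longrightarrow>
      c \<odot>\<^bsub>quot_rep M N\<^esub> (N +>\<^bsub>M\<^esub> v) = N +>\<^bsub>M\<^esub> (c \<odot>\<^bsub>M\<^esub> v)"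
    and quot_rep_act: "h \<in> carrier U \<Longrightarrow> v \<in> carrier M \<Longrightarrow>
      act (quot_rep M N) h (N +>\<^bsub>M\<^esub> v) = N +>\<^bsub>M\<^esub> act M h v"
proof -
  interpret complex_space M using M by (rule is_rep_space)
  note N' = subrep_submodule[OF M N]
  show "carrier (quot_rep M N) = (\<lambda>v. N +> v) ` carrier M"
    by (auto simp: quot_rep_def A_RCOSETS_def')
  show "u \<in> carrier M \<Longrightarrow> v \<in> carrier M \<Longrightarrow> (N +> u) \<oplus>\<^bsub>quot_rep M N\<^esub> (N +> v) = N +> (u \<oplus> v)"
    using coset_add[OF N'] by (simp add: quot_rep_def)
  show "\<zero>\<^bsub>quot_rep M N\<^esub> = N +> \<zero>"
    using coset_zero[OF N'] by (simp add: quot_rep_def)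
  show "c \<odot>\<^bsub>quot_rep M N\<^esub> (N +> v) = N +> (c \<odot> v)" if v: "v \<in> carrier M"
  proof -
    have "linear_map M M (\<lambda>v. c \<odot> v)"
      by (rule linear_mapI) (auto simp: smult_vadd smult_smult mult.commute)
    from coset_map[OF N' this _ v] show ?thesis
      using submodule_smult[OF N'] by (auto simp: quot_rep_def)
  qed
  show "act (quot_rep M N) h (N +> v) = N +> act M h v" if h: "h \<in> carrier U" and v: "v \<in> carrier M"
  proof -
    have "N +> v \<in> a_rcosets N" using v by (auto simp: A_RCOSETS_def')
    moreover have "act M h ` N \<subseteq> N" using subrep_act[OF M N h] by auto
    ultimately show ?thesis
      using coset_map[OF N' act_linear[OF M h] _ v] by (simp add: quot_rep_def)
  qed
qed

context algebra_ops
begin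

lemma is_rep_sub_rep:
  assumes M: "is_rep U M" and N: "subrep U M N"
  shows "is_rep U (sub_rep M N)"
proof (rule is_repI)
  interpret complex_space M using M by (rule is_rep_space)
  note sub = subrep_subset[OF M N]
  then have in_M: "v \<in> carrier M" if "v \<in> N" for v using that by auto
  have "Module.module \<CC> (M\<lparr>carrier := N\<rparr>)"
    using submodule.submodule_is_module[OF subrep_submodule[OF M N]] module_axioms by auto
  then interpret N: complex_space "M\<lparr>carrier := N\<rparr>" by (simp add: complex_space_def)
  show "complex_space (sub_rep M N)"
    by (rule complex_space_image[of "M\<lparr>carrier := N\<rparr>" _ id]) (simp_all add: N.complex_space_axioms)
  show "linear_map (sub_rep M N) (sub_rep M N) (act (sub_rep M N) h)" if h: "h \<in> carrier U" for h
    using act_linear[OF M h] subrep_act[OF M N h] submoduleE(5)[OF subrep_submodule[OF M N]]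
      submodule_smult[OF subrep_submodule[OF M N]]
    by (intro linear_mapI)
      (simp_all add: linear_map_add[OF act_linear[OF M h]] linear_map_smult[OF act_linear[OF M h]] in_M)
qed (simp_all add: mult_in add_in smult_in one_in subsetD[OF subrep_subset[OF M N]] subrep_act[OF M N] act_mult[OF M] act_add[OF M]
    act_smult[OF M] act_one[OF M])

lemma is_rep_quot_rep:
  assumes M: "is_rep U M" and N: "subrep U M N"
  shows "is_rep U (quot_rep M N)"
  using M
proof (rule is_rep_image[where f = "\<lambda>v. N +>\<^bsub>M\<^esub> v"])
  show "act (quot_rep M N) h \<in> extensional (carrier (quot_rep M N))" for h
    by (simp add: quot_rep_def)
qed (simp_all add: quot_rep_carrier[OF M N] quot_rep_add[OF M N] quot_rep_zero[OF M N]
    quot_rep_smult[OF M N] quot_rep_act[OF M N])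

end

text \<open>
  Verma modules are free on their basis, so the maps that can be written down start there, whereas
  the isomorphisms wanted end there.
\<close>

lemma rep_iso_inverse:
  assumes N: "is_rep U N" and lin: "linear_map N M f" and bij: "bij_betw f (carrier N) (carrier M)"
    and comm: "\<And>h v. h \<in> carrier U \<Longrightarrow> v \<in> carrier N \<Longrightarrow> f (act N h v) = act M h (f v)"
  shows "rep_iso U M N"
proof -
  interpret N: complex_space N using N by (rule is_rep_space)
  let ?g = "inv_into (carrier N) f"
  have g: "?g (f v) = v" if "v \<in> carrier N" for v
    using bij that by (simp add: bij_betw_inv_into_left)
  have carr: "carrier M = f ` carrier N" using bij by (simp add: bij_betw_def)
  have "linear_map M N ?g"
  proof (rule linear_mapI)
    fix v assume "v \<in> carrier M"
    then obtain v' where v: "v' \<in> carrier N" "v = f v'" using carr by auto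
    show "?g v \<in> carrier N" using v g by simp
    show "?g (c \<odot>\<^bsub>M\<^esub> v) = c \<odot>\<^bsub>N\<^esub> ?g v" for c
      using v by (simp add: g linear_map_smult[OF lin, symmetric])
    fix u assume "u \<in> carrier M"
    then obtain u' where u: "u' \<in> carrier N" "u = f u'" using carr by auto
    show "?g (u \<oplus>\<^bsub>M\<^esub> v) = ?g u \<oplus>\<^bsub>N\<^esub> ?g v"
      using u v by (simp add: g linear_map_add[OF lin, symmetric])
  qed
  moreover have "bij_betw ?g (carrier M) (carrier N)"
    using bij by (rule bij_betw_inv_into)
  moreover have "?g (act M h v) = act N h (?g v)" if "h \<in> carrier U" "v \<in> carrier M" for h v
    using that comm act_closed[OF N] g carr by (auto simp: comm[symmetric])
  ultimately show ?thesis unfolding rep_iso_def by blast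
qed

lemma simple_rep_iso:
  assumes M: "is_rep U M" and N: "simple_rep U N" and iso: "rep_iso U M N"
  shows "simple_rep U M"
proof -
  obtain f where lin: "linear_map M N f" and bij: "bij_betw f (carrier M) (carrier N)"
    and comm: "\<And>h v. h \<in> carrier U \<Longrightarrow> v \<in> carrier M \<Longrightarrow> f (act M h v) = act N h (f v)"
    using iso by (auto simp: rep_iso_def)
  have N': "is_rep U N" using N by (simp add: simple_rep_def)
  interpret M: complex_space M using M by (rule is_rep_space)
  interpret N: complex_space N using N' by (rule is_rep_space)
  have zero: "f \<zero>\<^bsub>M\<^esub> = \<zero>\<^bsub>N\<^esub>"
    using M.complex_space_axioms N.complex_space_axioms lin by (rule linear_map_zero)
  have inj: "inj_on f (carrier M)" and surj: "f ` carrier M = carrier N"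
    using bij by (simp_all add: bij_betw_def)
  have "L = {\<zero>\<^bsub>M\<^esub>} \<or> L = carrier M" if L: "subrep U M L" for L
  proof -
    note L' = subrep_submodule[OF M L] and sub = subrep_subset[OF M L]
    have "submodule (f ` L) \<CC> N"
    proof (rule N.complex_submoduleI)
      show "f ` L \<subseteq> carrier N" using sub surj by auto
      show "\<zero>\<^bsub>N\<^esub> \<in> f ` L"
        unfolding zero[symmetric] by (intro imageI M.submodule_zero L')
    next
      fix u v assume "u \<in> f ` L" "v \<in> f ` L"
      then obtain u' v' where *: "u' \<in> L" "v' \<in> L" "u = f u'" "v = f v'" by auto
      then have "u \<oplus>\<^bsub>N\<^esub> v = f (u' \<oplus>\<^bsub>M\<^esub> v')"
        using linear_map_add[OF lin subsetD[OF sub *(1)] subsetD[OF sub *(2)]] by simp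
      then show "u \<oplus>\<^bsub>N\<^esub> v \<in> f ` L"
        using M.submoduleE(5)[OF L'] * by auto
    next
      fix c u assume "u \<in> f ` L"
      then obtain u' where *: "u' \<in> L" "u = f u'" by auto
      then have "c \<odot>\<^bsub>N\<^esub> u = f (c \<odot>\<^bsub>M\<^esub> u')"
        using linear_map_smult[OF lin subsetD[OF sub *(1)], of c] by simp
      then show "c \<odot>\<^bsub>N\<^esub> u \<in> f ` L"
        using M.submodule_smult[OF L'] * by auto
    qed
    moreover have "act N h v \<in> f ` L" if "h \<in> carrier U" "v \<in> f ` L" for h v
    proof -
      from that obtain v' where *: "v' \<in> L" "v = f v'" by auto
      then have "act N h v = f (act M h v')"
        using comm[OF that(1) subsetD[OF sub *(1)]] by simp
      then show ?thesis using subrep_act[OF M L that(1)] * by auto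
    qed
    ultimately have "subrep U N (f ` L)" by (simp add: subrep_def)
    then consider "f ` L = {\<zero>\<^bsub>N\<^esub>}" | "f ` L = carrier N"
      using N by (auto simp: simple_rep_def)
    then show ?thesis
    proof cases
      case 1
      have "L \<subseteq> {\<zero>\<^bsub>M\<^esub>}"
      proof (rule subsetI)
        fix v assume v: "v \<in> L"
        then have "f v \<in> f ` L" by (rule imageI)
        then have "f v = f \<zero>\<^bsub>M\<^esub>" unfolding 1 zero by (rule singletonD)
        moreover have "v \<in> carrier M" using v sub by (rule rev_subsetD)
        ultimately have "v = \<zero>\<^bsub>M\<^esub>" using inj M.M.zero_closed by (metis inj_onD)
        then show "v \<in> {\<zero>\<^bsub>M\<^esub>}" by simp
      qed
      then show ?thesis using M.submodule_zero[OF L'] by auto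
    next
      case 2
      then show ?thesis using inj_on_image_eq_iff[OF inj sub order_refl] surj by simp
    qed
  qed
  moreover have "carrier M \<noteq> {\<zero>\<^bsub>M\<^esub>}"
  proof
    assume "carrier M = {\<zero>\<^bsub>M\<^esub>}"
    then have "carrier N = {\<zero>\<^bsub>N\<^esub>}" using surj zero by auto
    then show False using N by (simp add: simple_rep_def)
  qed
  ultimately show ?thesis using M by (simp add: simple_rep_def)
qed

lemma simple_rep_one_dimensional:
  assumes M: "is_rep U M" and v: "v \<in> carrier M" "v \<noteq> \<zero>\<^bsub>M\<^esub>"
    and span: "carrier M = range (\<lambda>c. c \<odot>\<^bsub>M\<^esub> v)"
  shows "simple_rep U M"
proof -
  interpret M: complex_space M using M by (rule is_rep_space)
  have "L = {\<zero>\<^bsub>M\<^esub>} \<or> L = carrier M" if L: "subrep U M L" for L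
  proof (cases "L \<subseteq> {\<zero>\<^bsub>M\<^esub>}")
    case True
    then show ?thesis using M.submodule_zero[OF subrep_submodule[OF M L]] by auto
  next
    case False
    then obtain w where w: "w \<in> L" "w \<noteq> \<zero>\<^bsub>M\<^esub>" by auto
    then obtain c where c: "w = c \<odot>\<^bsub>M\<^esub> v" using subrep_subset[OF M L] span by blast
    then have "c \<noteq> 0" using w v by auto
    have "d \<odot>\<^bsub>M\<^esub> v = (d / c) \<odot>\<^bsub>M\<^esub> w" for d
      using c \<open>c \<noteq> 0\<close> v by (simp add: M.smult_smult)
    then have "d \<odot>\<^bsub>M\<^esub> v \<in> L" for d
      using M.submodule_smult[OF subrep_submodule[OF M L] w(1)] by simp
    then show ?thesis using subrep_subset[OF M L] span by auto
  qed
  then show ?thesis using M v by (auto simp: simple_rep_def)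
qed

lemma sub_rep_sub_rep [simp]: "sub_rep (sub_rep M N) N = sub_rep M N"
  by (simp add: sub_rep_def fun_eq_iff)

lemma (in algebra_ops) subrep_sub_rep:
  assumes M: "is_rep U M" and N: "subrep U M N" and L: "subrep U M L" and "L \<subseteq> N"
  shows "subrep U (sub_rep M N) L"
proof -
  interpret M: complex_space M using M by (rule is_rep_space)
  interpret N: complex_space "sub_rep M N"
    using is_rep_sub_rep[OF M N] by (rule is_rep_space)
  note L' = subrep_submodule[OF M L]
  have "submodule L \<CC> (sub_rep M N)"
    by (rule N.complex_submoduleI)
      (use \<open>L \<subseteq> N\<close> in \<open>simp_all add: M.submodule_zero[OF L'] M.submoduleE(5)[OF L'] M.submodule_smult[OF L']\<close>)
  then show ?thesis
    using \<open>L \<subseteq> N\<close> subrep_act[OF M L] by (auto simp: subrep_def)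
qed

lemma (in algebra_ops) subrep_zero:
  assumes M: "is_rep U M"
  shows "subrep U M {\<zero>\<^bsub>M\<^esub>}"
proof -
  interpret M: complex_space M using M by (rule is_rep_space)
  have "act M h \<zero>\<^bsub>M\<^esub> = \<zero>\<^bsub>M\<^esub>" if "h \<in> carrier U" for h
    using M.complex_space_axioms M.complex_space_axioms act_linear[OF M that] by (rule linear_map_zero)
  moreover have "submodule {\<zero>\<^bsub>M\<^esub>} \<CC> M" by (rule M.complex_submoduleI) simp_all
  ultimately show ?thesis by (simp add: subrep_def)
qed

section \<open>Algebras given by generators and relations\<close>

lemma ring_monoid_algebra: "ring monoid_algebra"
proof (rule ringI)
  show "abelian_group monoid_algebra"
    by (rule module.axioms(2)[OF complex_space_monoid_algebra[unfolded complex_space_def]])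
  show "Group.monoid monoid_algebra"
    by (rule monoidI) (simp_all add: mult.assoc)
qed (simp_all add: distrib_left distrib_right)

lemma ideal_relations: "ideal (genideal monoid_algebra R) monoid_algebra"
  by (rule ring.genideal_ideal[OF ring_monoid_algebra]) simp

lemma mem_pres_class_iff: "p' \<in> pres_class R p \<longleftrightarrow> p' - p \<in> genideal monoid_algebra R"
  by (auto simp: pres_class_def a_r_coset_def' intro: bexI[of _ "p' - p"])

lemma
  assumes "p \<in> genideal monoid_algebra R"
  shows relations_add: "r \<in> genideal monoid_algebra R \<Longrightarrow> p + r \<in> genideal monoid_algebra R"
    and relations_scale: "scale c p \<in> genideal monoid_algebra R"
proof -
  interpret ideal "genideal monoid_algebra R" monoid_algebra by (rule ideal_relations)
  show "r \<in> genideal monoid_algebra R \<Longrightarrow> p + r \<in> genideal monoid_algebra R"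
    using additive_subgroup.a_closed[OF ideal.axioms(1)[OF ideal_relations] assms] by simp
  show "scale c p \<in> genideal monoid_algebra R"
    using I_l_closed[OF assms, of "Poly_Mapping.single 0 c"] by (simp add: mult_map_scale_conv_mult)
qed

lemma relations_zero: "0 \<in> genideal monoid_algebra R"
  using additive_subgroup.zero_closed[OF ideal.axioms(1)[OF ideal_relations]] by simp

lemma pres_class_self: "p \<in> pres_class R p"
  by (simp add: mem_pres_class_iff relations_zero)

lemma pres_class_eq_iff:
  "pres_class R p = pres_class R r \<longleftrightarrow> p - r \<in> genideal monoid_algebra R"
proof
  assume "pres_class R p = pres_class R r"
  then show "p - r \<in> genideal monoid_algebra R"
    using pres_class_self[of p R] by (simp add: mem_pres_class_iff)
next
  assume *: "p - r \<in> genideal monoid_algebra R"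
  show "pres_class R p = pres_class R r"
  proof (rule Set.set_eqI)
    fix x
    show "x \<in> pres_class R p \<longleftrightarrow> x \<in> pres_class R r"
      using relations_add[OF _ *, of "x - p"]
        relations_add[OF _ relations_scale[OF *, of "- 1"], of "x - r"]
      by (auto simp: mem_pres_class_iff scale_minus_one)
  qed
qed

lemma pres_class_relator: "p - r \<in> R \<Longrightarrow> pres_class R p = pres_class R r"
  using ring.genideal_self[OF ring_monoid_algebra, of R] by (auto simp: pres_class_eq_iff)

lemma pres_class_zero: "pres_class R 0 = genideal monoid_algebra R"
  by (rule Set.set_eqI) (simp add: mem_pres_class_iff)

lemma pres_class_scale:
  assumes "p' \<in> pres_class R p"
  shows "pres_class R (scale c p') = pres_class R (scale c p)"
proof -
  have "scale c (p' - p) \<in> genideal monoid_algebra R"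
    using assms unfolding mem_pres_class_iff by (rule relations_scale)
  then show ?thesis unfolding pres_class_eq_iff scale_diff_right .
qed

lemma presented_algebra_simps [simp]:
  "carrier (presented_algebra R) = range (pres_class R)"
  "pres_class R p \<otimes>\<^bsub>presented_algebra R\<^esub> pres_class R r = pres_class R (p * r)"
  "pres_class R p \<oplus>\<^bsub>presented_algebra R\<^esub> pres_class R r = pres_class R (p + r)"
  "c \<odot>\<^bsub>presented_algebra R\<^esub> pres_class R p = pres_class R (scale c p)"
  "\<one>\<^bsub>presented_algebra R\<^esub> = pres_class R 1"
  "\<zero>\<^bsub>presented_algebra R\<^esub> = pres_class R 0"
proof -
  interpret ideal "genideal monoid_algebra R" monoid_algebra by (rule ideal_relations)
  have fold: "genideal monoid_algebra R +>\<^bsub>monoid_algebra\<^esub> p = pres_class R p" for p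
    by (simp add: pres_class_def)
  show "carrier (presented_algebra R) = range (pres_class R)"
    by (auto simp: presented_algebra_def FactRing_def A_RCOSETS_def' ring.defs fold)
  show "pres_class R p \<otimes>\<^bsub>presented_algebra R\<^esub> pres_class R r = pres_class R (p * r)"
    using rcoset_mult_add[of p r] by (simp add: presented_algebra_def FactRing_def ring.defs fold)
  show "pres_class R p \<oplus>\<^bsub>presented_algebra R\<^esub> pres_class R r = pres_class R (p + r)"
    using a_rcos_sum[of p r] by (simp add: presented_algebra_def FactRing_def ring.defs fold)
  show "\<one>\<^bsub>presented_algebra R\<^esub> = pres_class R 1"
    by (simp add: presented_algebra_def FactRing_def ring.defs fold)
  show "\<zero>\<^bsub>presented_algebra R\<^esub> = pres_class R 0"
    by (simp add: presented_algebra_def FactRing_def ring.defs pres_class_zero)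
  have "(\<Union>p'\<in>pres_class R p. pres_class R (scale c p')) = pres_class R (scale c p)"
  proof (rule equalityI)
    show "(\<Union>p'\<in>pres_class R p. pres_class R (scale c p')) \<subseteq> pres_class R (scale c p)"
      by (rule UN_least) (simp only: pres_class_scale order_refl)
  qed (rule UN_upper[OF pres_class_self])
  then show "c \<odot>\<^bsub>presented_algebra R\<^esub> pres_class R p = pres_class R (scale c p)"
    by (simp add: presented_algebra_def ring.defs module.defs)
qed

interpretation presented: algebra_ops "presented_algebra R" for R
  by standard auto

lemma complex_space_presented_algebra: "complex_space (presented_algebra R)"
  by (rule complex_space_image[OF complex_space_monoid_algebra, where f = "pres_class R"]) simp_all

text \<open>
  A presented algebra is spanned by words, and a word is built by multiplying generators from the
  left.  Hence stability and intertwining need to be checked on generators only.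
\<close>

lemma presented_algebra_induct [consumes 1, case_names one gen add smult]:
  fixes R :: "'g free_algebra set"
  assumes "h \<in> carrier (presented_algebra R)"
    and one: "P \<one>\<^bsub>presented_algebra R\<^esub>"
    and gen: "\<And>g h. h \<in> carrier (presented_algebra R) \<Longrightarrow> P h \<Longrightarrow>
      P (pres_class R (gen g) \<otimes>\<^bsub>presented_algebra R\<^esub> h)"
    and add: "\<And>h h'. h \<in> carrier (presented_algebra R) \<Longrightarrow> h' \<in> carrier (presented_algebra R) \<Longrightarrow>
      P h \<Longrightarrow> P h' \<Longrightarrow> P (h \<oplus>\<^bsub>presented_algebra R\<^esub> h')"
    and smult: "\<And>c h. h \<in> carrier (presented_algebra R) \<Longrightarrow> P h \<Longrightarrow>
      P (c \<odot>\<^bsub>presented_algebra R\<^esub> h)"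
  shows "P h"
proof -
  have word: "P (pres_class R (Poly_Mapping.single (Word ls) 1))" for ls
  proof (induction ls)
    case Nil
    then show ?case using one by (simp flip: zero_word_def)
  next
    case (Cons g ls)
    have "Poly_Mapping.single (Word (g # ls)) 1
        = gen g * (Poly_Mapping.single (Word ls) 1 :: 'g free_algebra)"
      by (simp add: gen_def mult_single plus_word_def)
    then show ?case using gen[OF _ Cons.IH, of g] by simp
  qed
  have "P (pres_class R p)" for p
  proof (induction p rule: finitely_supported_induct)
    case (single w c)
    have "P (pres_class R (Poly_Mapping.single w 1))"
      using word[of "letters w"] by simp
    then have "P (c \<odot>\<^bsub>presented_algebra R\<^esub> pres_class R (Poly_Mapping.single w 1))"
      by (intro smult) simp_all
    then show ?case by simp
  next
    case (add u v)
    then have "P (pres_class R u \<oplus>\<^bsub>presented_algebra R\<^esub> pres_class R v)"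
      by (intro assms(4)) simp_all
    then show ?case by simp
  qed
  then show ?thesis using assms(1) by auto
qed

lemma subrepI_generators:
  assumes M: "is_rep (presented_algebra R) M" and N: "submodule N \<CC> M"
    and gens: "\<And>g v. v \<in> N \<Longrightarrow> act M (pres_class R (gen g)) v \<in> N"
  shows "subrep (presented_algebra R) M N"
proof -
  interpret M: complex_space M using M by (rule is_rep_space)
  have in_M: "v \<in> carrier M" if "v \<in> N" for v using M.submoduleE(1)[OF N] that by auto
  have "\<forall>v\<in>N. act M h v \<in> N" if "h \<in> carrier (presented_algebra R)" for h
    using that
  proof (induction h rule: presented_algebra_induct)
    case one
    then show ?case using act_one[OF M] in_M by (simp del: presented_algebra_simps)
  next
    case (gen g h)
    have "pres_class R (gen g) \<in> carrier (presented_algebra R)" by simp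
    then show ?case using gen gens act_mult[OF M] in_M by (simp del: presented_algebra_simps)
  next
    case (add h h')
    then show ?case using M.submoduleE(5)[OF N] act_add[OF M] in_M
      by (simp del: presented_algebra_simps)
  next
    case (smult c h)
    then show ?case using M.submodule_smult[OF N] act_smult[OF M] in_M
      by (simp del: presented_algebra_simps)
  qed
  then show ?thesis using N by (simp add: subrep_def del: presented_algebra_simps)
qed

lemma intertwiningI_generators:
  assumes M: "is_rep (presented_algebra R) M" and N: "is_rep (presented_algebra R) N"
    and f: "linear_map M N f"
    and gens: "\<And>g v. v \<in> carrier M \<Longrightarrow>
      f (act M (pres_class R (gen g)) v) = act N (pres_class R (gen g)) (f v)"
    and h: "h \<in> carrier (presented_algebra R)" and v: "v \<in> carrier M"
  shows "f (act M h v) = act N h (f v)"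
proof -
  note closed = linear_map_closed[OF f]
  have "\<forall>v\<in>carrier M. f (act M h v) = act N h (f v)"
    using h
  proof (induction h rule: presented_algebra_induct)
    case one
    then show ?case using act_one[OF M] act_one[OF N] closed by (simp del: presented_algebra_simps)
  next
    case (gen g h)
    have "pres_class R (gen g) \<in> carrier (presented_algebra R)" by simp
    then show ?case
      using gen gens act_mult[OF M] act_mult[OF N] closed act_closed[OF M]
      by (simp del: presented_algebra_simps)
  next
    case (add h h')
    then show ?case
      using act_add[OF M] act_add[OF N] closed act_closed[OF M] linear_map_add[OF f]
      by (simp del: presented_algebra_simps)
  next
    case (smult c h)
    then show ?case
      using act_smult[OF M] act_smult[OF N] closed act_closed[OF M] linear_map_smult[OF f]
      by (simp del: presented_algebra_simps)
  qed
  then show ?thesis using v by blast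
qed

section \<open>Representations defined by operators\<close>

lemma free_act_eq_linear_ext: "free_act ops p v = linear_ext (\<lambda>w. foldr ops (letters w) v) p"
  by (simp add: free_act_def linear_ext_def)

lemma free_act_add: "free_act ops (p + r) v = free_act ops p v + free_act ops r v"
  and free_act_diff: "free_act ops (p - r) v = free_act ops p v - free_act ops r v"
  and free_act_scale: "free_act ops (scale c p) v = scale c (free_act ops p v)"
  by (simp_all only: free_act_eq_linear_ext clinear_linear_ext clinear_add clinear_diff clinear_scale)

lemma free_act_single: "free_act ops (Poly_Mapping.single w c) v = scale c (foldr ops (letters w) v)"
  by (simp add: free_act_eq_linear_ext)

lemma free_act_gen: "free_act ops (gen g) v = ops g v"
  by (simp add: gen_def free_act_single)

lemma free_act_one:
  fixes ops :: "'g \<Rightarrow> ('i \<Rightarrow>\<^sub>0 complex) \<Rightarrow> ('i \<Rightarrow>\<^sub>0 complex)"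
  shows "free_act ops 1 v = v"
proof -
  have "letters (0 :: 'g word) = []" by (simp add: zero_word_def)
  then show ?thesis using free_act_single[of ops 0 1 v] by simp
qed

context
  fixes ops :: "'g \<Rightarrow> ('i \<Rightarrow>\<^sub>0 complex) \<Rightarrow> ('i \<Rightarrow>\<^sub>0 complex)"
  assumes ops: "\<And>g. clinear (ops g)"
begin

lemma clinear_foldr: "clinear (foldr ops ls)"
proof (induction ls)
  case Nil
  then show ?case by (simp add: clinear_def)
next
  case (Cons g ls)
  then show ?case using clinear_comp[OF ops[of g] Cons] by (simp add: comp_def)
qed

lemma clinear_free_act: "clinear (free_act ops p)"
proof (induction p rule: finitely_supported_induct)
  case (single w c)
  show ?case
    using clinear_foldr[of "letters w"]
    by (simp add: free_act_single clinear_def scale_add_right scale_scale mult.commute)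
next
  case (add p r)
  then show ?case
    by (simp add: clinear_def free_act_add scale_add_right add_ac)
qed

lemma free_act_mult: "free_act ops (p * r) v = free_act ops p (free_act ops r v)"
proof (induction p rule: finitely_supported_induct)
  case (single w c)
  show ?case
  proof (induction r rule: finitely_supported_induct)
    case (single u d)
    show ?case
      using clinear_scale[OF clinear_foldr[of "letters w"]]
      by (simp add: free_act_single mult_single plus_word_def scale_scale)
  next
    case (add r r')
    then show ?case by (simp add: free_act_add distrib_left clinear_add[OF clinear_free_act])
  qed
next
  case (add p p')
  then show ?case by (simp add: free_act_add distrib_right)
qed

text \<open>
  The elements that act as zero form a two-sided ideal; if it contains the relators, it contains
  the ideal that they generate.
\<close>

lemma free_act_ideal:
  assumes R: "\<And>r v. r \<in> R \<Longrightarrow> free_act ops r v = 0" and p: "p \<in> genideal monoid_algebra R"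
  shows "free_act ops p v = 0"
proof -
  let ?I = "{p. \<forall>v. free_act ops p v = 0}"
  have "ideal ?I monoid_algebra"
  proof (rule idealI[OF ring_monoid_algebra])
    interpret complex_space monoid_algebra by (rule complex_space_monoid_algebra)
    have "submodule ?I \<CC> monoid_algebra"
      by (rule complex_submoduleI) (use free_act_scale[of ops 0 0] in
          \<open>auto simp: free_act_add free_act_scale\<close>)
    then show "subgroup ?I (add_monoid monoid_algebra)" by (rule submodule.axioms(1))
  qed (simp_all add: free_act_mult clinear_zero[OF clinear_free_act])
  then have "genideal monoid_algebra R \<subseteq> ?I"
    using R by (intro ring.genideal_minimal[OF ring_monoid_algebra]) auto
  then show ?thesis using p by auto
qed

lemma free_act_pres_class:
  assumes R: "\<And>r v. r \<in> R \<Longrightarrow> free_act ops r v = 0"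
  shows "(\<lambda>p. free_act ops p v) ` pres_class R p = {free_act ops p v}"
proof -
  have "free_act ops p' v = free_act ops p v" if "p' \<in> pres_class R p" for p'
    using free_act_ideal[OF R, of R "p' - p" v] that
    by (simp add: free_act_diff mem_pres_class_iff)
  then have "(\<lambda>p. free_act ops p v) ` pres_class R p \<subseteq> {free_act ops p v}" by auto
  moreover have "free_act ops p v \<in> (\<lambda>p. free_act ops p v) ` pres_class R p"
    using pres_class_self by (rule imageI)
  ultimately show ?thesis by (intro equalityI) simp_all
qed

lemma is_rep_free_act:
  assumes R: "\<And>r v. r \<in> R \<Longrightarrow> free_act ops r v = 0"
    and M: "carrier M = UNIV" "\<And>u v. u \<oplus>\<^bsub>M\<^esub> v = u + v" "\<zero>\<^bsub>M\<^esub> = 0"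
      "\<And>c v. c \<odot>\<^bsub>M\<^esub> v = scale c v"
    and act: "\<And>p v. act M (pres_class R p) v = free_act ops p v"
  shows "is_rep (presented_algebra R) M"
proof (rule is_repI)
  show "complex_space M" using M by (rule complex_space_poly_mapping)
  show "linear_map M M (act M h)" if h: "h \<in> carrier (presented_algebra R)" for h
  proof -
    obtain p where "h = pres_class R p" using h by auto
    then show ?thesis
      by (intro linear_mapI)
        (simp_all add: M act clinear_add[OF clinear_free_act] clinear_scale[OF clinear_free_act])
  qed
  show "act M h \<in> extensional (carrier M)" for h by (simp add: M)
  fix h h' v c
  assume "h \<in> carrier (presented_algebra R)"
  then obtain p where h: "h = pres_class R p" by auto
  show "act M (c \<odot>\<^bsub>presented_algebra R\<^esub> h) v = c \<odot>\<^bsub>M\<^esub> act M h v"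
    by (simp add: h M act free_act_scale)
  assume "h' \<in> carrier (presented_algebra R)"
  then obtain p' where h': "h' = pres_class R p'" by auto
  show "act M (h \<otimes>\<^bsub>presented_algebra R\<^esub> h') v = act M h (act M h' v)"
    by (simp add: h h' act free_act_mult)
  show "act M (h \<oplus>\<^bsub>presented_algebra R\<^esub> h') v = act M h v \<oplus>\<^bsub>M\<^esub> act M h' v"
    by (simp add: h h' M act free_act_add)
next
  show "act M \<one>\<^bsub>presented_algebra R\<^esub> v = v" for v
    by (simp add: act free_act_one)
qed (erule (1) presented.mult_in presented.add_in | erule presented.smult_in | rule presented.one_in)+

end

section \<open>Representations of the quantum group\<close>

interpretation uq: algebra_ops "uq q" for q
  unfolding uq_def by (rule presented.algebra_ops_axioms)

context
  fixes q :: complex and M :: "(uq_gen free_algebra set, 'v) rep" (structure)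
  assumes M: "is_rep (uq q) M"
begin

interpretation complex_space M using M by (rule is_rep_space)

lemma uq_class_in: "uq_class q p \<in> carrier (uq q)"
  by (simp add: uq_def uq_class_def)

lemma uq_act_linear: "linear_map M M (act M (uq_class q p))"
  by (rule act_linear[OF M uq_class_in])

lemma uq_act_closed [simp, intro]: "v \<in> carrier M \<Longrightarrow> act M (uq_class q p) v \<in> carrier M"
  by (rule act_closed[OF M uq_class_in])

lemma uq_act_mult: "v \<in> carrier M \<Longrightarrow>
    act M (uq_class q (p * r)) v = act M (uq_class q p) (act M (uq_class q r) v)"
  using act_mult[OF M uq_class_in uq_class_in, of v p r] by (simp add: uq_def uq_class_def)

lemma uq_act_add: "v \<in> carrier M \<Longrightarrow>
    act M (uq_class q (p + r)) v = act M (uq_class q p) v \<oplus> act M (uq_class q r) v"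
  using act_add[OF M uq_class_in uq_class_in, of v p r] by (simp add: uq_def uq_class_def)

lemma uq_act_scale: "v \<in> carrier M \<Longrightarrow>
    act M (uq_class q (scale c p)) v = c \<odot> act M (uq_class q p) v"
  using act_smult[OF M uq_class_in, of v c p] by (simp add: uq_def uq_class_def)

lemma uq_act_one: "v \<in> carrier M \<Longrightarrow> act M (uq_class q 1) v = v"
  using act_one[OF M, of v] by (simp add: uq_def uq_class_def)

lemmas uq_act_vadd = linear_map_add[OF uq_act_linear]
lemmas uq_act_vsmult = linear_map_smult[OF uq_act_linear]

lemma uq_act_vzero: "act M (uq_class q p) \<zero> = \<zero>"
  using complex_space_axioms complex_space_axioms uq_act_linear by (rule linear_map_zero)

lemma uq_class_relator: "p - r \<in> uq_relators q \<Longrightarrow> uq_class q p = uq_class q r"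
  unfolding uq_class_def by (rule pres_class_relator)

lemma uq_relation_Kinv_K: "v \<in> carrier M \<Longrightarrow>
    act M (uq_class q (gen GenKinv)) (act M (uq_k q) v) = v"
proof -
  have "uq_class q (gen GenKinv * gen GenK) = uq_class q 1"
    by (rule uq_class_relator) (simp add: uq_relators_def)
  then show "v \<in> carrier M \<Longrightarrow> ?thesis"
    using uq_act_mult[of v "gen GenKinv" "gen GenK"] uq_act_one[of v] by simp
qed

lemma uq_relation_K_F: "v \<in> carrier M \<Longrightarrow>
    act M (uq_k q) (act M (uq_f q) v) = inverse (q\<^sup>2) \<odot> act M (uq_f q) (act M (uq_k q) v)"
proof -
  have "uq_class q (gen GenK * gen GenF)
      = uq_class q (scale (inverse (q\<^sup>2)) (gen GenF * gen GenK))"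
    by (rule uq_class_relator) (simp add: uq_relators_def)
  then show "v \<in> carrier M \<Longrightarrow> ?thesis"
    using uq_act_mult[of v "gen GenK" "gen GenF"] uq_act_mult[of v "gen GenF" "gen GenK"]
      uq_act_scale[of v "inverse (q\<^sup>2)" "gen GenF * gen GenK"] by simp
qed

lemma uq_relation_E_F: "v \<in> carrier M \<Longrightarrow>
    act M (uq_e q) (act M (uq_f q) v) = act M (uq_f q) (act M (uq_e q) v) \<oplus>
      (1 / (q - inverse q)) \<odot>
        (act M (uq_k q) v \<oplus> (- 1) \<odot> act M (uq_class q (gen GenKinv)) v)"
proof -
  let ?c = "1 / (q - inverse q)"
  let ?h = "scale ?c (gen GenK + scale (- 1) (gen GenKinv)) :: uq_gen free_algebra"
  have "uq_class q (gen GenE * gen GenF) = uq_class q (gen GenF * gen GenE + ?h)"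
    by (rule uq_class_relator) (simp add: uq_relators_def scale_minus_one diff_diff_eq)
  then show "v \<in> carrier M \<Longrightarrow> ?thesis"
    using uq_act_mult[of v "gen GenE" "gen GenF"] uq_act_mult[of v "gen GenF" "gen GenE"]
      uq_act_add[of v "gen GenF * gen GenE" ?h]
      uq_act_scale[of v ?c "gen GenK + scale (- 1) (gen GenKinv)"]
      uq_act_add[of v "gen GenK" "scale (- 1) (gen GenKinv)"]
      uq_act_scale[of v "- 1" "gen GenKinv"]
    by simp
qed

lemma uq_Kinv_weight:
  assumes v: "v \<in> carrier M" "act M (uq_k q) v = l \<odot> v" "l \<noteq> 0"
  shows "act M (uq_class q (gen GenKinv)) v = inverse l \<odot> v"
proof -
  have "v = act M (uq_class q (gen GenKinv)) (l \<odot> v)"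
    using uq_relation_Kinv_K[OF v(1)] v(2) by simp
  also have "\<dots> = l \<odot> act M (uq_class q (gen GenKinv)) v"
    using v(1) by (rule uq_act_vsmult)
  finally have "inverse l \<odot> v = inverse l \<odot> (l \<odot> act M (uq_class q (gen GenKinv)) v)" by simp
  then show ?thesis using v by (simp add: smult_smult)
qed

end

text \<open>
  The matrix entries of \<open>e\<close> and \<open>f\<close> on a Verma module, and of \<open>(k - k\<^bsup>-1\<^esup>) / (q - q\<^bsup>-1\<^esup>)\<close>.
\<close>

definition verma_e :: "complex \<Rightarrow> complex \<Rightarrow> nat \<Rightarrow> complex"
  where "verma_e q l i = (l * q powi (- int i) - inverse l * q powi int i) / (q - inverse q)"

definition verma_f :: "complex \<Rightarrow> nat \<Rightarrow> complex"
  where "verma_f q i = (q powi (int i + 1) - q powi (- int i - 1)) / (q - inverse q)"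

definition verma_h :: "complex \<Rightarrow> complex \<Rightarrow> nat \<Rightarrow> complex"
  where "verma_h q l i =
    (l * q powi (- 2 * int i) - inverse (l * q powi (- 2 * int i))) / (q - inverse q)"

lemma
  fixes q :: complex
  shows powi_minus_double: "q powi (- 2 * int i) = inverse (q ^ i * q ^ i)"
  and powi_double: "q powi (2 * int i) = q ^ i * q ^ i"
  and powi_minus: "q powi (- int i) = inverse (q ^ i)"
  and powi_minus_Suc: "q powi (- int i - 1) = inverse (q * q ^ i)"
  and powi_Suc: "q powi (int i + 1) = q * q ^ i"
proof -
  have "q powi (2 * int i) = q powi int (i + i)" by simp
  then show *: "q powi (2 * int i) = q ^ i * q ^ i" by (simp only: power_int_of_nat power_add)
  show "q powi (- 2 * int i) = inverse (q ^ i * q ^ i)"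
    using * power_int_minus[of q "2 * int i"] by simp
  show "q powi (- int i) = inverse (q ^ i)" by (simp add: power_int_minus)
  have "q powi (int i + 1) = q powi int (Suc i)" by (simp add: add.commute)
  then show **: "q powi (int i + 1) = q * q ^ i" by (simp only: power_int_of_nat power_Suc)
  have "- int i - 1 = - (int i + 1)" by simp
  then show "q powi (- int i - 1) = inverse (q * q ^ i)"
    by (simp only: power_int_minus **)
qed

lemmas powi_simps = powi_minus_double powi_double powi_minus powi_Suc powi_minus_Suc

context
  fixes q l :: complex
  assumes q: "q \<noteq> 0" and q2: "q \<noteq> inverse q" and l: "l \<noteq> 0"
begin

lemma verma_f_e_0: "verma_f q 0 * verma_e q l 0 = verma_h q l 0"
  using q q2 l by (simp add: verma_f_def verma_e_def verma_h_def power_int_minus)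

text \<open>
  This is the relation \<open>e f = f e + (k - k\<^bsup>-1\<^esup>) / (q - q\<^bsup>-1\<^esup>)\<close> read off at the basis vector
  \<open>v\<^sub>i\<^sub>+\<^sub>1\<close>.  It serves twice: to verify the relators on the Verma module, and to compute the action of
  \<open>e\<close> on divided powers in an arbitrary representation.
\<close>

lemma verma_f_e_Suc:
  "verma_f q (Suc i) * verma_e q l (Suc i) = verma_f q i * verma_e q l i + verma_h q l (Suc i)"
proof -
  define Q where "Q = q ^ i"
  have Q: "Q \<noteq> 0" using q by (simp add: Q_def)
  define d where "d = q - inverse q"
  have d: "d \<noteq> 0" using q2 by (simp add: d_def)
  \<comment> \<open>With the common denominator \<open>d\<^sup>2\<close> cleared, only the identity between the numerators remains.\<close>
  have frac: "A / d * (B / d) = C / d * (D / d) + H / d" if "A * B = C * D + d * H" for A B C D H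
  proof -
    have "A / d * (B / d) = (C * D + d * H) / (d * d)" using that by simp
    also have "\<dots> = C / d * (D / d) + H / d" using d by (simp add: add_divide_distrib)
    finally show ?thesis .
  qed
  have "(q * (q * Q) - inverse (q * (q * Q))) * (l * inverse (q * Q) - inverse l * (q * Q))
      = (q * Q - inverse (q * Q)) * (l * inverse Q - inverse l * Q)
        + d * (l * inverse (q * Q * (q * Q)) - inverse l * (q * Q * (q * Q)))"
    using q l Q unfolding d_def by (simp add: divide_simps) (simp add: algebra_simps)
  then have "(q * (q * Q) - inverse (q * (q * Q))) / d * ((l * inverse (q * Q) - inverse l * (q * Q)) / d)
      = (q * Q - inverse (q * Q)) / d * ((l * inverse Q - inverse l * Q) / d)
        + (l * inverse (q * Q * (q * Q)) - inverse l * (q * Q * (q * Q))) / d"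
    by (rule frac)
  then show ?thesis
    unfolding verma_f_def verma_e_def verma_h_def powi_simps power_int_of_nat power_Suc
      inverse_mult_distrib inverse_inverse_eq
    unfolding Q_def d_def by (simp only: inverse_mult_distrib mult.assoc)
qed

end

section \<open>Verma modules\<close>

definition verma_weight :: "complex \<Rightarrow> complex \<Rightarrow> nat \<Rightarrow> complex"
  where "verma_weight q l i = l * q powi (- 2 * int i)"

lemma verma_simps [simp]:
  "carrier (verma q l) = UNIV" "u \<oplus>\<^bsub>verma q l\<^esub> v = u + v" "\<zero>\<^bsub>verma q l\<^esub> = 0"
  "c \<odot>\<^bsub>verma q l\<^esub> v = scale c v"
  by (simp_all add: verma_def)

lemma verma_E_lookup:
  "Poly_Mapping.lookup (linear_ext (verma_gen q l GenE) v) i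
    = verma_e q l i * Poly_Mapping.lookup v (Suc i)"
proof (induction v rule: finitely_supported_induct)
  case (single j c)
  then show ?case by (cases j) (auto simp: lookup_single when_def verma_e_def)
next
  case (add u v)
  then show ?case by (simp add: clinear_add[OF clinear_linear_ext] lookup_add distrib_left)
qed

context
  fixes q l :: complex
  assumes q: "q \<noteq> 0" and q2: "q \<noteq> inverse q" and l: "l \<noteq> 0"
begin

lemma verma_weight_nonzero: "verma_weight q l i \<noteq> 0"
  using q l by (simp add: verma_weight_def)

lemma verma_weight_0: "verma_weight q l 0 = l"
  by (simp add: verma_weight_def)

lemma verma_weight_Suc: "verma_weight q l (Suc i) = inverse (q\<^sup>2) * verma_weight q l i"
  unfolding verma_weight_def powi_minus_double by (simp add: power2_eq_square)

lemma verma_gen_simps: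
  "verma_gen q l GenK i = Poly_Mapping.single i (verma_weight q l i)"
  "verma_gen q l GenKinv i = Poly_Mapping.single i (inverse (verma_weight q l i))"
  "verma_gen q l GenE (Suc i) = Poly_Mapping.single i (verma_e q l i)"
  "verma_gen q l GenF i = Poly_Mapping.single (Suc i) (verma_f q i)"
proof -
  have "inverse (q powi (- 2 * int i)) = q powi (2 * int i)"
    using power_int_minus[of q "2 * int i"] by simp
  then show "verma_gen q l GenKinv i = Poly_Mapping.single i (inverse (verma_weight q l i))"
    by (simp add: verma_weight_def)
qed (simp_all add: verma_weight_def verma_e_def verma_f_def)

lemma verma_h_eq: "verma_h q l i = (verma_weight q l i - inverse (verma_weight q l i)) / (q - inverse q)"
  by (simp add: verma_h_def verma_weight_def)

text \<open>
  By linearity it is enough to evaluate the five relators at basis vectors.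
\<close>

lemma verma_relations:
  assumes "r \<in> uq_relators q"
  shows "free_act (\<lambda>g. linear_ext (verma_gen q l g)) r v = 0"
proof -
  let ?T = "free_act (\<lambda>g. linear_ext (verma_gen q l g))"
  note simps = free_act_diff free_act_scale free_act_gen free_act_one
    free_act_mult[of "\<lambda>g. linear_ext (verma_gen q l g)", OF clinear_linear_ext]
  have "?T r (Poly_Mapping.single i 1) = 0" for i
    using assms[unfolded uq_relators_def]
  proof (elim insertE)
    assume "r = gen GenKinv * gen GenK - 1"
    then show ?thesis
      using verma_weight_nonzero[of i] by (simp add: simps verma_gen_simps del: verma_gen.simps)
  next
    assume "r = gen GenK * gen GenKinv - 1"
    then show ?thesis
      using verma_weight_nonzero[of i] by (simp add: simps verma_gen_simps del: verma_gen.simps)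
  next
    assume r: "r = gen GenK * gen GenE - scale (q\<^sup>2) (gen GenE * gen GenK)"
    show ?thesis
    proof (cases i)
      case 0
      then show ?thesis
        by (simp add: r simps verma_gen_simps(1) clinear_zero[OF clinear_linear_ext] del: single_one)
    next
      case (Suc j)
      then show ?thesis
        using q by (simp add: r simps verma_gen_simps verma_weight_Suc mult.assoc[symmetric]
            del: verma_gen.simps) (simp add: mult.commute)
    qed
  next
    assume "r = gen GenK * gen GenF - scale (inverse (q\<^sup>2)) (gen GenF * gen GenK)"
    then show ?thesis
      by (simp add: simps verma_gen_simps verma_weight_Suc mult_ac del: verma_gen.simps)
  next
    assume r: "r = gen GenE * gen GenF - gen GenF * gen GenE
       - scale (1 / (q - inverse q)) (gen GenK - gen GenKinv)"
    have h: "scale (1 / (q - inverse q))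
        (Poly_Mapping.single i (verma_weight q l i) - Poly_Mapping.single i (inverse (verma_weight q l i)))
        = Poly_Mapping.single i (verma_h q l i)"
      by (simp add: verma_h_eq flip: single_diff)
    show ?thesis
    proof (cases i)
      case 0
      then show ?thesis
        using h verma_f_e_0[OF q q2 l]
        by (simp add: r simps verma_gen_simps clinear_zero[OF clinear_linear_ext]
            del: verma_gen.simps(1,2,4,5) single_one)
    next
      case (Suc j)
      then show ?thesis
        using h verma_f_e_Suc[OF q q2 l, of j]
        by (simp add: r simps verma_gen_simps single_add mult.commute del: verma_gen.simps)
    qed
  qed simp
  then have "?T r = (\<lambda>v. 0)"
    by (intro clinear_eqI clinear_free_act clinear_linear_ext) (simp_all add: clinear_def)
  then show ?thesis by simp
qed

lemma act_verma:
  "act (verma q l) (uq_class q p) v = free_act (\<lambda>g. linear_ext (verma_gen q l g)) p v"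
proof -
  have "(\<lambda>p. free_act (\<lambda>g. linear_ext (verma_gen q l g)) p v) ` uq_class q p
      = {free_act (\<lambda>g. linear_ext (verma_gen q l g)) p v}"
    unfolding uq_class_def
    by (rule free_act_pres_class) (rule clinear_linear_ext, rule verma_relations)
  then show ?thesis by (simp add: verma_def)
qed

lemma act_verma_gen: "act (verma q l) (uq_class q (gen g)) v = linear_ext (verma_gen q l g) v"
  by (simp add: act_verma free_act_gen)

lemma is_rep_verma: "is_rep (uq q) (verma q l)"
  unfolding uq_def
proof (rule is_rep_free_act)
  show "act (verma q l) (pres_class (uq_relators q) p) v
      = free_act (\<lambda>g. linear_ext (verma_gen q l g)) p v" for p v
    using act_verma[of p v] by (simp add: uq_class_def)
qed (simp_all add: clinear_linear_ext verma_relations)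

text \<open>
  Since \<open>e\<close> lowers the degree by one with a nonzero coefficient, repeated application of \<open>e\<close> to a
  nonzero vector of a subrepresentation ends in a nonzero multiple of \<open>v\<^sub>0\<close>; from \<open>v\<^sub>0\<close> the operator
  \<open>f\<close> then reaches every basis vector.
\<close>

lemma simple_rep_verma:
  assumes e: "\<And>i. verma_e q l i \<noteq> 0" and f: "\<And>i. verma_f q i \<noteq> 0"
  shows "simple_rep (uq q) (verma q l)"
proof -
  interpret V: complex_space "verma q l"
    using is_rep_verma by (rule is_rep_space)
  have "N = {0} \<or> N = UNIV" if N: "subrep (uq q) (verma q l) N" for N
  proof (cases "N \<subseteq> {0}")
    case True
    then show ?thesis using V.submodule_zero[OF subrep_submodule[OF is_rep_verma N]] by auto
  next
    case False
    note N' = subrep_submodule[OF is_rep_verma N]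
    have N_add: "u + v \<in> N" if "u \<in> N" "v \<in> N" for u v
      using V.submoduleE(5)[OF N' that] by simp
    have N_scale: "scale c v \<in> N" if "v \<in> N" for c v
      using V.submodule_smult[OF N' that] by simp
    have N_gen: "linear_ext (verma_gen q l g) v \<in> N" if "v \<in> N" for g v
      using subrep_act[OF is_rep_verma N, of "uq_class q (gen g)" v] that
      by (simp add: act_verma_gen) (simp add: uq_def uq_class_def)
    have bottom: "Poly_Mapping.single 0 1 \<in> N"
      if "v \<in> N" "v \<noteq> 0" "\<And>i. i \<ge> d \<Longrightarrow> Poly_Mapping.lookup v i = 0" for v d
      using that
    proof (induction d arbitrary: v)
      case 0
      then have "v = 0" by (intro poly_mapping_eqI) simp
      with 0 show ?case by simp
    next
      case (Suc d)
      let ?w = "linear_ext (verma_gen q l GenE) v"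
      show ?case
      proof (cases "?w = 0")
        case False
        then show ?thesis
          using Suc.prems by (intro Suc.IH[of ?w] N_gen) (simp_all add: verma_E_lookup)
      next
        case True
        have "Poly_Mapping.lookup v (Suc i) = 0" for i
          using verma_E_lookup[of q l v i] True e[of i] by simp
        then have v: "v = Poly_Mapping.single 0 (Poly_Mapping.lookup v 0)"
          by (intro poly_mapping_eqI) (metis lookup_single_eq lookup_single_not_eq not0_implies_Suc)
        then have "Poly_Mapping.lookup v 0 \<noteq> 0" using Suc.prems(2) by (metis single_zero)
        moreover have "scale (inverse (Poly_Mapping.lookup v 0)) v \<in> N"
          using Suc.prems(1) by (rule N_scale)
        ultimately show ?thesis
          by (subst (asm) v) simp
      qed
    qed
    obtain v where v: "v \<in> N" "v \<noteq> 0" using False by auto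
    obtain d where "\<And>i. i \<in> Poly_Mapping.keys v \<Longrightarrow> i < d"
      using finite_nat_set_iff_bounded[of "Poly_Mapping.keys v"] by auto
    then have "Poly_Mapping.lookup v i = 0" if "i \<ge> d" for i
      using that by (meson in_keys_iff not_le)
    with v have 0: "Poly_Mapping.single 0 1 \<in> N" by (intro bottom)
    have basis: "Poly_Mapping.single i 1 \<in> N" for i
    proof (induction i)
      case 0
      show ?case by fact
    next
      case (Suc i)
      have "scale (inverse (verma_f q i)) (linear_ext (verma_gen q l GenF) (Poly_Mapping.single i 1)) \<in> N"
        by (intro N_scale N_gen Suc)
      then show ?case using f[of i] by (simp add: verma_gen_simps del: verma_gen.simps)
    qed
    have "v \<in> N" for v
    proof (induction v rule: finitely_supported_induct)
      case (single i c)
      then show ?case using N_scale[OF basis[of i], of c] by simp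
    qed (rule N_add)
    then show ?thesis by auto
  qed
  moreover have "(UNIV :: (nat \<Rightarrow>\<^sub>0 complex) set) \<noteq> {0}"
    using single_zero[of 0] by (metis UNIV_I lookup_single_eq lookup_zero singletonD zero_neq_one)
  ultimately show ?thesis using is_rep_verma by (simp add: simple_rep_def)
qed

end

text \<open>
  The quantum divided powers \<open>f\<^sup>i v / [i]!\<close>, normalised so that they match the basis of the Verma
  module.
\<close>

primrec verma_vec :: "complex \<Rightarrow> (uq_gen free_algebra set, 'v) rep \<Rightarrow> 'v \<Rightarrow> nat \<Rightarrow> 'v"
  where
    "verma_vec q M v 0 = v"
  | "verma_vec q M v (Suc i) = inverse (verma_f q i) \<odot>\<^bsub>M\<^esub> act M (uq_f q) (verma_vec q M v i)"

context
  fixes q l :: complex and M :: "(uq_gen free_algebra set, 'v) rep" (structure) and v :: 'v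
  assumes q: "q \<noteq> 0" and q2: "q \<noteq> inverse q" and l: "l \<noteq> 0" and f: "\<And>i. verma_f q i \<noteq> 0"
    and M: "is_rep (uq q) M"
    and v: "v \<in> carrier M" "act M (uq_k q) v = l \<odot> v"
begin

interpretation complex_space M using M by (rule is_rep_space)

lemma verma_vec_in: "verma_vec q M v i \<in> carrier M"
  by (induction i) (simp_all add: v uq_act_closed[OF M])

lemma verma_vec_F: "act M (uq_f q) (verma_vec q M v i) = verma_f q i \<odot> verma_vec q M v (Suc i)"
  using f[of i] by (simp add: smult_smult verma_vec_in uq_act_closed[OF M])

lemma verma_vec_K: "act M (uq_k q) (verma_vec q M v i) = verma_weight q l i \<odot> verma_vec q M v i"
proof (induction i)
  case 0
  then show ?case using v by (simp add: verma_weight_0[OF q q2 l])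
next
  case (Suc i)
  note in_M = verma_vec_in[of i]
  note Fin = uq_act_closed[OF M in_M, of "gen GenF"]
  have "act M (uq_k q) (verma_vec q M v (Suc i))
      = inverse (verma_f q i) \<odot> act M (uq_k q) (act M (uq_f q) (verma_vec q M v i))"
    using uq_act_vsmult[OF M Fin] by simp
  also have "act M (uq_k q) (act M (uq_f q) (verma_vec q M v i))
      = inverse (q\<^sup>2) \<odot> act M (uq_f q) (verma_weight q l i \<odot> verma_vec q M v i)"
    using uq_relation_K_F[OF M in_M] Suc by simp
  also have "act M (uq_f q) (verma_weight q l i \<odot> verma_vec q M v i)
      = verma_weight q l i \<odot> act M (uq_f q) (verma_vec q M v i)"
    by (rule uq_act_vsmult[OF M in_M])
  finally show ?case
    using Fin by (simp add: smult_smult verma_weight_Suc[OF q q2 l] mult_ac)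
qed

lemma verma_vec_Kinv:
  "act M (uq_class q (gen GenKinv)) (verma_vec q M v i)
    = inverse (verma_weight q l i) \<odot> verma_vec q M v i"
  by (rule uq_Kinv_weight[OF M verma_vec_in verma_vec_K verma_weight_nonzero[OF q q2 l]])

text \<open>
  The hypothesis is \<open>f e v = 0\<close> and not \<open>e v = 0\<close>: the induction commutes \<open>e\<close> past \<open>f\<close> and only
  meets \<open>e v\<close> under a further \<open>f\<close>.  This covers the vector \<open>x\<close> of the quantum plane, for which
  \<open>e x\<close> is a nonzero constant.
\<close>

lemma verma_vec_E:
  assumes "act M (uq_f q) (act M (uq_e q) v) = \<zero>"
  shows "act M (uq_e q) (verma_vec q M v (Suc i)) = verma_e q l i \<odot> verma_vec q M v i"
proof -
  have step: "act M (uq_e q) (verma_vec q M v (Suc i)) = verma_e q l i \<odot> verma_vec q M v i"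
    if FE: "act M (uq_f q) (act M (uq_e q) (verma_vec q M v i)) = c \<odot> verma_vec q M v i"
      and c: "c + verma_h q l i = verma_f q i * verma_e q l i" for c i
  proof -
    note in_M = verma_vec_in[of i]
    note Fin = uq_act_closed[OF M in_M, of "gen GenF"]
    have "act M (uq_e q) (verma_vec q M v (Suc i))
        = inverse (verma_f q i) \<odot> act M (uq_e q) (act M (uq_f q) (verma_vec q M v i))"
      using uq_act_vsmult[OF M Fin] by simp
    also have "act M (uq_e q) (act M (uq_f q) (verma_vec q M v i))
        = c \<odot> verma_vec q M v i \<oplus> (1 / (q - inverse q)) \<odot>
          (verma_weight q l i \<odot> verma_vec q M v i
            \<oplus> (- 1) \<odot> (inverse (verma_weight q l i) \<odot> verma_vec q M v i))"
      using uq_relation_E_F[OF M in_M] by (simp only: FE verma_vec_K verma_vec_Kinv)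
    also have "\<dots> = (c + verma_h q l i) \<odot> verma_vec q M v i"
      using in_M by (simp add: smult_smult smult_add verma_h_eq[OF q q2 l] flip: smult_add)
    finally have "act M (uq_e q) (verma_vec q M v (Suc i))
        = (inverse (verma_f q i) * (verma_f q i * verma_e q l i)) \<odot> verma_vec q M v i"
      using in_M by (simp only: c smult_smult)
    moreover have "inverse (verma_f q i) * (verma_f q i * verma_e q l i) = verma_e q l i"
      using f[of i] by simp
    ultimately show ?thesis by (simp only:)
  qed
  show ?thesis
  proof (induction i)
    case 0
    have "act M (uq_f q) (act M (uq_e q) (verma_vec q M v 0)) = 0 \<odot> verma_vec q M v 0"
      using assms v(1) by simp
    then show ?case
      by (rule step) (simp add: verma_f_e_0[OF q q2 l])
  next
    case (Suc i)
    show ?case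
    proof (rule step)
      have "act M (uq_f q) (verma_e q l i \<odot> verma_vec q M v i)
          = verma_e q l i \<odot> act M (uq_f q) (verma_vec q M v i)"
        by (rule uq_act_vsmult[OF M verma_vec_in])
      also have "\<dots> = (verma_e q l i * verma_f q i) \<odot> verma_vec q M v (Suc i)"
        unfolding verma_vec_F by (rule smult_smult[OF verma_vec_in])
      finally show "act M (uq_f q) (act M (uq_e q) (verma_vec q M v (Suc i)))
          = (verma_e q l i * verma_f q i) \<odot> verma_vec q M v (Suc i)"
        unfolding Suc.IH .
      show "verma_e q l i * verma_f q i + verma_h q l (Suc i)
          = verma_f q (Suc i) * verma_e q l (Suc i)"
        using verma_f_e_Suc[OF q q2 l, of i] by simp
    qed
  qed
qed

lemma verma_hom:
  assumes E: "act M (uq_e q) v = \<zero>" and h: "h \<in> carrier (uq q)"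
  shows "lin_comb M (verma_vec q M v) (act (verma q l) h w)
    = act M h (lin_comb M (verma_vec q M v) w)"
  using is_rep_verma[OF q q2 l, unfolded uq_def] M[unfolded uq_def] _ _ h[unfolded uq_def]
proof (rule intertwiningI_generators)
  let ?\<psi> = "lin_comb M (verma_vec q M v)"
  have lin: "linear_map monoid_algebra M ?\<psi>"
    by (rule linear_map_lin_comb) (rule verma_vec_in)
  then show "linear_map (verma q l) M ?\<psi>" by (simp add: linear_map_def)
  have single: "?\<psi> (Poly_Mapping.single i c) = c \<odot> verma_vec q M v i" for i c
    by (rule lin_comb_single) (rule verma_vec_in)
  fix g w
  have "?\<psi> (linear_ext (verma_gen q l g) w) = act M (uq_class q (gen g)) (?\<psi> w)"
  proof (rule linear_map_monoid_algebra_eqI)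
    show "linear_map monoid_algebra M (\<lambda>w. ?\<psi> (linear_ext (verma_gen q l g) w))"
      by (rule linear_map_comp[OF linear_map_clinear[OF clinear_linear_ext] lin])
    show "linear_map monoid_algebra M (\<lambda>w. act M (uq_class q (gen g)) (?\<psi> w))"
      by (rule linear_map_comp[OF lin uq_act_linear[OF M]])
    fix i
    have FE: "act M (uq_f q) (act M (uq_e q) v) = \<zero>"
      unfolding E by (rule uq_act_vzero[OF M])
    have zero: "?\<psi> 0 = \<zero>"
      using single[of 0 0] verma_vec_in[of 0] by simp
    show "?\<psi> (linear_ext (verma_gen q l g) (Poly_Mapping.single i 1))
        = act M (uq_class q (gen g)) (?\<psi> (Poly_Mapping.single i 1))"
    proof (cases g)
      case GenE
      show ?thesis
      proof (cases i)
        case 0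
        then show ?thesis using GenE E v(1) by (simp add: single zero del: single_one)
      next
        case (Suc j)
        then show ?thesis
          using GenE verma_vec_E[OF FE, of j] verma_vec_in[of "Suc j"]
          by (simp add: single verma_gen_simps[OF q q2 l] del: verma_gen.simps verma_vec.simps)
      qed
    qed (simp_all add: single verma_gen_simps[OF q q2 l] verma_vec_in verma_vec_F verma_vec_K
        verma_vec_Kinv del: verma_gen.simps verma_vec.simps)
  qed
  then show "?\<psi> (act (verma q l) (pres_class (uq_relators q) (gen g)) w)
      = act M (pres_class (uq_relators q) (gen g)) (?\<psi> w)"
    using act_verma_gen[OF q q2 l, of g w] by (simp add: uq_class_def)
qed simp

end

section \<open>Monomials in the quantum plane\<close>

definition qp_monomial :: "nat \<times> nat \<Rightarrow> qp_gen free_algebra"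
  where "qp_monomial = (\<lambda>(m, n). gen GenX ^ m * gen GenY ^ n)"

definition qp_poly :: "complex \<Rightarrow> (nat \<times> nat \<Rightarrow>\<^sub>0 complex) \<Rightarrow> qp_gen free_algebra set"
  where "qp_poly q v = pres_class (qp_relators q) (linear_ext qp_monomial v)"

text \<open>
  Left multiplication by the generators on formal normally ordered monomials, where
  \<open>(m, n)\<close> stands for \<open>x\<^sup>m y\<^sup>n\<close> and \<open>y x\<^sup>m = q\<^sup>m x\<^sup>m y\<close>.
\<close>

fun qp_op :: "complex \<Rightarrow> qp_gen \<Rightarrow> (nat \<times> nat \<Rightarrow>\<^sub>0 complex) \<Rightarrow> (nat \<times> nat \<Rightarrow>\<^sub>0 complex)"
  where
    "qp_op q GenX = linear_ext (\<lambda>(m, n). Poly_Mapping.single (Suc m, n) 1)"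
  | "qp_op q GenY = linear_ext (\<lambda>(m, n). Poly_Mapping.single (m, Suc n) (q ^ m))"

lemma clinear_qp_op: "clinear (qp_op q g)"
  by (cases g) (simp_all add: clinear_linear_ext)

lemma qp_op_single:
  "qp_op q GenX (Poly_Mapping.single (m, n) c) = Poly_Mapping.single (Suc m, n) c"
  "qp_op q GenY (Poly_Mapping.single (m, n) c) = Poly_Mapping.single (m, Suc n) (q ^ m * c)"
  by (simp_all add: mult.commute)

lemma qp_op_relation: "r \<in> qp_relators q \<Longrightarrow> free_act (qp_op q) r v = 0"
proof -
  assume "r \<in> qp_relators q"
  then have r: "r = gen GenY * gen GenX - scale q (gen GenX * gen GenY)"
    by (simp add: qp_relators_def)
  have "free_act (qp_op q) r (Poly_Mapping.single i 1) = 0" for i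
    by (cases i) (simp add: r free_act_diff free_act_scale free_act_mult[OF clinear_qp_op]
        free_act_gen qp_op_single del: qp_op.simps)
  then have "free_act (qp_op q) r = (\<lambda>v. 0)"
    by (intro clinear_eqI clinear_free_act clinear_qp_op) (simp_all add: clinear_def)
  then show ?thesis by simp
qed

lemma qp_op_monomial:
  "free_act (qp_op q) (qp_monomial i) (Poly_Mapping.single (0, 0) 1) = Poly_Mapping.single i 1"
proof -
  note simps = free_act_mult[OF clinear_qp_op] free_act_gen free_act_one qp_op_single
  have Y: "free_act (qp_op q) (gen GenY ^ n) (Poly_Mapping.single (0, 0) 1)
      = Poly_Mapping.single (0, n) 1" for n
    by (induction n) (simp_all add: simps del: qp_op.simps)
  have "free_act (qp_op q) (gen GenX ^ m) (Poly_Mapping.single (0, n) 1)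
      = Poly_Mapping.single (m, n) 1" for m n
    by (induction m) (simp_all add: simps del: qp_op.simps)
  with Y show ?thesis by (cases i) (simp add: qp_monomial_def simps)
qed

lemma linear_map_pres_class:
  assumes "clinear T"
  shows "linear_map monoid_algebra (presented_algebra R) (\<lambda>v. pres_class R (T v))"
  by (intro linear_mapI) (simp_all add: clinear_add[OF assms] clinear_scale[OF assms])

lemma linear_map_qp_poly: "linear_map monoid_algebra (quantum_plane q) (qp_poly q)"
  unfolding quantum_plane_def qp_poly_def by (rule linear_map_pres_class[OF clinear_linear_ext])

text \<open>
  A polynomial is recovered from its class by letting the class act on the formal monomial \<open>1\<close>.
\<close>

lemma inj_qp_poly: "inj (qp_poly q)"
proof (rule injI)
  fix u v assume "qp_poly q u = qp_poly q v"
  then have "linear_ext qp_monomial u - linear_ext qp_monomial v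
      \<in> genideal monoid_algebra (qp_relators q)"
    by (simp add: qp_poly_def pres_class_eq_iff)
  then have "linear_ext qp_monomial (u - v) \<in> genideal monoid_algebra (qp_relators q)"
    by (simp add: clinear_diff[OF clinear_linear_ext])
  from free_act_ideal[OF clinear_qp_op qp_op_relation this]
  have "free_act (qp_op q) (linear_ext qp_monomial (u - v)) (Poly_Mapping.single (0, 0) 1) = 0"
    by simp
  moreover have "(\<lambda>v. free_act (qp_op q) (linear_ext qp_monomial v) (Poly_Mapping.single (0, 0) 1))
      = (\<lambda>v. v)"
  proof (rule clinear_eqI)
    show "clinear (\<lambda>v. free_act (qp_op q) (linear_ext qp_monomial v) (Poly_Mapping.single (0, 0) 1))"
      by (rule clinearI) (simp_all add: clinear_add[OF clinear_linear_ext]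
          clinear_scale[OF clinear_linear_ext] free_act_add free_act_scale)
  qed (simp_all add: clinear_def qp_op_monomial)
  ultimately have "u - v = 0" by (metis (no_types, lifting))
  then show "u = v" by simp
qed

lemma Y_X_power: "pres_class (qp_relators q) (gen GenY * gen GenX ^ m)
    = pres_class (qp_relators q) (scale (q ^ m) (gen GenX ^ m * gen GenY))"
proof (induction m)
  case 0
  then show ?case by simp
next
  case (Suc m)
  let ?cl = "pres_class (qp_relators q)" and ?A = "presented_algebra (qp_relators q)"
  have YX: "?cl (gen GenY * gen GenX) = ?cl (scale q (gen GenX * gen GenY))"
    by (rule pres_class_relator) (simp add: qp_relators_def)
  have "?cl (gen GenY * gen GenX ^ Suc m) = ?cl (gen GenY * gen GenX) \<otimes>\<^bsub>?A\<^esub> ?cl (gen GenX ^ m)"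
    by (simp add: mult.assoc)
  also have "\<dots> = ?cl (scale q (gen GenX)) \<otimes>\<^bsub>?A\<^esub> ?cl (gen GenY * gen GenX ^ m)"
    unfolding YX by (simp add: mult.assoc scale_mult_left)
  also have "\<dots> = ?cl (scale (q ^ Suc m) (gen GenX ^ Suc m * gen GenY))"
    unfolding Suc.IH by (simp add: mult.assoc scale_mult_left scale_mult_right scale_scale
        mult.commute[of q])
  finally show ?case .
qed

lemma qp_poly_gen_mult:
  "pres_class (qp_relators q) (gen g) \<otimes>\<^bsub>quantum_plane q\<^esub> qp_poly q v = qp_poly q (qp_op q g v)"
proof -
  let ?cl = "pres_class (qp_relators q)"
  have "?cl (gen g * linear_ext qp_monomial v) = ?cl (linear_ext qp_monomial (qp_op q g v))"
  proof (rule linear_map_monoid_algebra_eqI[where v = v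
        and f = "\<lambda>v. ?cl (gen g * linear_ext qp_monomial v)"
        and g = "\<lambda>v. ?cl (linear_ext qp_monomial (qp_op q g v))"])
    show "linear_map monoid_algebra (presented_algebra (qp_relators q))
        (\<lambda>v. ?cl (gen g * linear_ext qp_monomial v))"
      by (rule linear_map_pres_class) (simp add: clinear_def clinear_add[OF clinear_linear_ext]
          clinear_scale[OF clinear_linear_ext] distrib_left scale_mult_right)
    show "linear_map monoid_algebra (presented_algebra (qp_relators q))
        (\<lambda>v. ?cl (linear_ext qp_monomial (qp_op q g v)))"
      by (rule linear_map_pres_class[OF clinear_comp[OF clinear_linear_ext clinear_qp_op]])
    fix i :: "nat \<times> nat"
    obtain m n where i: "i = (m, n)" by (cases i)
    show "?cl (gen g * linear_ext qp_monomial (Poly_Mapping.single i 1))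
        = ?cl (linear_ext qp_monomial (qp_op q g (Poly_Mapping.single i 1)))"
    proof (cases g)
      case GenX
      then show ?thesis
        by (simp add: i qp_op_single qp_monomial_def mult.assoc del: qp_op.simps)
    next
      case GenY
      have "?cl (gen GenY * (gen GenX ^ m * gen GenY ^ n))
          = ?cl (gen GenY * gen GenX ^ m) \<otimes>\<^bsub>presented_algebra (qp_relators q)\<^esub> ?cl (gen GenY ^ n)"
        by (simp add: mult.assoc)
      also have "\<dots> = ?cl (scale (q ^ m) (gen GenX ^ m * gen GenY ^ Suc n))"
        unfolding Y_X_power by (simp add: mult.assoc scale_mult_left)
      finally show ?thesis
        using GenY by (simp add: i qp_op_single qp_monomial_def del: qp_op.simps)
    qed
  qed
  then show ?thesis by (simp add: qp_poly_def quantum_plane_def)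
qed

text \<open>
  Normally ordered polynomials contain \<open>1\<close> and are stable under left multiplication by generators,
  hence exhaust the plane.
\<close>

lemma surj_qp_poly: "a \<in> carrier (quantum_plane q) \<Longrightarrow> \<exists>v. a = qp_poly q v"
  unfolding quantum_plane_def
proof (induction a rule: presented_algebra_induct)
  case one
  have "\<one>\<^bsub>presented_algebra (qp_relators q)\<^esub> = qp_poly q (Poly_Mapping.single (0, 0) 1)"
    by (simp add: qp_poly_def qp_monomial_def)
  then show ?case by (rule exI)
next
  case (gen g h)
  then show ?case using qp_poly_gen_mult[of q g, unfolded quantum_plane_def] by blast
next
  case (add h h')
  then obtain u v where "h = qp_poly q u" "h' = qp_poly q v" by blast
  then have "h \<oplus>\<^bsub>presented_algebra (qp_relators q)\<^esub> h' = qp_poly q (u + v)"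
    by (simp add: qp_poly_def clinear_add[OF clinear_linear_ext])
  then show ?case by (rule exI)
next
  case (smult c h)
  then obtain v where "h = qp_poly q v" by blast
  then have "c \<odot>\<^bsub>presented_algebra (qp_relators q)\<^esub> h = qp_poly q (scale c v)"
    by (simp add: qp_poly_def clinear_scale[OF clinear_linear_ext])
  then show ?case by (rule exI)
qed

lemma qp_y_pow: "qp_y q [^]\<^bsub>quantum_plane q\<^esub> (n::nat) = qp_poly q (Poly_Mapping.single (0, n) 1)"
proof -
  have "qp_y q [^]\<^bsub>quantum_plane q\<^esub> n = pres_class (qp_relators q) (gen GenY ^ n)"
    by (induction n) (simp_all add: nat_pow_def qp_y_def quantum_plane_def power_commutes)
  then show ?thesis by (simp add: qp_poly_def qp_monomial_def)
qed

lemma complex_space_quantum_plane: "complex_space (quantum_plane q)"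
  unfolding quantum_plane_def by (rule complex_space_presented_algebra)

section \<open>Module algebras over the quantum group\<close>

lemma rep_of_simps [simp]:
  "carrier (rep_of V \<pi>) = carrier V" "\<zero>\<^bsub>rep_of V \<pi>\<^esub> = \<zero>\<^bsub>V\<^esub>"
  "u \<oplus>\<^bsub>rep_of V \<pi>\<^esub> v = u \<oplus>\<^bsub>V\<^esub> v" "c \<odot>\<^bsub>rep_of V \<pi>\<^esub> v = c \<odot>\<^bsub>V\<^esub> v" "act (rep_of V \<pi>) = \<pi>"
  by (simp_all add: rep_of_def module.defs rep.defs)

lemma is_rep_module_algebra:
  assumes "complex_space A" "module_algebra q A \<pi>"
  shows "is_rep (uq q) (rep_of A \<pi>)"
proof -
  have "complex_space (rep_of A \<pi>)"
    by (rule complex_space_image[OF assms(1), where f = "\<lambda>v. v"]) simp_all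
  moreover have "linear_map (rep_of A \<pi>) (rep_of A \<pi>) = linear_map A A"
    by (intro ext) (simp add: linear_map_def)
  then have "End_alg (rep_of A \<pi>) = End_alg A" by (simp add: End_alg_def)
  ultimately show ?thesis using assms(2) by (simp add: is_rep_def module_algebra_def complex_space_def)
qed

lemma tensor_single:
  "tensor (Poly_Mapping.single u 1) (Poly_Mapping.single v 1) = Poly_Mapping.single (u, v) 1"
  by (simp add: tensor_def)

lemma free_lift_gen: "free_lift (Poly_Mapping.single 0) \<phi> (gen g) = \<phi> g"
  by (simp add: free_lift_def gen_def)

text \<open>
  The axiom of a module algebra quantifies over all representatives of the coproduct; for a
  generator its defining expression is one of them.
\<close>

lemma comult_gen_in: "comult_gen g \<in> uq_comult q (uq_class q (gen g))"
proof -
  have "free_lift (Poly_Mapping.single 0) comult_gen (gen g) = comult_gen g"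
    by (rule free_lift_gen)
  then have "comult_gen g \<in> pres_class (uq_tensor_relators q)
      (free_lift (Poly_Mapping.single 0) comult_gen (gen g))"
    using pres_class_self by simp
  then show ?thesis
    unfolding uq_comult_def uq_class_def using pres_class_self by (rule UN_I[rotated])
qed

text \<open>
  A character of a free algebra is the same as an action on a one-dimensional space.  In this form
  the general statement about operators and relators shows that the counit does not depend on the
  representative.
\<close>

lemma free_lift_id_eq_free_act:
  "Poly_Mapping.single () (free_lift id \<phi> p)
    = free_act (\<lambda>g. scale (\<phi> g)) p (Poly_Mapping.single () 1)"
proof -
  have "foldr (\<lambda>g. scale (\<phi> g)) ls (Poly_Mapping.single () 1)
      = Poly_Mapping.single () (prod_list (map \<phi> ls))" for ls
    by (induction ls) simp_all
  then show ?thesis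
    by (intro poly_mapping_eqI) (simp add: free_act_def free_lift_def lookup_sum)
qed

lemma uq_counit_gen: "uq_counit (uq_class q (gen g)) = counit_gen g"
proof -
  let ?T = "free_act (\<lambda>g. scale (counit_gen g))"
  have lin: "clinear (scale c)" for c :: complex
    by (rule clinearI) (simp_all add: scale_add_right scale_scale mult.commute)
  have "?T r v = 0" if "r \<in> uq_relators q" for r and v :: "unit \<Rightarrow>\<^sub>0 complex"
    using that by (auto simp: uq_relators_def free_act_diff free_act_scale free_act_mult[OF lin]
        free_act_gen free_act_one)
  from free_act_pres_class[OF lin this]
  have *: "(\<lambda>p. ?T p (Poly_Mapping.single () 1)) ` uq_class q (gen g)
      = {?T (gen g) (Poly_Mapping.single () 1)}"
    by (simp add: uq_class_def)
  have "free_lift id counit_gen p = counit_gen g" if "p \<in> uq_class q (gen g)" for p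
  proof -
    have "?T p (Poly_Mapping.single () 1) \<in> (\<lambda>p. ?T p (Poly_Mapping.single () 1)) ` uq_class q (gen g)"
      using that by (rule imageI)
    then have "?T p (Poly_Mapping.single () 1) = ?T (gen g) (Poly_Mapping.single () 1)"
      unfolding * by (rule singletonD)
    then have "Poly_Mapping.single () (free_lift id counit_gen p) = Poly_Mapping.single () (counit_gen g)"
      by (simp add: free_lift_id_eq_free_act free_act_gen)
    then have "Poly_Mapping.lookup (Poly_Mapping.single () (free_lift id counit_gen p)) ()
        = Poly_Mapping.lookup (Poly_Mapping.single () (counit_gen g)) ()" by (rule arg_cong)
    then show ?thesis by simp
  qed
  then have "free_lift id counit_gen ` uq_class q (gen g) = {counit_gen g}"
    using pres_class_self[of "gen g" "uq_relators q"] unfolding uq_class_def by (auto intro: rev_image_eqI)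
  then show ?thesis by (simp add: uq_counit_def)
qed

context
  fixes q :: complex and A :: "(complex, 'a) module" (structure)
    and \<pi> :: "uq_gen free_algebra set \<Rightarrow> 'a \<Rightarrow> 'a"
  assumes A: "complex_space A" and MA: "module_algebra q A \<pi>"
    and mult: "\<And>a b. a \<in> carrier A \<Longrightarrow> b \<in> carrier A \<Longrightarrow> a \<otimes> b \<in> carrier A"
begin

interpretation complex_space A by (rule A)

lemma module_algebra_closed: "a \<in> carrier A \<Longrightarrow> \<pi> (uq_class q p) a \<in> carrier A"
  using uq_act_closed[OF is_rep_module_algebra[OF A MA], of a p] by simp

lemma module_algebra_comult:
  assumes "a \<in> carrier A" "b \<in> carrier A"
  shows "\<pi> (uq_class q (gen g)) (a \<otimes> b) =
    (\<Oplus>i\<in>Poly_Mapping.keys (comult_gen g). (case i of (u, v) \<Rightarrow>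
      Poly_Mapping.lookup (comult_gen g) (u, v) \<odot>
        (\<pi> (uq_class q (Poly_Mapping.single u 1)) a \<otimes> \<pi> (uq_class q (Poly_Mapping.single v 1)) b)))"
proof -
  have "uq_class q (gen g) \<in> carrier (uq q)" by (simp add: uq_class_def uq_def)
  then show ?thesis
    using MA assms comult_gen_in[of g q] unfolding module_algebra_def by blast
qed

lemma module_algebra_K:
  assumes ab: "a \<in> carrier A" "b \<in> carrier A"
  shows "\<pi> (uq_k q) (a \<otimes> b) = \<pi> (uq_k q) a \<otimes> \<pi> (uq_k q) b"
proof -
  let ?K = "Word [GenK]"
  have "comult_gen GenK = Poly_Mapping.single (?K, ?K) 1"
    using tensor_single[of ?K ?K] by (simp add: gen_def)
  then show ?thesis
    using module_algebra_comult[OF ab, of GenK] mult[OF module_algebra_closed[OF ab(1)] module_algebra_closed[OF ab(2)]]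
    by (simp add: gen_def)
qed

lemma module_algebra_E:
  assumes ab: "a \<in> carrier A" "b \<in> carrier A"
  shows "\<pi> (uq_e q) (a \<otimes> b) = a \<otimes> \<pi> (uq_e q) b \<oplus> \<pi> (uq_e q) a \<otimes> \<pi> (uq_k q) b"
proof -
  let ?K = "Word [GenK]" and ?E = "Word [GenE]"
  let ?z = "Poly_Mapping.single (0, ?E) 1 + Poly_Mapping.single (?E, ?K) (1 :: complex)"
  have ne: "(0, ?E) \<noteq> (?E, ?K)" by simp
  have "comult_gen GenE = ?z"
    using tensor_single[of 0 ?E] tensor_single[of ?E ?K] by (simp add: gen_def)
  moreover have "Poly_Mapping.lookup ?z (0, ?E) = 1" "Poly_Mapping.lookup ?z (?E, ?K) = 1"
    by (simp_all add: lookup_add lookup_single)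
  moreover have "Poly_Mapping.keys ?z = {(0, ?E), (?E, ?K)}"
    by (auto simp: in_keys_iff lookup_add lookup_single when_def split: if_splits)
  moreover have "\<pi> (uq_class q 1) a = a"
    using uq_act_one[OF is_rep_module_algebra[OF A MA], of a] ab by simp
  ultimately show ?thesis
    using module_algebra_comult[OF ab, of GenE] ne ab
    by (simp add: gen_def mult module_algebra_closed)
qed

lemma module_algebra_one: "\<pi> (uq_class q (gen g)) \<one> = counit_gen g \<odot> \<one>"
proof -
  have "uq_class q (gen g) \<in> carrier (uq q)" by (simp add: uq_class_def uq_def)
  then show ?thesis using MA uq_counit_gen[of q g] by (simp add: module_algebra_def)
qed

end

section \<open>Bases adapted to a lowering operator\<close>

text \<open>
  The model of the operator \<open>e\<close> on the quantum plane: a weighted shift in the first coordinate,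
  with the bottom row as its kernel when no weight vanishes.
\<close>

definition lowering :: "(nat \<times> nat \<Rightarrow> complex) \<Rightarrow> (nat \<times> nat \<Rightarrow>\<^sub>0 complex) \<Rightarrow> (nat \<times> nat \<Rightarrow>\<^sub>0 complex)"
  where "lowering c =
    linear_ext (\<lambda>(m, n). case m of 0 \<Rightarrow> 0 | Suc k \<Rightarrow> Poly_Mapping.single (k, n) (c (k, n)))"

lemma lookup_lowering:
  "Poly_Mapping.lookup (lowering c v) (m, n) = c (m, n) * Poly_Mapping.lookup v (Suc m, n)"
proof (induction v rule: finitely_supported_induct)
  case (single i d)
  then show ?case
    by (cases i) (auto simp: lowering_def lookup_single when_def split: nat.splits)
next
  case (add u v)
  then show ?case
    by (simp add: lowering_def clinear_add[OF clinear_linear_ext] lookup_add distrib_left)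
qed

lemma surj_lowering:
  assumes "\<And>i. c i \<noteq> 0"
  shows "\<exists>w. lowering c w = v"
proof
  let ?R = "linear_ext (\<lambda>i. Poly_Mapping.single (Suc (fst i), snd i) (inverse (c i)))"
  have "(\<lambda>v. lowering c (?R v)) = (\<lambda>v. v)"
  proof (rule clinear_eqI)
    show "clinear (\<lambda>v. lowering c (?R v))"
      unfolding lowering_def by (rule clinear_comp[OF clinear_linear_ext clinear_linear_ext])
  qed (simp_all add: lowering_def clinear_def assms)
  then show "lowering c (?R v) = v" by (rule fun_cong)
qed

context complex_space
begin

lemma lowering_intertwines:
  assumes E: "linear_map M M E" and F: "linear_map monoid_algebra M F"
    and bottom: "\<And>n. E (F (Poly_Mapping.single (0, n) 1)) = \<zero>"
    and lower: "\<And>m n. E (F (Poly_Mapping.single (Suc m, n) 1))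
      = c (m, n) \<odot> F (Poly_Mapping.single (m, n) 1)"
  shows "E (F v) = F (lowering c v)"
proof (rule linear_map_monoid_algebra_eqI[where f = "\<lambda>v. E (F v)" and g = "\<lambda>v. F (lowering c v)"])
  show "linear_map monoid_algebra M (\<lambda>v. E (F v))" by (rule linear_map_comp[OF F E])
  show "linear_map monoid_algebra M (\<lambda>v. F (lowering c v))"
    unfolding lowering_def by (rule linear_map_comp[OF linear_map_clinear[OF clinear_linear_ext] F])
  fix i :: "nat \<times> nat"
  obtain m n where i: "i = (m, n)" by (cases i)
  have F_single: "F (Poly_Mapping.single j d) = d \<odot> F (Poly_Mapping.single j 1)" for j d
    using linear_map_smult[OF F, of "Poly_Mapping.single j 1" d] by simp
  have F_0: "F 0 = \<zero>"
    using linear_map_zero[OF complex_space_monoid_algebra complex_space_axioms F] by simp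
  show "E (F (Poly_Mapping.single i 1)) = F (lowering c (Poly_Mapping.single i 1))"
    using bottom lower
    by (cases m) (simp_all add: i lowering_def F_0 F_single[of _ "c _"] del: single_one)
qed

text \<open>
  If \<open>E\<close> acts on two families by nowhere vanishing weighted shifts and the families share their
  bottom row, then one is a basis as soon as the other is.  Both halves go by induction on the number of rows occupied: applying \<open>E\<close>
  removes a row, and what \<open>E\<close> annihilates lies in the bottom row, where the families agree.
\<close>

lemma lowering_basis:
  assumes E: "linear_map M M E"
    and F: "linear_map monoid_algebra M F" "inj F" "range F = carrier M"
    and B: "linear_map monoid_algebra M B"
    and F_low: "\<And>v. E (F v) = F (lowering c v)" and B_low: "\<And>v. E (B v) = B (lowering d v)"
    and d: "\<And>i. d i \<noteq> 0" and c: "\<And>i. c i \<noteq> 0"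
    and bottom: "\<And>n. B (Poly_Mapping.single (0, n) 1) = F (Poly_Mapping.single (0, n) 1)"
  shows "inj B" "range B = carrier M"
proof -
  have diff: "L (u - v) = L u \<oplus> (- 1) \<odot> L v" if "linear_map monoid_algebra M L" for L u v
    using linear_map_add[OF that, of u "scale (- 1) v"] linear_map_smult[OF that, of v "- 1"]
    by (simp add: scale_minus_one)
  have F_in: "F v \<in> carrier M" and B_in: "B v \<in> carrier M" for v
    using linear_map_closed[OF F(1), of v] linear_map_closed[OF B, of v] by simp_all
  have F_0: "F 0 = \<zero>" and B_0: "B 0 = \<zero>"
    using linear_map_zero[OF complex_space_monoid_algebra complex_space_axioms F(1)]
      linear_map_zero[OF complex_space_monoid_algebra complex_space_axioms B] by simp_all
  have F_zero: "v = 0" if "F v = \<zero>" for v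
    using injD[OF F(2), of v 0] that F_0 by simp
  have agree: "B v = F v" if "\<And>m n. Poly_Mapping.lookup v (Suc m, n) = 0" for v
  proof -
    let ?P = "linear_ext (\<lambda>(m, n). if m = 0 then Poly_Mapping.single (m, n) 1 else 0)"
    have "Poly_Mapping.lookup (?P u) (m, n) = (if m = 0 then Poly_Mapping.lookup u (m, n) else 0)"
      for u and m n :: nat
    proof (induction u rule: finitely_supported_induct)
      case (single i c)
      then show ?case by (cases i) (auto simp: lookup_single when_def)
    next
      case (add u v)
      then show ?case by (auto simp: clinear_add[OF clinear_linear_ext] lookup_add)
    qed
    then have "?P v = v"
      using that by (intro poly_mapping_eqI) (auto simp: gr0_conv_Suc)
    moreover have "B (?P v) = F (?P v)"
    proof (rule linear_map_monoid_algebra_eqI[where f = "\<lambda>v. B (?P v)" and g = "\<lambda>v. F (?P v)"])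
      show "linear_map monoid_algebra M (\<lambda>v. B (?P v))" "linear_map monoid_algebra M (\<lambda>v. F (?P v))"
        by (rule linear_map_comp[OF linear_map_clinear[OF clinear_linear_ext]], fact)+
    qed (auto simp: bottom F_0 B_0 simp del: single_one split: prod.splits)
    ultimately show ?thesis by simp
  qed
  have bounded: "\<exists>k. \<forall>m n. k \<le> m \<longrightarrow> Poly_Mapping.lookup v (m, n) = 0"
    for v :: "nat \<times> nat \<Rightarrow>\<^sub>0 complex"
  proof -
    obtain k where "\<forall>m\<in>fst ` Poly_Mapping.keys v. m < k"
      using finite_nat_set_iff_bounded[of "fst ` Poly_Mapping.keys v"] by auto
    then show ?thesis by (intro exI[of _ k]) (force simp: in_keys_iff)
  qed
  have B_zero: "v = 0" if "B v = \<zero>" "\<And>m n. k \<le> m \<Longrightarrow> Poly_Mapping.lookup v (m, n) = 0" for k v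
    using that
  proof (induction k arbitrary: v)
    case 0
    show ?case
      by (rule poly_mapping_eqI) (metis 0(2) le0 lookup_zero surj_pair)
  next
    case (Suc k)
    have "B (lowering d v) = \<zero>"
      unfolding B_low[symmetric] Suc.prems(1)
      by (rule linear_map_zero[OF complex_space_axioms complex_space_axioms E])
    moreover have "Poly_Mapping.lookup (lowering d v) (m, n) = 0" if "k \<le> m" for m n
      using Suc.prems(2)[of "Suc m" n] that by (simp add: lookup_lowering)
    ultimately have low: "lowering d v = 0" by (rule Suc.IH)
    have "Poly_Mapping.lookup v (Suc m, n) = 0" for m n
      using lookup_lowering[of d v m n] d[of "(m, n)"] low by simp
    then have "B v = F v" by (rule agree)
    then show ?case using F_zero Suc.prems(1) by simp
  qed
  show "inj B"
  proof (rule injI)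
    fix u v assume "B u = B v"
    then have "B (u - v) = \<zero>"
      using diff[OF B, of u v] B_in[of v] by (simp add: smult_minus_one M.r_neg)
    moreover obtain k where "\<forall>m n. k \<le> m \<longrightarrow> Poly_Mapping.lookup (u - v) (m, n) = 0"
      using bounded by blast
    ultimately have "u - v = 0" by (intro B_zero[of "u - v" k]) simp_all
    then show "u = v" by simp
  qed
  have B_surj: "\<exists>w. F v = B w" if "\<And>m n. k \<le> m \<Longrightarrow> Poly_Mapping.lookup v (m, n) = 0" for k v
    using that
  proof (induction k arbitrary: v)
    case 0
    have "v = 0"
      by (rule poly_mapping_eqI) (metis 0 le0 lookup_zero surj_pair)
    then have "F v = B 0" by (simp add: F_0 B_0)
    then show ?case by (rule exI)
  next
    case (Suc k)
    have "Poly_Mapping.lookup (lowering c v) (m, n) = 0" if "k \<le> m" for m n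
      using Suc.prems[of "Suc m" n] that by (simp add: lookup_lowering)
    then obtain w where w: "F (lowering c v) = B w" using Suc.IH by blast
    obtain w' where w': "lowering d w' = w" using surj_lowering[of d w] d by blast
    \<comment> \<open>The vector \<open>B w'\<close> has the same image under \<open>E\<close> as \<open>F v\<close>, so
      it differs from \<open>F v\<close> by a vector of the bottom row.\<close>
    obtain u where u: "B w' = F u" using F(3) B_in[of w'] by (metis rangeE)
    have "F (lowering c u) = E (B w')" by (simp only: u F_low)
    also have "\<dots> = F (lowering c v)" by (simp only: B_low w' w)
    finally have "lowering c u = lowering c v" using injD[OF F(2)] by blast
    then have "Poly_Mapping.lookup u (Suc m, n) = Poly_Mapping.lookup v (Suc m, n)" for m n
      using lookup_lowering[of c u m n] lookup_lowering[of c v m n] c[of "(m, n)"] by simp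
    then have "B (v - u) = F (v - u)" by (intro agree) (simp add: lookup_minus)
    moreover have "F v = F (v - u) \<oplus> F u" "B (v - u + w') = B (v - u) \<oplus> B w'"
      using linear_map_add[OF F(1), of "v - u" u] linear_map_add[OF B, of "v - u" w'] by simp_all
    ultimately have "F v = B (v - u + w')" using u by simp
    then show ?case by (rule exI)
  qed
  show "range B = carrier M"
  proof
    show "range B \<subseteq> carrier M" using B_in by auto
    show "carrier M \<subseteq> range B"
    proof
      fix a assume "a \<in> carrier M"
      then obtain v where v: "a = F v" using F(3) by (metis rangeE)
      obtain k where "\<forall>m n. k \<le> m \<longrightarrow> Poly_Mapping.lookup v (m, n) = 0"
        using bounded by blast
      then obtain w where "F v = B w" using B_surj[of k v] by blast
      then show "a \<in> range B" using v by (metis rangeI)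
    qed
  qed
qed

lemma linear_map_sum:
  assumes F: "linear_map monoid_algebra M F" and "finite S"
  shows "F (\<Sum>i\<in>S. g i) = (\<Oplus>i\<in>S. F (g i))"
  using \<open>finite S\<close>
proof (induction S rule: finite_induct)
  case empty
  then show ?case
    using linear_map_zero[OF complex_space_monoid_algebra complex_space_axioms F] by simp
next
  case (insert i S)
  have "F v \<in> carrier M" for v using linear_map_closed[OF F, of v] by simp
  then show ?case
    using insert linear_map_add[OF F, of "g i" "\<Sum>i\<in>S. g i"] by (simp add: M.finsum_insert Pi_def)
qed

text \<open>
  Grouping the coordinates of a vector by columns gives its components, and bijectivity of
  \<open>B\<close> leaves no other choice.
\<close>

lemma internal_direct_sum_columns:
  fixes B :: "(nat \<times> nat \<Rightarrow>\<^sub>0 complex) \<Rightarrow> 'v"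
  assumes B: "linear_map monoid_algebra M B" "inj B" "range B = carrier M"
  shows "internal_direct_sum M UNIV (\<lambda>n. B ` {v. Poly_Mapping.keys v \<subseteq> range (\<lambda>i. (i, n))})"
  unfolding internal_direct_sum_def
proof (intro conjI ballI)
  let ?V = "\<lambda>n. B ` {v. Poly_Mapping.keys v \<subseteq> range (\<lambda>i. (i, n))}"
  show "?V n \<subseteq> carrier M" for n using B(3) by auto
  fix a assume "a \<in> carrier M"
  then obtain v where v: "a = B v" using B(3) by (metis rangeE)
  define part :: "nat \<Rightarrow> (nat \<times> nat \<Rightarrow>\<^sub>0 complex) \<Rightarrow> (nat \<times> nat \<Rightarrow>\<^sub>0 complex)"
    where "part n = linear_ext (\<lambda>i. if snd i = n then Poly_Mapping.single i 1 else 0)" for n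
  have part: "Poly_Mapping.lookup (part n u) i = (if snd i = n then Poly_Mapping.lookup u i else 0)"
    for n u i
  proof (induction u rule: finitely_supported_induct)
    case (single j c)
    then show ?case by (auto simp: part_def lookup_single when_def)
  next
    case (add u v)
    then show ?case by (auto simp: part_def clinear_add[OF clinear_linear_ext] lookup_add)
  qed
  have column: "Poly_Mapping.keys w \<subseteq> range (\<lambda>i. (i, n)) \<longleftrightarrow> (\<forall>i. snd i \<noteq> n \<longrightarrow> Poly_Mapping.lookup w i = 0)"
    for w :: "nat \<times> nat \<Rightarrow>\<^sub>0 complex" and n
    by (force simp: in_keys_iff subset_iff image_iff)
  have B_0: "B 0 = \<zero>"
    using linear_map_zero[OF complex_space_monoid_algebra complex_space_axioms B(1)] by simp
  have B_eq_0: "B w = \<zero> \<longleftrightarrow> w = 0" for w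
    using injD[OF B(2), of w 0] B_0 by auto
  show "\<exists>!f. f \<in> (\<Pi>\<^sub>E i\<in>UNIV. ?V i) \<and> finite {i \<in> UNIV. f i \<noteq> \<zero>} \<and> a = (\<Oplus>i\<in>{i \<in> UNIV. f i \<noteq> \<zero>}. f i)"
  proof (rule ex1I[where a = "\<lambda>n. B (part n v)"])
    let ?S = "{i \<in> UNIV. B (part i v) \<noteq> \<zero>}"
    have "?S \<subseteq> snd ` Poly_Mapping.keys v"
    proof
      fix n assume "n \<in> ?S"
      then have "part n v \<noteq> 0" by (simp add: B_eq_0)
      then obtain i where "Poly_Mapping.lookup (part n v) i \<noteq> 0"
        using poly_mapping_eqI[of "part n v" 0] by auto
      then have "snd i = n" "i \<in> Poly_Mapping.keys v"
        by (auto simp: part in_keys_iff split: if_splits)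
      then show "n \<in> snd ` Poly_Mapping.keys v" by auto
    qed
    then have fin: "finite ?S" by (rule finite_subset) simp
    have "(\<Sum>n\<in>?S. part n v) = v"
    proof (rule poly_mapping_eqI)
      fix i
      have "Poly_Mapping.lookup (\<Sum>n\<in>?S. part n v) i
          = (\<Sum>n\<in>?S. if snd i = n then Poly_Mapping.lookup v i else 0)"
        by (simp add: lookup_sum part)
      also have "\<dots> = (if snd i \<in> ?S then Poly_Mapping.lookup v i else 0)"
        using fin by (rule sum.delta')
      also have "\<dots> = Poly_Mapping.lookup v i"
        using part[of "snd i" v i] by (auto simp: B_eq_0)
      finally show "Poly_Mapping.lookup (\<Sum>n\<in>?S. part n v) i = Poly_Mapping.lookup v i" .
    qed
    then have "a = (\<Oplus>i\<in>?S. B (part i v))"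
      using linear_map_sum[OF B(1) fin, of "\<lambda>n. part n v"] v by simp
    moreover have "B (part n v) \<in> ?V n" for n
      by (intro imageI) (simp add: column part)
    ultimately show "(\<lambda>n. B (part n v)) \<in> (\<Pi>\<^sub>E i\<in>UNIV. ?V i) \<and> finite ?S \<and> a = (\<Oplus>i\<in>?S. B (part i v))"
      using fin by (intro conjI PiE_I) simp_all
  next
    fix f
    assume f: "f \<in> (\<Pi>\<^sub>E i\<in>UNIV. ?V i) \<and> finite {i \<in> UNIV. f i \<noteq> \<zero>} \<and> a = (\<Oplus>i\<in>{i \<in> UNIV. f i \<noteq> \<zero>}. f i)"
    let ?S = "{i \<in> UNIV. f i \<noteq> \<zero>}"
    have "\<forall>n. \<exists>w. f n = B w \<and> Poly_Mapping.keys w \<subseteq> range (\<lambda>i. (i, n))"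
    proof
      fix n
      have "f n \<in> ?V n" using f PiE_mem[of f UNIV ?V n] by simp
      then show "\<exists>w. f n = B w \<and> Poly_Mapping.keys w \<subseteq> range (\<lambda>i. (i, n))" by (rule imageE) blast
    qed
    then obtain w where w: "\<And>n. f n = B (w n)" "\<And>n. Poly_Mapping.keys (w n) \<subseteq> range (\<lambda>i. (i, n))"
      by metis
    have "B v = B (\<Sum>n\<in>?S. w n)"
      using f linear_map_sum[OF B(1), of ?S w] v by (simp add: w(1))
    then have v_sum: "v = (\<Sum>n\<in>?S. w n)" by (rule injD[OF B(2)])
    have w0: "Poly_Mapping.lookup (w n) i = 0" if "snd i \<noteq> n" for n i
      using w(2)[of n] that unfolding column by blast
    have "w n = part n v" for n
    proof (rule poly_mapping_eqI)
      fix i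
      have "Poly_Mapping.lookup v i = (\<Sum>k\<in>?S. if snd i = k then Poly_Mapping.lookup (w (snd i)) i else 0)"
        unfolding v_sum lookup_sum by (rule sum.cong) (simp_all add: w0)
      also have "\<dots> = (if snd i \<in> ?S then Poly_Mapping.lookup (w (snd i)) i else 0)"
        using f by (intro sum.delta') simp
      also have "\<dots> = Poly_Mapping.lookup (w (snd i)) i"
        by (auto simp: w(1) B_eq_0)
      finally show "Poly_Mapping.lookup (w n) i = Poly_Mapping.lookup (part n v) i"
        by (simp add: part w0)
    qed
    then show "f = (\<lambda>n. B (part n v))" using w(1) by auto
  qed
qed

end

definition push_forward :: "('i \<Rightarrow> 'j) \<Rightarrow> ('i \<Rightarrow>\<^sub>0 complex) \<Rightarrow> ('j \<Rightarrow>\<^sub>0 complex)"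
  where "push_forward h = linear_ext (\<lambda>i. Poly_Mapping.single (h i) 1)"

lemma clinear_push_forward: "clinear (push_forward h)"
  unfolding push_forward_def by (rule clinear_linear_ext)

lemma push_forward_single [simp]: "push_forward h (Poly_Mapping.single i c) = Poly_Mapping.single (h i) c"
  by (simp add: push_forward_def)

lemma lookup_push_forward:
  assumes "inj h"
  shows "Poly_Mapping.lookup (push_forward h w) (h i) = Poly_Mapping.lookup w i"
proof (induction w rule: finitely_supported_induct)
  case (single j c)
  then show ?case using assms by (auto simp: lookup_single when_def dest: injD)
qed (simp add: clinear_add[OF clinear_push_forward] lookup_add)

lemma lookup_push_forward_outside: "j \<notin> range h \<Longrightarrow> Poly_Mapping.lookup (push_forward h w) j = 0"
proof (induction w rule: finitely_supported_induct)
  case (single i c)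
  then show ?case by (auto simp: lookup_single when_def)
qed (simp add: clinear_add[OF clinear_push_forward] lookup_add)

lemma range_push_forward:
  fixes h :: "'i \<Rightarrow> 'j"
  assumes "inj h"
  shows "range (push_forward h) = {v. Poly_Mapping.keys v \<subseteq> range h}"
proof (intro equalityI subsetI)
  fix v assume "v \<in> range (push_forward h)"
  then obtain w where "v = push_forward h w" by auto
  then show "v \<in> {v. Poly_Mapping.keys v \<subseteq> range h}"
    using lookup_push_forward_outside[of _ h w] by (auto simp: in_keys_iff)
next
  fix v :: "'j \<Rightarrow>\<^sub>0 complex" assume v: "v \<in> {v. Poly_Mapping.keys v \<subseteq> range h}"
  have "v = push_forward h (Poly_Mapping.map_key h v)"
  proof (rule poly_mapping_eqI)
    fix j
    show "Poly_Mapping.lookup v j = Poly_Mapping.lookup (push_forward h (Poly_Mapping.map_key h v)) j"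
    proof (cases "j \<in> range h")
      case True
      then show ?thesis using lookup_push_forward[OF assms] by (auto simp: map_key.rep_eq[OF assms])
    next
      case False
      then show ?thesis using v by (auto simp: lookup_push_forward_outside in_keys_iff)
    qed
  qed
  then show "v \<in> range (push_forward h)" by (rule range_eqI)
qed

lemma inj_push_forward: "inj h \<Longrightarrow> inj (push_forward h)"
  by (rule injI, rule poly_mapping_eqI) (metis lookup_push_forward)

context complex_space
begin

lemma submodule_lin_comb_image:
  fixes b :: "'i::monoid_add \<Rightarrow> 'v"
  assumes b: "\<And>i. b i \<in> carrier M"
  shows "submodule (lin_comb M b ` {v. Poly_Mapping.keys v \<subseteq> I}) \<CC> M"
proof (rule complex_submoduleI)
  note lin = linear_map_lin_comb[of b, OF b]
  show "lin_comb M b ` {v. Poly_Mapping.keys v \<subseteq> I} \<subseteq> carrier M"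
    using linear_map_closed[OF lin] by auto
  have "\<zero> = lin_comb M b 0"
    using linear_map_zero[OF complex_space_monoid_algebra complex_space_axioms lin] by simp
  then show "\<zero> \<in> lin_comb M b ` {v. Poly_Mapping.keys v \<subseteq> I}"
    by (rule image_eqI) simp
next
  note lin = linear_map_lin_comb[of b, OF b]
  fix u v assume "u \<in> lin_comb M b ` {v. Poly_Mapping.keys v \<subseteq> I}"
    "v \<in> lin_comb M b ` {v. Poly_Mapping.keys v \<subseteq> I}"
  then obtain u' v' where *: "u = lin_comb M b u'" "v = lin_comb M b v'"
    "Poly_Mapping.keys u' \<subseteq> I" "Poly_Mapping.keys v' \<subseteq> I" by auto
  then have "u \<oplus> v = lin_comb M b (u' + v')"
    using linear_map_add[OF lin, of u' v'] by simp
  then show "u \<oplus> v \<in> lin_comb M b ` {v. Poly_Mapping.keys v \<subseteq> I}"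
    using * keys_add[of u' v'] by (intro image_eqI[where x = "u' + v'"]) auto
next
  note lin = linear_map_lin_comb[of b, OF b]
  fix c v assume "v \<in> lin_comb M b ` {v. Poly_Mapping.keys v \<subseteq> I}"
  then obtain v' where *: "v = lin_comb M b v'" "Poly_Mapping.keys v' \<subseteq> I" by auto
  then have "c \<odot> v = lin_comb M b (scale c v')"
    using linear_map_smult[OF lin, of v' c] by simp
  then show "c \<odot> v \<in> lin_comb M b ` {v. Poly_Mapping.keys v \<subseteq> I}"
    using * by (intro image_eqI[where x = "scale c v'"]) (auto simp: in_keys_iff subset_iff)
qed

end

lemma subrep_lin_comb_image:
  fixes b :: "'i::monoid_add \<Rightarrow> 'v" and M :: "('g free_algebra set, 'v) rep"
  assumes M: "is_rep (presented_algebra R) M" and b: "\<And>i. b i \<in> carrier M"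
    and gens: "\<And>g i. i \<in> I \<Longrightarrow> act M (pres_class R (gen g)) (b i)
      \<in> lin_comb M b ` {v. Poly_Mapping.keys v \<subseteq> I}"
  shows "subrep (presented_algebra R) M (lin_comb M b ` {v. Poly_Mapping.keys v \<subseteq> I})"
proof (rule subrepI_generators[OF M])
  interpret complex_space M using M by (rule is_rep_space)
  let ?N = "lin_comb M b ` {v. Poly_Mapping.keys v \<subseteq> I}"
  show sub: "submodule ?N \<CC> M" by (rule submodule_lin_comb_image[of b, OF b])
  fix g a assume "a \<in> ?N"
  then obtain v where v: "a = lin_comb M b v" "Poly_Mapping.keys v \<subseteq> I" by auto
  have lin: "linear_map M M (act M (pres_class R (gen g)))"
    by (rule act_linear[OF M]) simp
  have b': "act M (pres_class R (gen g)) (b i) \<in> carrier M" for i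
    by (rule linear_map_closed[OF lin b])
  have "act M (pres_class R (gen g)) (lin_comb M b v)
      = lin_comb M (\<lambda>i. act M (pres_class R (gen g)) (b i)) v"
  proof (rule linear_map_monoid_algebra_eqI[where
        f = "\<lambda>v. act M (pres_class R (gen g)) (lin_comb M b v)"
        and g = "lin_comb M (\<lambda>i. act M (pres_class R (gen g)) (b i))"])
    show "linear_map monoid_algebra M (\<lambda>v. act M (pres_class R (gen g)) (lin_comb M b v))"
      by (rule linear_map_comp[OF linear_map_lin_comb[of b, OF b] lin])
    show "linear_map monoid_algebra M (lin_comb M (\<lambda>i. act M (pres_class R (gen g)) (b i)))"
      by (rule linear_map_lin_comb[of "\<lambda>i. act M (pres_class R (gen g)) (b i)", OF b'])
    show "act M (pres_class R (gen g)) (lin_comb M b (Poly_Mapping.single i 1))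
        = lin_comb M (\<lambda>i. act M (pres_class R (gen g)) (b i)) (Poly_Mapping.single i 1)" for i
      using lin_comb_single[of b, OF b, of i 1]
        lin_comb_single[of "\<lambda>i. act M (pres_class R (gen g)) (b i)", OF b', of i 1] b[of i] b'[of i] by simp
  qed
  also have "\<dots> \<in> ?N"
    using sub by (rule lin_comb_in_submodule) (use gens v(2) in auto)
  finally show "act M (pres_class R (gen g)) a \<in> ?N" using v(1) by simp
qed

section \<open>Decomposition of a representation with a lowering operator\<close>

text \<open>
  The vectors \<open>\<Phi> (single (m, n) 1)\<close> stand for the monomials \<open>x\<^sup>m y\<^sup>n\<close>.  The decomposition
  rests on the following properties of \<open>k\<close> and \<open>e\<close> on monomials and on \<open>f 1 = 0\<close>; stating them
  for an abstract representation keeps the cosets of the presented algebra out of sight.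
\<close>

locale lowering_rep =
  fixes q :: complex and M :: "(uq_gen free_algebra set, 'v) rep" (structure)
    and \<Phi> :: "(nat \<times> nat \<Rightarrow>\<^sub>0 complex) \<Rightarrow> 'v" and c :: "nat \<times> nat \<Rightarrow> complex"
  assumes q: "q \<noteq> 0" and not_root: "\<And>n. n > 0 \<Longrightarrow> q ^ n \<noteq> 1"
    and M: "is_rep (uq q) M"
    and \<Phi>: "linear_map monoid_algebra M \<Phi>" "inj \<Phi>" "range \<Phi> = carrier M"
    and K: "\<And>m n. act M (uq_k q) (\<Phi> (Poly_Mapping.single (m, n) 1))
      = inverse (q ^ (2 * m + n)) \<odot> \<Phi> (Poly_Mapping.single (m, n) 1)"
    and E_bottom: "\<And>n. act M (uq_e q) (\<Phi> (Poly_Mapping.single (0, n) 1)) = \<zero>"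
    and E_lower: "\<And>m n. act M (uq_e q) (\<Phi> (Poly_Mapping.single (Suc m, n) 1))
      = c (m, n) \<odot> \<Phi> (Poly_Mapping.single (m, n) 1)"
    and c: "\<And>i. c i \<noteq> 0"
    and F_bottom: "act M (uq_f q) (\<Phi> (Poly_Mapping.single (0, 0) 1)) = \<zero>"
begin

sublocale complex_space M using M by (rule is_rep_space)

abbreviation mon :: "nat \<Rightarrow> nat \<Rightarrow> 'v"
  where "mon m n \<equiv> \<Phi> (Poly_Mapping.single (m, n) 1)"

lemma \<Phi>_in: "\<Phi> v \<in> carrier M"
  using linear_map_closed[OF \<Phi>(1), of v] by simp

lemma \<Phi>_zero_iff: "\<Phi> v = \<zero> \<longleftrightarrow> v = 0"
  using linear_map_zero[OF complex_space_monoid_algebra complex_space_axioms \<Phi>(1)]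
    injD[OF \<Phi>(2), of v 0] by auto

lemma mon_nonzero: "mon m n \<noteq> \<zero>"
  unfolding \<Phi>_zero_iff by (metis lookup_single_eq lookup_zero zero_neq_one)

lemma q_not_inverse: "q \<noteq> inverse q"
proof
  assume "q = inverse q"
  then have "q * q = q * inverse q" by simp
  then show False using not_root[of 2] q by (simp add: power2_eq_square)
qed

text \<open>
  The numerators of the Verma coefficients are differences of this kind, so all of them are nonzero.
\<close>

lemma power_not_inverse: "n > 0 \<Longrightarrow> q ^ n \<noteq> inverse (q ^ n)"
proof
  assume "n > 0" "q ^ n = inverse (q ^ n)"
  then have "q ^ n * q ^ n = q ^ n * inverse (q ^ n)" by simp
  then have "q ^ (n + n) = 1" using q by (simp only: power_add) simp
  then show False using not_root[of "n + n"] \<open>n > 0\<close> by simp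
qed

lemma verma_f_nonzero: "verma_f q i \<noteq> 0"
proof -
  have "verma_f q i = (q * q ^ i - inverse (q * q ^ i)) / (q - inverse q)"
    unfolding verma_f_def powi_simps ..
  then show ?thesis
    using power_not_inverse[of "Suc i"] q_not_inverse by simp
qed

lemma verma_e_nonzero:
  assumes "n > 0"
  shows "verma_e q (inverse (q ^ n)) i \<noteq> 0"
proof -
  have "verma_e q (inverse (q ^ n)) i
      = (inverse (q ^ n) * inverse (q ^ i) - q ^ n * q ^ i) / (q - inverse q)"
    unfolding verma_e_def by (simp add: powi_minus)
  also have "\<dots> = (inverse (q ^ (n + i)) - q ^ (n + i)) / (q - inverse q)"
    by (simp add: power_add)
  finally show ?thesis
    using power_not_inverse[of "n + i"] assms q_not_inverse by simp
qed

lemma weight_nonzero: "inverse (q ^ n) \<noteq> 0"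
  using q by simp

lemma simple_verma: "n > 0 \<Longrightarrow> simple_rep (uq q) (verma q (inverse (q ^ n)))"
  by (rule simple_rep_verma[OF q q_not_inverse weight_nonzero verma_e_nonzero verma_f_nonzero])

lemma K_x: "act M (uq_k q) (mon (Suc 0) 0) = inverse (q ^ 2) \<odot> mon (Suc 0) 0"
  using K[of "Suc 0" 0] by (simp add: power2_eq_square)

lemma K_y: "act M (uq_k q) (mon 0 n) = inverse (q ^ n) \<odot> mon 0 n"
  using K[of 0 n] by simp

lemmas chain_x = verma_vec_in[OF q q_not_inverse weight_nonzero verma_f_nonzero M \<Phi>_in K_x]
  verma_vec_F[OF q q_not_inverse weight_nonzero verma_f_nonzero M \<Phi>_in K_x]
  verma_vec_K[OF q q_not_inverse weight_nonzero verma_f_nonzero M \<Phi>_in K_x]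
  verma_vec_Kinv[OF q q_not_inverse weight_nonzero verma_f_nonzero M \<Phi>_in K_x]

lemmas chain_y = verma_vec_in[OF q q_not_inverse weight_nonzero verma_f_nonzero M \<Phi>_in K_y]
  verma_vec_F[OF q q_not_inverse weight_nonzero verma_f_nonzero M \<Phi>_in K_y]
  verma_vec_K[OF q q_not_inverse weight_nonzero verma_f_nonzero M \<Phi>_in K_y]
  verma_vec_Kinv[OF q q_not_inverse weight_nonzero verma_f_nonzero M \<Phi>_in K_y]

lemma E_x: "act M (uq_e q) (mon (Suc 0) 0) = c (0, 0) \<odot> mon 0 0"
  using E_lower[of 0 0] by simp

lemma E_chain_x: "act M (uq_e q) (verma_vec q M (mon (Suc 0) 0) (Suc i))
    = verma_e q (inverse (q ^ 2)) i \<odot> verma_vec q M (mon (Suc 0) 0) i"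
proof (rule verma_vec_E[OF q q_not_inverse weight_nonzero verma_f_nonzero M \<Phi>_in K_x])
  have "act M (uq_f q) (c (0, 0) \<odot> mon 0 0) = c (0, 0) \<odot> act M (uq_f q) (mon 0 0)"
    by (rule uq_act_vsmult[OF M \<Phi>_in])
  then show "act M (uq_f q) (act M (uq_e q) (mon (Suc 0) 0)) = \<zero>"
    unfolding E_x F_bottom by simp
qed

lemma E_chain_y: "act M (uq_e q) (verma_vec q M (mon 0 n) (Suc i))
    = verma_e q (inverse (q ^ n)) i \<odot> verma_vec q M (mon 0 n) i"
proof (rule verma_vec_E[OF q q_not_inverse weight_nonzero verma_f_nonzero M \<Phi>_in K_y])
  show "act M (uq_f q) (act M (uq_e q) (mon 0 n)) = \<zero>"
    unfolding E_bottom by (rule uq_act_vzero[OF M])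
qed

text \<open>
  Column \<open>n > 0\<close> consists of the divided powers of \<open>y\<^sup>n\<close>.  Column \<open>0\<close> would break off after \<open>1\<close>
  in this form, as \<open>f 1 = 0\<close>; instead it consists of \<open>1\<close> followed by the divided powers of \<open>x\<close>.
\<close>

definition basis :: "nat \<times> nat \<Rightarrow> 'v"
  where "basis = (\<lambda>(i, n).
    if n > 0 then verma_vec q M (mon 0 n) i
    else case i of 0 \<Rightarrow> mon 0 0 | Suc j \<Rightarrow> verma_vec q M (mon (Suc 0) 0) j)"

lemma basis_simps:
  "n > 0 \<Longrightarrow> basis (i, n) = verma_vec q M (mon 0 n) i"
  "basis (0, 0) = mon 0 0" "basis (Suc i, 0) = verma_vec q M (mon (Suc 0) 0) i" "basis (0, n) = mon 0 n"
  by (simp_all add: basis_def)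

lemma basis_in: "basis i \<in> carrier M"
  by (auto simp: basis_def chain_x(1) chain_y(1) \<Phi>_in split: nat.splits prod.splits)

definition B :: "(nat \<times> nat \<Rightarrow>\<^sub>0 complex) \<Rightarrow> 'v"
  where "B = lin_comb M basis"

lemma linear_B: "linear_map monoid_algebra M B"
  unfolding B_def by (rule linear_map_lin_comb[of basis, OF basis_in])

lemma B_single: "B (Poly_Mapping.single i d) = d \<odot> basis i"
  unfolding B_def by (rule lin_comb_single[of basis, OF basis_in])

lemma B_single_1: "B (Poly_Mapping.single i 1) = basis i"
  using B_single[of i 1] basis_in[of i] by simp

definition basis_coeff :: "nat \<times> nat \<Rightarrow> complex"
  where "basis_coeff = (\<lambda>(i, n).
    if n > 0 then verma_e q (inverse (q ^ n)) i
    else case i of 0 \<Rightarrow> c (0, 0) | Suc j \<Rightarrow> verma_e q (inverse (q ^ 2)) j)"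

lemma E_basis_Suc: "act M (uq_e q) (basis (Suc i, n)) = basis_coeff (i, n) \<odot> basis (i, n)"
proof (cases "n > 0")
  case True
  then show ?thesis using E_chain_y[of n i] by (simp add: basis_def basis_coeff_def)
next
  case False
  then show ?thesis
    using E_chain_x E_x
    by (cases i) (simp_all add: basis_def basis_coeff_def del: verma_vec.simps(2))
qed

lemma E_basis_0: "act M (uq_e q) (basis (0, n)) = \<zero>"
  by (simp add: basis_simps E_bottom)

lemma B_bij: "inj B" "range B = carrier M"
proof -
  have low_\<Phi>: "act M (uq_e q) (\<Phi> v) = \<Phi> (lowering c v)" for v
    by (rule lowering_intertwines[OF uq_act_linear[OF M] \<Phi>(1) E_bottom E_lower])
  have low_B: "act M (uq_e q) (B v) = B (lowering basis_coeff v)" for v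
    by (rule lowering_intertwines[OF uq_act_linear[OF M] linear_B])
      (simp_all only: B_single_1 E_basis_0 E_basis_Suc)
  have nonzero: "basis_coeff i \<noteq> 0" for i
    using c verma_e_nonzero[of "snd i"] verma_e_nonzero[of 2]
    by (auto simp: basis_coeff_def split: nat.splits prod.splits)
  have bottom: "B (Poly_Mapping.single (0, n) 1) = mon 0 n" for n
    by (simp only: B_single_1 basis_simps)
  show "inj B" "range B = carrier M"
    by (rule lowering_basis[OF uq_act_linear[OF M] \<Phi> linear_B low_\<Phi> low_B nonzero c bottom])+
qed

definition V :: "nat \<Rightarrow> 'v set"
  where "V n = B ` {v. Poly_Mapping.keys v \<subseteq> range (\<lambda>i. (i, n))}"

lemma direct_sum_V: "internal_direct_sum M UNIV V"
  unfolding V_def[abs_def] using linear_B B_bij by (rule internal_direct_sum_columns)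

lemma basis_in_V: "basis (i, n) \<in> V n"
  unfolding V_def B_single_1[symmetric] by (intro imageI) auto

lemma submodule_V: "submodule (V n) \<CC> M"
  unfolding V_def B_def by (rule submodule_lin_comb_image[of basis, OF basis_in])

lemma smult_basis_in_V: "d \<odot> basis (i, n) \<in> V n"
  using submodule_V basis_in_V by (rule submodule_smult)

lemma subrep_V: "subrep (uq q) M (V n)"
  unfolding V_def B_def uq_def
proof (rule subrep_lin_comb_image[OF M[unfolded uq_def], of basis, OF basis_in])
  fix g and i :: "nat \<times> nat" assume "i \<in> range (\<lambda>i. (i, n))"
  then obtain m where i: "i = (m, n)" by auto
  have "act M (uq_class q (gen g)) (basis (m, n)) \<in> V n"
  proof (cases "n > 0")
    case True
    have E: "act M (uq_e q) (basis (m, n)) \<in> V n"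
      using smult_basis_in_V E_basis_Suc E_basis_0 submodule_zero[OF submodule_V] by (cases m) simp_all
    show ?thesis
      using True E smult_basis_in_V[of _ m n] smult_basis_in_V[of _ "Suc m" n]
      by (cases g) (simp_all add: basis_simps(1) chain_y(2,3,4) del: verma_vec.simps)
  next
    case False
    then have n: "n = 0" by simp
    have E: "act M (uq_e q) (basis (m, n)) \<in> V n"
      using smult_basis_in_V E_basis_Suc E_basis_0 submodule_zero[OF submodule_V] by (cases m) simp_all
    have K0: "act M (uq_k q) (mon 0 0) = 1 \<odot> mon 0 0"
      using K_y[of 0] by simp
    show ?thesis
    proof (cases m)
      case 0
      then show ?thesis
        using n E smult_basis_in_V[of _ 0 0] K0 F_bottom submodule_zero[OF submodule_V]
          uq_Kinv_weight[OF M \<Phi>_in K0]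
        by (cases g) (simp_all add: basis_simps(2))
    next
      case (Suc j)
      then show ?thesis
        using n E smult_basis_in_V[of _ m 0] smult_basis_in_V[of _ "Suc m" 0]
        by (cases g) (simp_all add: basis_simps(3) chain_x(2,3,4) del: verma_vec.simps)
    qed
  qed
  then show "act M (pres_class (uq_relators q) (gen g)) (basis i)
      \<in> lin_comb M basis ` {v. Poly_Mapping.keys v \<subseteq> range (\<lambda>i. (i, n))}"
    by (simp add: i V_def B_def uq_class_def)
qed

lemma y_in_V: "mon 0 n \<in> V n"
  using basis_in_V[of 0 n] by (simp add: basis_simps)

lemma highest_weight_vector_V:
  "highest_weight_vector q (sub_rep M (V n)) (inverse (q ^ n)) (mon 0 n)"
  by (simp add: highest_weight_vector_def y_in_V mon_nonzero E_bottom K_y)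

lemma B_push_forward_y:
  assumes "n > 0"
  shows "lin_comb M (verma_vec q M (mon 0 n)) w = B (push_forward (\<lambda>i. (i, n)) w)"
proof (rule linear_map_monoid_algebra_eqI[where f = "lin_comb M (verma_vec q M (mon 0 n))"
      and g = "\<lambda>w. B (push_forward (\<lambda>i. (i, n)) w)"])
  show "linear_map monoid_algebra M (lin_comb M (verma_vec q M (mon 0 n)))"
    by (rule linear_map_lin_comb) (rule chain_y(1))
  show "linear_map monoid_algebra M (\<lambda>w. B (push_forward (\<lambda>i. (i, n)) w))"
    by (rule linear_map_comp[OF linear_map_clinear[OF clinear_push_forward] linear_B])
  show "lin_comb M (verma_vec q M (mon 0 n)) (Poly_Mapping.single i 1)
      = B (push_forward (\<lambda>i. (i, n)) (Poly_Mapping.single i 1))" for i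
    unfolding push_forward_single B_single basis_simps(1)[OF assms]
    by (rule lin_comb_single) (rule chain_y(1))
qed

lemma V_eq_range:
  assumes "n > 0"
  shows "V n = range (lin_comb M (verma_vec q M (mon 0 n)))"
proof -
  have inj: "inj (\<lambda>i. (i, n))" by (simp add: inj_on_def)
  show ?thesis
    unfolding V_def range_push_forward[OF inj, symmetric] using B_push_forward_y[OF assms] by auto
qed

text \<open>
  A subrepresentation that contains \<open>y\<^sup>n\<close> contains its divided powers, which span the column.
\<close>

lemma V_generated:
  assumes "n > 0"
  shows "V n = generated_subrep (uq q) M {mon 0 n}"
  unfolding generated_subrep_def
proof (rule equalityI)
  show "V n \<subseteq> \<Inter>{N. subrep (uq q) M N \<and> {mon 0 n} \<subseteq> N}"
  proof (rule Inter_greatest)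
    fix N assume "N \<in> {N. subrep (uq q) M N \<and> {mon 0 n} \<subseteq> N}"
    then have N: "subrep (uq q) M N" and y: "mon 0 n \<in> N" by auto
    note N' = subrep_submodule[OF M N]
    have vec: "verma_vec q M (mon 0 n) i \<in> N" for i
    proof (induction i)
      case 0
      then show ?case using y by simp
    next
      case (Suc i)
      then show ?case
        using submodule_smult[OF N'] subrep_act[OF M N uq_class_in[OF M]] by simp
    qed
    have "lin_comb M (verma_vec q M (mon 0 n)) w \<in> N" for w
      using N' by (rule lin_comb_in_submodule) (rule vec)
    then show "V n \<subseteq> N" unfolding V_eq_range[OF assms] by auto
  qed
  show "\<Inter>{N. subrep (uq q) M N \<and> {mon 0 n} \<subseteq> N} \<subseteq> V n"
    using subrep_V y_in_V by (intro Inter_lower) auto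
qed

lemma V_iso_verma:
  assumes "n > 0"
  shows "rep_iso (uq q) (sub_rep M (V n)) (verma q (inverse (q ^ n)))"
proof (rule rep_iso_inverse)
  let ?\<psi> = "lin_comb M (verma_vec q M (mon 0 n))"
  have lin: "linear_map monoid_algebra M ?\<psi>"
    by (rule linear_map_lin_comb) (rule chain_y(1))
  have in_V: "?\<psi> w \<in> V n" for w unfolding V_eq_range[OF assms] by (rule rangeI)
  show "is_rep (uq q) (verma q (inverse (q ^ n)))"
    by (rule is_rep_verma[OF q q_not_inverse weight_nonzero])
  show "linear_map (verma q (inverse (q ^ n))) (sub_rep M (V n)) ?\<psi>"
    using lin in_V by (simp add: linear_map_def)
  have "inj ?\<psi>"
  proof (rule injI)
    fix u w assume "?\<psi> u = ?\<psi> w"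
    then have "push_forward (\<lambda>i. (i, n)) u = push_forward (\<lambda>i. (i, n)) w"
      unfolding B_push_forward_y[OF assms] by (rule injD[OF B_bij(1)])
    then show "u = w" by (rule injD[OF inj_push_forward, rotated]) (simp add: inj_on_def)
  qed
  then show "bij_betw ?\<psi> (carrier (verma q (inverse (q ^ n)))) (carrier (sub_rep M (V n)))"
    by (simp add: bij_betw_def V_eq_range[OF assms])
  show "?\<psi> (act (verma q (inverse (q ^ n))) h w) = act (sub_rep M (V n)) h (?\<psi> w)"
    if "h \<in> carrier (uq q)" for h w
    using verma_hom[OF q q_not_inverse weight_nonzero verma_f_nonzero M \<Phi>_in K_y E_bottom that] in_V
    by simp
qed

definition J :: "'v set"
  where "J = range (\<lambda>d. d \<odot> mon 0 0)"

lemma subrep_J: "subrep (uq q) M J"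
  unfolding uq_def
proof (rule subrepI_generators[OF M[unfolded uq_def]])
  show sub: "submodule J \<CC> M"
  proof (rule complex_submoduleI)
    show "J \<subseteq> carrier M" by (auto simp: J_def \<Phi>_in)
    show "\<zero> \<in> J" unfolding J_def using \<Phi>_in by (intro range_eqI[where x = 0]) simp
  next
    fix u v assume "u \<in> J" "v \<in> J"
    then obtain a b where "u = a \<odot> mon 0 0" "v = b \<odot> mon 0 0" by (auto simp: J_def)
    then show "u \<oplus> v \<in> J"
      unfolding J_def by (intro range_eqI[where x = "a + b"]) (simp add: smult_add \<Phi>_in)
  next
    fix d v assume "v \<in> J"
    then obtain a where "v = a \<odot> mon 0 0" by (auto simp: J_def)
    then show "d \<odot> v \<in> J"
      unfolding J_def by (intro range_eqI[where x = "d * a"]) (simp add: smult_smult \<Phi>_in)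
  qed
  fix g v assume "v \<in> J"
  then obtain a where v: "v = a \<odot> mon 0 0" by (auto simp: J_def)
  have K0: "act M (uq_k q) (mon 0 0) = 1 \<odot> mon 0 0"
    using K_y[of 0] by simp
  have "\<exists>b. act M (uq_class q (gen g)) (mon 0 0) = b \<odot> mon 0 0"
  proof (cases g)
    case GenK
    then show ?thesis using K0 by blast
  next
    case GenKinv
    then show ?thesis using uq_Kinv_weight[OF M \<Phi>_in K0] by auto
  next
    case GenE
    then show ?thesis using E_bottom[of 0] \<Phi>_in by (intro exI[of _ 0]) simp
  next
    case GenF
    then show ?thesis using F_bottom \<Phi>_in by (intro exI[of _ 0]) simp
  qed
  then obtain b where b: "act M (uq_class q (gen g)) (mon 0 0) = b \<odot> mon 0 0" by blast
  have "act M (uq_class q (gen g)) v = a \<odot> (b \<odot> mon 0 0)"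
    unfolding v b[symmetric] by (rule uq_act_vsmult[OF M \<Phi>_in])
  then have "act M (uq_class q (gen g)) v \<in> J"
    unfolding J_def using \<Phi>_in by (intro range_eqI[where x = "a * b"]) (simp add: smult_smult)
  then show "act M (pres_class (uq_relators q) (gen g)) v \<in> J" by (simp add: uq_class_def)
qed

lemma J_subset: "J \<subseteq> V 0"
  using smult_basis_in_V[of _ 0 0] by (auto simp: J_def basis_simps)

lemma x_in_V: "mon (Suc 0) 0 \<in> V 0"
  using basis_in_V[of "Suc 0" 0] basis_simps(3)[of 0] by simp

lemma x_not_in_J: "mon (Suc 0) 0 \<notin> J"
proof
  assume "mon (Suc 0) 0 \<in> J"
  then obtain d where "mon (Suc 0) 0 = d \<odot> mon 0 0" by (auto simp: J_def)
  also have "\<dots> = \<Phi> (Poly_Mapping.single (0, 0) d)"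
    using linear_map_smult[OF \<Phi>(1), of "Poly_Mapping.single (0, 0) 1" d] by simp
  finally have eq: "Poly_Mapping.single (Suc 0, 0 :: nat) 1 = Poly_Mapping.single (0, 0) d"
    by (rule injD[OF \<Phi>(2)])
  have "Poly_Mapping.lookup (Poly_Mapping.single (Suc 0, 0 :: nat) (1 :: complex)) (Suc 0, 0) = 1"
    by simp
  then have "Poly_Mapping.lookup (Poly_Mapping.single (0 :: nat, 0 :: nat) d) (Suc 0, 0) = 1"
    unfolding eq .
  then show False by (simp add: lookup_single when_def)
qed

text \<open>
  Write \<open>x = j + w\<close> with \<open>j\<close> constant and \<open>w\<close> in a complement.  Then \<open>e w = e x\<close> is a nonzero
  constant in the complement.
\<close>

lemma J_not_direct_summand: "\<not> direct_summand (uq q) (sub_rep M (V 0)) J"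
proof
  assume "direct_summand (uq q) (sub_rep M (V 0)) J"
  then obtain W where W: "subrep (uq q) (sub_rep M (V 0)) W" "J \<inter> W = {\<zero>}"
    "J <+>\<^bsub>sub_rep M (V 0)\<^esub> W = V 0"
    by (auto simp: direct_summand_def)
  note P = uq.is_rep_sub_rep[OF M subrep_V[of 0]]
  have sub: "W \<subseteq> V 0" using subrep_subset[OF P W(1)] by simp
  have "mon (Suc 0) 0 \<in> J <+>\<^bsub>sub_rep M (V 0)\<^esub> W" using W(3) x_in_V by simp
  then obtain j w where jw: "j \<in> J" "w \<in> W" "mon (Suc 0) 0 = j \<oplus> w"
    by (auto simp: set_add_def set_mult_def)
  obtain d where d: "j = d \<odot> mon 0 0" using jw(1) by (auto simp: J_def)
  have carr: "j \<in> carrier M" "w \<in> carrier M"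
    using jw sub subrep_subset[OF M subrep_J] subrep_subset[OF M subrep_V] by auto
  have "act M (uq_e q) j = \<zero>"
    using uq_act_vsmult[OF M \<Phi>_in, of "gen GenE" d "Poly_Mapping.single (0, 0) 1"]
    by (simp add: d E_bottom del: single_one)
  then have "c (0, 0) \<odot> mon 0 0 = act M (uq_e q) w"
    using uq_act_vadd[OF M carr, of "gen GenE"] E_x jw(3) carr uq_act_closed[OF M carr(2)] by simp
  also have "\<dots> = act (sub_rep M (V 0)) (uq_e q) w" using jw(2) sub by auto
  also have "\<dots> \<in> W" by (rule subrep_act[OF P W(1) uq_class_in[OF M] jw(2)])
  finally have "c (0, 0) \<odot> mon 0 0 \<in> J \<inter> W" by (auto simp: J_def)
  then have "c (0, 0) \<odot> mon 0 0 = \<zero>" using W(2) by blast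
  then show False using smult_eq_zeroD[OF \<Phi>_in] c mon_nonzero by blast
qed

lemma B_push_forward_x:
  "lin_comb M (verma_vec q M (mon (Suc 0) 0)) w = B (push_forward (\<lambda>i. (Suc i, 0)) w)"
proof (rule linear_map_monoid_algebra_eqI[where f = "lin_comb M (verma_vec q M (mon (Suc 0) 0))"
      and g = "\<lambda>w. B (push_forward (\<lambda>i. (Suc i, 0)) w)"])
  show "linear_map monoid_algebra M (lin_comb M (verma_vec q M (mon (Suc 0) 0)))"
    by (rule linear_map_lin_comb) (rule chain_x(1))
  show "linear_map monoid_algebra M (\<lambda>w. B (push_forward (\<lambda>i. (Suc i, 0)) w))"
    by (rule linear_map_comp[OF linear_map_clinear[OF clinear_push_forward] linear_B])
  show "lin_comb M (verma_vec q M (mon (Suc 0) 0)) (Poly_Mapping.single i 1)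
      = B (push_forward (\<lambda>i. (Suc i, 0)) (Poly_Mapping.single i 1))" for i
    unfolding push_forward_single B_single basis_simps(3)
    by (rule lin_comb_single) (rule chain_x(1))
qed

text \<open>
  In the quotient by the constants, \<open>e x\<close> becomes zero, so the class of \<open>x\<close> receives a homomorphism
  from the Verma module.  It sends \<open>v\<^sub>i\<close> to the class of the \<open>i\<close>-th divided power of \<open>x\<close>; these
  vectors together with \<open>1\<close> are the basis of the column, which gives bijectivity.
\<close>

lemma quotient_iso_verma:
  "rep_iso (uq q) (quot_rep (sub_rep M (V 0)) J) (verma q (inverse (q ^ 2)))"
proof (rule rep_iso_inverse)
  let ?P = "sub_rep M (V 0)"
  let ?Q = "quot_rep ?P J"
  let ?cl = "\<lambda>v. J +>\<^bsub>?P\<^esub> v"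
  have P: "is_rep (uq q) ?P" by (rule uq.is_rep_sub_rep[OF M subrep_V])
  have JP: "subrep (uq q) ?P J" by (rule uq.subrep_sub_rep[OF M subrep_V subrep_J J_subset])
  have Q: "is_rep (uq q) ?Q" by (rule uq.is_rep_quot_rep[OF P JP])
  interpret P: complex_space ?P using P by (rule is_rep_space)
  interpret Q: complex_space ?Q using Q by (rule is_rep_space)
  note J' = subrep_submodule[OF P JP]
  note Q_add = quot_rep_add[OF P JP] and Q_smult = quot_rep_smult[OF P JP]
    and Q_zero = quot_rep_zero[OF P JP] and Q_act = quot_rep_act[OF P JP]
    and Q_carrier = quot_rep_carrier[OF P JP]
  have cl_in: "?cl v \<in> carrier ?Q" if "v \<in> V 0" for v using that by (auto simp: Q_carrier)
  have cl_eq: "?cl u = ?cl v \<longleftrightarrow> u \<oplus> (- 1) \<odot> v \<in> J" if "u \<in> V 0" "v \<in> V 0" for u v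
    using P.coset_eq_iff[OF J', of u v] that by simp
  have act_P: "act ?Q (uq_class q p) (?cl v) = ?cl (act M (uq_class q p) v)" if "v \<in> V 0" for p v
    using Q_act[OF uq_class_in[OF M], of v p] that by simp
  let ?v = "?cl (mon (Suc 0) 0)"
  have v_in: "?v \<in> carrier ?Q" by (rule cl_in[OF x_in_V])
  have v_K: "act ?Q (uq_k q) ?v = inverse (q ^ 2) \<odot>\<^bsub>?Q\<^esub> ?v"
    using act_P[OF x_in_V, of "gen GenK"] Q_smult[of "mon (Suc 0) 0" "inverse (q ^ 2)"] x_in_V K_x by simp
  have v_E: "act ?Q (uq_e q) ?v = \<zero>\<^bsub>?Q\<^esub>"
  proof -
    have "c (0, 0) \<odot> mon 0 0 \<in> J" by (simp add: J_def)
    then have "?cl (c (0, 0) \<odot> mon 0 0) = ?cl \<zero>"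
      using cl_eq[of "c (0, 0) \<odot> mon 0 0" \<zero>] J_subset submodule_zero[OF submodule_V[of 0]]
      by (auto simp: \<Phi>_in)
    then show ?thesis using act_P[OF x_in_V, of "gen GenE"] E_x Q_zero by simp
  qed
  have vec_in: "verma_vec q M (mon (Suc 0) 0) i \<in> V 0" for i
    using basis_in_V[of "Suc i" 0] by (simp add: basis_simps(3))
  have vec: "verma_vec q ?Q ?v i = ?cl (verma_vec q M (mon (Suc 0) 0) i)" for i
  proof (induction i)
    case 0
    then show ?case by simp
  next
    case (Suc i)
    have "act M (uq_f q) (verma_vec q M (mon (Suc 0) 0) i) \<in> V 0"
      by (rule subrep_act[OF M subrep_V uq_class_in[OF M] vec_in])
    then show ?case using Suc act_P[OF vec_in] Q_smult by simp
  qed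
  let ?\<psi> = "lin_comb ?Q (verma_vec q ?Q ?v)" and ?\<Psi> = "lin_comb M (verma_vec q M (mon (Suc 0) 0))"
  have vecQ_in: "verma_vec q ?Q ?v i \<in> carrier ?Q" for i
    unfolding vec by (rule cl_in[OF vec_in])
  have lin: "linear_map monoid_algebra ?Q ?\<psi>"
    by (rule Q.linear_map_lin_comb) (rule vecQ_in)
  have lin\<Psi>: "linear_map monoid_algebra M ?\<Psi>"
    by (rule linear_map_lin_comb) (rule chain_x(1))
  have \<Psi>_in: "?\<Psi> w \<in> V 0" for w
    using submodule_V by (rule lin_comb_in_submodule) (rule vec_in)
  have \<psi>: "?\<psi> w = ?cl (?\<Psi> w)" for w
  proof (rule linear_map_monoid_algebra_eqI[where f = ?\<psi> and g = "\<lambda>w. ?cl (?\<Psi> w)"])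
    show "linear_map monoid_algebra ?Q ?\<psi>" by (rule lin)
    show "linear_map monoid_algebra ?Q (\<lambda>w. ?cl (?\<Psi> w))"
    proof (rule linear_mapI)
      fix u w d
      show "?cl (?\<Psi> w) \<in> carrier ?Q" by (rule cl_in[OF \<Psi>_in])
      show "?cl (?\<Psi> (u \<oplus>\<^bsub>monoid_algebra\<^esub> w)) = ?cl (?\<Psi> u) \<oplus>\<^bsub>?Q\<^esub> ?cl (?\<Psi> w)"
        using linear_map_add[OF lin\<Psi>, of u w] Q_add[of "?\<Psi> u" "?\<Psi> w"] \<Psi>_in by simp
      show "?cl (?\<Psi> (d \<odot>\<^bsub>monoid_algebra\<^esub> w)) = d \<odot>\<^bsub>?Q\<^esub> ?cl (?\<Psi> w)"
        using linear_map_smult[OF lin\<Psi>, of w d] Q_smult[of "?\<Psi> w" d] \<Psi>_in by simp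
    qed
    fix i
    have "?\<psi> (Poly_Mapping.single i 1) = 1 \<odot>\<^bsub>?Q\<^esub> verma_vec q ?Q ?v i"
      by (rule Q.lin_comb_single) (rule vecQ_in)
    moreover have "?\<Psi> (Poly_Mapping.single i 1) = 1 \<odot> verma_vec q M (mon (Suc 0) 0) i"
      by (rule lin_comb_single) (rule chain_x(1))
    ultimately show "?\<psi> (Poly_Mapping.single i 1) = ?cl (?\<Psi> (Poly_Mapping.single i 1))"
      using Q.smult_1[OF vecQ_in] smult_1[OF chain_x(1)] vec by simp
  qed
  show "is_rep (uq q) (verma q (inverse (q ^ 2)))"
    by (rule is_rep_verma[OF q q_not_inverse weight_nonzero])
  show "linear_map (verma q (inverse (q ^ 2))) ?Q ?\<psi>"
    using lin by (simp add: linear_map_def)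
  show "?\<psi> (act (verma q (inverse (q ^ 2))) h w) = act ?Q h (?\<psi> w)" if "h \<in> carrier (uq q)" for h w
    by (rule verma_hom[OF q q_not_inverse weight_nonzero verma_f_nonzero Q v_in v_K v_E that])
  have inj_h: "inj (\<lambda>i. (Suc i, 0 :: nat))" by (simp add: inj_on_def)
  have "inj ?\<psi>"
  proof (rule injI)
    fix u w assume "?\<psi> u = ?\<psi> w"
    then have "?\<Psi> u \<oplus> (- 1) \<odot> ?\<Psi> w \<in> J"
      unfolding \<psi> cl_eq[OF \<Psi>_in[of u] \<Psi>_in[of w]] .
    then obtain d where "?\<Psi> u \<oplus> (- 1) \<odot> ?\<Psi> w = d \<odot> mon 0 0" by (auto simp: J_def)
    moreover have "?\<Psi> (u - w) = ?\<Psi> u \<oplus> (- 1) \<odot> ?\<Psi> w"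
      using linear_map_add[OF lin\<Psi>, of u "scale (- 1) w"] linear_map_smult[OF lin\<Psi>, of w "- 1"]
      by (simp add: scale_minus_one)
    ultimately have "B (push_forward (\<lambda>i. (Suc i, 0)) (u - w)) = B (Poly_Mapping.single (0, 0) d)"
      using B_push_forward_x by (simp add: B_single basis_simps)
    then have eq: "push_forward (\<lambda>i. (Suc i, 0 :: nat)) (u - w) = Poly_Mapping.single (0, 0) d"
      by (rule injD[OF B_bij(1)])
    have "Poly_Mapping.lookup (u - w) i = 0" for i
      using lookup_push_forward[OF inj_h, of "u - w" i] unfolding eq by (simp add: lookup_single when_def)
    then have "u - w = 0" by (intro poly_mapping_eqI) simp
    then show "u = w" by simp
  qed
  moreover have "range ?\<psi> = carrier ?Q"
  proof (rule equalityI)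
    show "range ?\<psi> \<subseteq> carrier ?Q" using cl_in[OF \<Psi>_in] by (auto simp: \<psi>)
    show "carrier ?Q \<subseteq> range ?\<psi>"
    proof
      fix a assume "a \<in> carrier ?Q"
      then obtain u where u: "a = ?cl u" "u \<in> V 0" by (auto simp: Q_carrier)
      then obtain v where v: "u = B v" "Poly_Mapping.keys v \<subseteq> range (\<lambda>i. (i, 0))"
        by (auto simp: V_def)
      \<comment> \<open>Split off the constant term; the rest is a combination of divided powers of \<open>x\<close>.\<close>
      define d where "d = Poly_Mapping.lookup v (0, 0)"
      define r where "r = v - Poly_Mapping.single (0, 0) d"
      have "Poly_Mapping.keys r \<subseteq> range (\<lambda>i. (Suc i, 0))"
      proof
        fix i assume i: "i \<in> Poly_Mapping.keys r"
        then have "i \<noteq> (0, 0)" by (auto simp: r_def d_def in_keys_iff lookup_minus)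
        moreover have "i \<in> Poly_Mapping.keys v"
          using i \<open>i \<noteq> (0, 0)\<close> by (auto simp: r_def in_keys_iff lookup_minus lookup_single when_def)
        then obtain m where "i = (m, 0)" using v(2) by auto
        ultimately show "i \<in> range (\<lambda>i. (Suc i, 0))" by (cases m) auto
      qed
      then obtain w where w: "r = push_forward (\<lambda>i. (Suc i, 0)) w"
        using range_push_forward[OF inj_h] by blast
      have "v = Poly_Mapping.single (0, 0) d + r" by (simp add: r_def)
      then have "u = d \<odot> mon 0 0 \<oplus> ?\<Psi> w"
        using linear_map_add[OF linear_B, of "Poly_Mapping.single (0, 0) d" r] v(1)
        by (simp add: B_single basis_simps B_push_forward_x w)
      then have "u \<oplus> (- 1) \<odot> ?\<Psi> w = d \<odot> mon 0 0"
        using subsetD[OF subrep_subset[OF M subrep_V] \<Psi>_in[of w]]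
        by (simp add: smult_minus_one M.a_assoc M.r_neg \<Phi>_in)
      then have "?cl u = ?cl (?\<Psi> w)"
        using cl_eq[OF u(2) \<Psi>_in[of w]] by (simp add: J_def)
      then show "a \<in> range ?\<psi>" using u(1) \<psi>[of w] by auto
    qed
  qed
  ultimately show "bij_betw ?\<psi> (carrier (verma q (inverse (q ^ 2)))) (carrier ?Q)"
    by (simp add: bij_betw_def)
qed

lemma composition_series_V: "composition_series (uq q) (sub_rep M (V 0)) [{\<zero>}, J, V 0]"
proof -
  let ?P = "sub_rep M (V 0)"
  have P: "is_rep (uq q) ?P" by (rule uq.is_rep_sub_rep[OF M subrep_V])
  have JP: "subrep (uq q) ?P J" by (rule uq.subrep_sub_rep[OF M subrep_V subrep_J J_subset])
  have VP: "subrep (uq q) ?P (V 0)" by (rule uq.subrep_sub_rep[OF M subrep_V subrep_V order_refl])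
  have ZP: "subrep (uq q) ?P {\<zero>}" using uq.subrep_zero[OF P] by simp
  let ?J = "sub_rep ?P J"
  have J: "is_rep (uq q) ?J" by (rule uq.is_rep_sub_rep[OF P JP])
  have ZJ: "subrep (uq q) ?J {\<zero>}" using uq.subrep_zero[OF J] by simp
  interpret J: complex_space ?J using J by (rule is_rep_space)
  let ?Q = "quot_rep ?J {\<zero>}"
  have Q: "is_rep (uq q) ?Q" by (rule uq.is_rep_quot_rep[OF J ZJ])
  have zero_J: "\<zero> \<in> J" using submodule_zero[OF subrep_submodule[OF M subrep_J]] .
  have one_J: "mon 0 0 \<in> J"
    unfolding J_def using \<Phi>_in by (intro range_eqI[where x = 1]) simp
  have simple1: "simple_rep (uq q) ?Q"
  proof (rule simple_rep_one_dimensional[OF Q])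
    let ?v = "{\<zero>} +>\<^bsub>?J\<^esub> mon 0 0"
    show "?v \<in> carrier ?Q" using quot_rep_carrier[OF J ZJ] one_J by simp
    show "?v \<noteq> \<zero>\<^bsub>?Q\<^esub>"
      using J.coset_eq_iff[OF subrep_submodule[OF J ZJ], of "mon 0 0" \<zero>] one_J zero_J
        quot_rep_zero[OF J ZJ] mon_nonzero[of 0 0] by (simp add: \<Phi>_in)
    have "carrier ?Q = (\<lambda>v. {\<zero>} +>\<^bsub>?J\<^esub> v) ` J"
      using quot_rep_carrier[OF J ZJ] by simp
    also have "\<dots> = range (\<lambda>d. {\<zero>} +>\<^bsub>?J\<^esub> (d \<odot> mon 0 0))"
      by (simp add: J_def image_image)
    also have "\<dots> = range (\<lambda>d. d \<odot>\<^bsub>?Q\<^esub> ?v)"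
      using quot_rep_smult[OF J ZJ, of "mon 0 0"] one_J by simp
    finally show "carrier ?Q = range (\<lambda>d. d \<odot>\<^bsub>?Q\<^esub> ?v)" .
  qed
  have simple2: "simple_rep (uq q) (quot_rep ?P J)"
    using uq.is_rep_quot_rep[OF P JP] simple_verma[of 2] quotient_iso_verma
    by (rule simple_rep_iso[rotated 0]) simp
  have strict: "{\<zero>} \<subset> J" "J \<subset> V 0"
    using zero_J one_J mon_nonzero[of 0 0] J_subset x_in_V x_not_in_J by auto
  have "[{\<zero>}, J, V 0] ! i \<subset> [{\<zero>}, J, V 0] ! Suc i \<and>
      simple_rep (uq q) (quot_rep (sub_rep ?P ([{\<zero>}, J, V 0] ! Suc i)) ([{\<zero>}, J, V 0] ! i))"
    if "Suc i < length [{\<zero>}, J, V 0]" for i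
  proof -
    consider "i = 0" | "i = 1" using \<open>Suc i < length [{\<zero>}, J, V 0]\<close> by fastforce
    then show ?thesis
      using simple1 simple2 strict by cases simp_all
  qed
  then show ?thesis
    unfolding composition_series_def using ZP JP VP by simp
qed

end

section \<open>The action on the quantum plane\<close>

lemma
  assumes "a \<in> carrier (quantum_plane q)" "b \<in> carrier (quantum_plane q)"
  shows qp_mult_closed: "a \<otimes>\<^bsub>quantum_plane q\<^esub> b \<in> carrier (quantum_plane q)"
    and qp_smult_mult: "(c \<odot>\<^bsub>quantum_plane q\<^esub> a) \<otimes>\<^bsub>quantum_plane q\<^esub> b
      = c \<odot>\<^bsub>quantum_plane q\<^esub> (a \<otimes>\<^bsub>quantum_plane q\<^esub> b)"
    and qp_mult_smult: "a \<otimes>\<^bsub>quantum_plane q\<^esub> (c \<odot>\<^bsub>quantum_plane q\<^esub> b)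
      = c \<odot>\<^bsub>quantum_plane q\<^esub> (a \<otimes>\<^bsub>quantum_plane q\<^esub> b)"
    and qp_mult_zero: "a \<otimes>\<^bsub>quantum_plane q\<^esub> \<zero>\<^bsub>quantum_plane q\<^esub> = \<zero>\<^bsub>quantum_plane q\<^esub>"
    and qp_zero_mult: "\<zero>\<^bsub>quantum_plane q\<^esub> \<otimes>\<^bsub>quantum_plane q\<^esub> b = \<zero>\<^bsub>quantum_plane q\<^esub>"
    and qp_one_mult: "\<one>\<^bsub>quantum_plane q\<^esub> \<otimes>\<^bsub>quantum_plane q\<^esub> b = b"
proof -
  obtain p r where "a = pres_class (qp_relators q) p" "b = pres_class (qp_relators q) r"
    using assms by (auto simp: quantum_plane_def)
  then show "a \<otimes>\<^bsub>quantum_plane q\<^esub> b \<in> carrier (quantum_plane q)"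
    "(c \<odot>\<^bsub>quantum_plane q\<^esub> a) \<otimes>\<^bsub>quantum_plane q\<^esub> b = c \<odot>\<^bsub>quantum_plane q\<^esub> (a \<otimes>\<^bsub>quantum_plane q\<^esub> b)"
    "a \<otimes>\<^bsub>quantum_plane q\<^esub> (c \<odot>\<^bsub>quantum_plane q\<^esub> b) = c \<odot>\<^bsub>quantum_plane q\<^esub> (a \<otimes>\<^bsub>quantum_plane q\<^esub> b)"
    "a \<otimes>\<^bsub>quantum_plane q\<^esub> \<zero>\<^bsub>quantum_plane q\<^esub> = \<zero>\<^bsub>quantum_plane q\<^esub>"
    "\<zero>\<^bsub>quantum_plane q\<^esub> \<otimes>\<^bsub>quantum_plane q\<^esub> b = \<zero>\<^bsub>quantum_plane q\<^esub>"
    "\<one>\<^bsub>quantum_plane q\<^esub> \<otimes>\<^bsub>quantum_plane q\<^esub> b = b"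
    by (simp_all add: quantum_plane_def scale_mult_left scale_mult_right)
qed

lemma range_qp_poly: "range (qp_poly q) = carrier (quantum_plane q)"
  using surj_qp_poly[of _ q] linear_map_closed[OF linear_map_qp_poly[of q]] by auto

lemma qp_poly_one: "qp_poly q (Poly_Mapping.single (0, 0) 1) = \<one>\<^bsub>quantum_plane q\<^esub>"
  by (simp add: qp_poly_def quantum_plane_def qp_monomial_def)

text \<open>
  The hypothesis forces \<open>r \<noteq> 1\<close>, so the sum is \<open>(1 - r\<^bsup>m+1\<^esup>) / (1 - r)\<close>.
\<close>

lemma geometric_sum_nonzero:
  assumes "r ^ Suc m \<noteq> (1 :: complex)"
  shows "(\<Sum>j\<le>m. r ^ j) \<noteq> 0"
  using assms sum_gp_basic[of r m] by auto

context
  fixes q a0 :: complex and \<pi> :: "uq_gen free_algebra set \<Rightarrow> qp_gen free_algebra set \<Rightarrow> qp_gen free_algebra set"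
  assumes q: "q \<noteq> 0" and not_root: "\<forall>n::nat. n > 0 \<longrightarrow> q ^ n \<noteq> 1" and a0: "a0 \<noteq> 0"
    and MA: "module_algebra q (quantum_plane q) \<pi>"
    and Kx: "\<pi> (uq_k q) (qp_x q) = inverse (q\<^sup>2) \<odot>\<^bsub>quantum_plane q\<^esub> qp_x q"
    and Ky: "\<pi> (uq_k q) (qp_y q) = inverse q \<odot>\<^bsub>quantum_plane q\<^esub> qp_y q"
    and Ex: "\<pi> (uq_e q) (qp_x q) = a0 \<odot>\<^bsub>quantum_plane q\<^esub> \<one>\<^bsub>quantum_plane q\<^esub>"
    and Ey: "\<pi> (uq_e q) (qp_y q) = \<zero>\<^bsub>quantum_plane q\<^esub>"
begin

interpretation complex_space "quantum_plane q" by (rule complex_space_quantum_plane)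

abbreviation xy :: "nat \<Rightarrow> nat \<Rightarrow> qp_gen free_algebra set"
  where "xy m n \<equiv> qp_poly q (Poly_Mapping.single (m, n) 1)"

lemma act_on_one: "\<pi> (uq_class q (gen g)) \<one>\<^bsub>quantum_plane q\<^esub>
    = counit_gen g \<odot>\<^bsub>quantum_plane q\<^esub> \<one>\<^bsub>quantum_plane q\<^esub>"
  by (rule module_algebra_one[OF complex_space_axioms MA qp_mult_closed])

lemma xy_in: "xy m n \<in> carrier (quantum_plane q)"
  unfolding range_qp_poly[symmetric] by (rule rangeI)

lemma x_in: "qp_x q \<in> carrier (quantum_plane q)" and y_in: "qp_y q \<in> carrier (quantum_plane q)"
  by (simp_all add: qp_x_def qp_y_def quantum_plane_def)

lemma x_mult_xy: "qp_x q \<otimes>\<^bsub>quantum_plane q\<^esub> xy m n = xy (Suc m) n"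
  using qp_poly_gen_mult[of q GenX "Poly_Mapping.single (m, n) 1"]
  by (simp add: qp_x_def qp_op_single del: qp_op.simps single_one)

lemma y_mult_xy: "qp_y q \<otimes>\<^bsub>quantum_plane q\<^esub> xy 0 n = xy 0 (Suc n)"
  using qp_poly_gen_mult[of q GenY "Poly_Mapping.single (0, n) 1"]
  by (simp add: qp_y_def qp_op_single del: qp_op.simps single_one)

lemma K_xy: "\<pi> (uq_k q) (xy m n) = inverse (q ^ (2 * m + n)) \<odot>\<^bsub>quantum_plane q\<^esub> xy m n"
proof (induction m)
  case 0
  show ?case
  proof (induction n)
    case 0
    then show ?case
      using act_on_one[of GenK]
      by (simp add: qp_poly_one del: single_one)
  next
    case (Suc n)
    have "\<pi> (uq_k q) (xy 0 (Suc n))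
        = \<pi> (uq_k q) (qp_y q) \<otimes>\<^bsub>quantum_plane q\<^esub> \<pi> (uq_k q) (xy 0 n)"
      unfolding y_mult_xy[symmetric]
      by (rule module_algebra_K[OF complex_space_axioms MA qp_mult_closed y_in xy_in])
    then show ?case
      using Suc by (simp add: Ky qp_smult_mult qp_mult_smult y_in xy_in y_mult_xy smult_smult
          mult.commute del: single_one)
  qed
next
  case (Suc m)
  have "\<pi> (uq_k q) (xy (Suc m) n)
      = \<pi> (uq_k q) (qp_x q) \<otimes>\<^bsub>quantum_plane q\<^esub> \<pi> (uq_k q) (xy m n)"
    unfolding x_mult_xy[symmetric]
    by (rule module_algebra_K[OF complex_space_axioms MA qp_mult_closed x_in xy_in])
  then show ?case
    using Suc by (simp add: Kx qp_smult_mult qp_mult_smult x_in xy_in x_mult_xy smult_smult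
        power2_eq_square mult_ac del: single_one)
qed

lemma E_y_power: "\<pi> (uq_e q) (xy 0 n) = \<zero>\<^bsub>quantum_plane q\<^esub>"
proof (induction n)
  case 0
  then show ?case
    using act_on_one[of GenE] qp_poly_one[of q] xy_in[of 0 0]
    by (simp del: single_one)
next
  case (Suc n)
  have "\<pi> (uq_e q) (xy 0 (Suc n))
      = qp_y q \<otimes>\<^bsub>quantum_plane q\<^esub> \<pi> (uq_e q) (xy 0 n)
        \<oplus>\<^bsub>quantum_plane q\<^esub> \<pi> (uq_e q) (qp_y q) \<otimes>\<^bsub>quantum_plane q\<^esub> \<pi> (uq_k q) (xy 0 n)"
    unfolding y_mult_xy[symmetric]
    by (rule module_algebra_E[OF complex_space_axioms MA qp_mult_closed y_in xy_in])
  then show ?case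
    using Suc qp_mult_zero[OF y_in y_in] qp_zero_mult[OF y_in xy_in[of 0 n]]
    by (simp add: Ey K_xy qp_mult_smult[OF M.zero_closed] xy_in del: single_one)
qed

lemma E_xy: "\<pi> (uq_e q) (xy (Suc m) n)
    = (a0 * inverse (q ^ n) * (\<Sum>j\<le>m. inverse (q\<^sup>2) ^ j)) \<odot>\<^bsub>quantum_plane q\<^esub> xy m n"
proof (induction m)
  have step: "\<pi> (uq_e q) (xy (Suc m) n)
      = qp_x q \<otimes>\<^bsub>quantum_plane q\<^esub> \<pi> (uq_e q) (xy m n)
        \<oplus>\<^bsub>quantum_plane q\<^esub> (a0 * inverse (q ^ (2 * m + n))) \<odot>\<^bsub>quantum_plane q\<^esub> xy m n" for m
  proof -
    have one: "\<one>\<^bsub>quantum_plane q\<^esub> \<in> carrier (quantum_plane q)"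
      using xy_in[of 0 0] qp_poly_one by simp
    have "\<pi> (uq_e q) (xy (Suc m) n)
        = qp_x q \<otimes>\<^bsub>quantum_plane q\<^esub> \<pi> (uq_e q) (xy m n)
          \<oplus>\<^bsub>quantum_plane q\<^esub> \<pi> (uq_e q) (qp_x q) \<otimes>\<^bsub>quantum_plane q\<^esub> \<pi> (uq_k q) (xy m n)"
      unfolding x_mult_xy[symmetric]
      by (rule module_algebra_E[OF complex_space_axioms MA qp_mult_closed x_in xy_in])
    moreover have "\<pi> (uq_e q) (qp_x q) \<otimes>\<^bsub>quantum_plane q\<^esub> \<pi> (uq_k q) (xy m n)
        = (a0 * inverse (q ^ (2 * m + n))) \<odot>\<^bsub>quantum_plane q\<^esub> xy m n"
      using one qp_one_mult[OF one xy_in]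
      by (simp add: Ex K_xy qp_smult_mult qp_mult_smult xy_in smult_smult mult.commute
          del: single_one)
    ultimately show ?thesis by (simp only:)
  qed
  case 0
  show ?case
    using step[of 0] qp_mult_zero[OF x_in x_in] xy_in by (simp add: E_y_power del: single_one)
  case (Suc m)
  have "inverse (q ^ (2 * Suc m + n)) = inverse (q ^ n) * inverse (q\<^sup>2) ^ Suc m"
    unfolding power_add power_mult power_inverse inverse_mult_distrib by (rule mult.commute)
  then show ?case
    using step[of "Suc m"]
    by (simp add: Suc qp_mult_smult x_in xy_in x_mult_xy ring_distribs mult.assoc
        smult_add[OF xy_in, symmetric] del: single_one power_Suc mult_Suc_right)
qed

lemma lowering_rep_quantum_plane:
  "lowering_rep q (rep_of (quantum_plane q) \<pi>) (qp_poly q)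
    (\<lambda>(m, n). a0 * inverse (q ^ n) * (\<Sum>j\<le>m. inverse (q\<^sup>2) ^ j))"
proof
  have "inverse (q\<^sup>2) ^ Suc m \<noteq> 1" for m
  proof
    assume "inverse (q\<^sup>2) ^ Suc m = 1"
    then have "inverse (q ^ (2 * Suc m)) = 1" by (simp only: power_inverse power_mult)
    then have "q ^ (2 * Suc m) = 1" by (simp only: inverse_eq_1_iff)
    then show False using not_root[rule_format, of "2 * Suc m"] by simp
  qed
  then show "(case i of (m, n) \<Rightarrow> a0 * inverse (q ^ n) * (\<Sum>j\<le>m. inverse (q\<^sup>2) ^ j)) \<noteq> 0" for i
    using a0 q geometric_sum_nonzero by (cases i) simp
  show "is_rep (uq q) (rep_of (quantum_plane q) \<pi>)"
    by (rule is_rep_module_algebra[OF complex_space_axioms MA])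
  show "linear_map monoid_algebra (rep_of (quantum_plane q) \<pi>) (qp_poly q)"
    using linear_map_qp_poly[of q] by (simp add: linear_map_def)
  have "xy 0 0 \<in> carrier (quantum_plane q)" by (rule xy_in)
  then show "act (rep_of (quantum_plane q) \<pi>) (uq_f q) (xy 0 0) = \<zero>\<^bsub>rep_of (quantum_plane q) \<pi>\<^esub>"
    using act_on_one[of GenF]
    by (simp add: qp_poly_one del: single_one)
qed (use q not_root in \<open>simp_all add: inj_qp_poly range_qp_poly K_xy E_y_power E_xy del: single_one\<close>)

end

theorem proposition22:
  fixes q a0 s t :: complex
    and \<pi> :: "uq_gen free_algebra set \<Rightarrow> qp_gen free_algebra set \<Rightarrow> qp_gen free_algebra set"
  assumes "q \<noteq> 0" and "\<forall>n::nat. n > 0 \<longrightarrow> q ^ n \<noteq> 1"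
    and "a0 \<noteq> 0"
    and "module_algebra q (quantum_plane q) \<pi>"
    and "\<pi> (uq_k q) (qp_x q) = inverse (q\<^sup>2) \<odot>\<^bsub>quantum_plane q\<^esub> qp_x q"
    and "\<pi> (uq_k q) (qp_y q) = inverse q \<odot>\<^bsub>quantum_plane q\<^esub> qp_y q"
    and "\<pi> (uq_e q) (qp_x q) = a0 \<odot>\<^bsub>quantum_plane q\<^esub> \<one>\<^bsub>quantum_plane q\<^esub>"
    and "\<pi> (uq_e q) (qp_y q) = \<zero>\<^bsub>quantum_plane q\<^esub>"
    and "\<pi> (uq_f q) (qp_x q) =
      (- q * inverse a0) \<odot>\<^bsub>quantum_plane q\<^esub> (qp_x q [^]\<^bsub>quantum_plane q\<^esub> (2::nat))
      \<oplus>\<^bsub>quantum_plane q\<^esub> t \<odot>\<^bsub>quantum_plane q\<^esub> (qp_y q [^]\<^bsub>quantum_plane q\<^esub> (4::nat))"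
    and "\<pi> (uq_f q) (qp_y q) =
      (- q * inverse a0) \<odot>\<^bsub>quantum_plane q\<^esub> (qp_x q \<otimes>\<^bsub>quantum_plane q\<^esub> qp_y q)
      \<oplus>\<^bsub>quantum_plane q\<^esub> s \<odot>\<^bsub>quantum_plane q\<^esub> (qp_y q [^]\<^bsub>quantum_plane q\<^esub> (3::nat))"
  shows
    "let M = rep_of (quantum_plane q) \<pi>;
         y_pow = (\<lambda>n::nat. qp_y q [^]\<^bsub>quantum_plane q\<^esub> n);
         J0 = range (\<lambda>c. c \<odot>\<^bsub>quantum_plane q\<^esub> \<one>\<^bsub>quantum_plane q\<^esub>)
     in \<exists>V :: nat \<Rightarrow> qp_gen free_algebra set set.
          (\<forall>n. subrep (uq q) M (V n)) \<and>
          internal_direct_sum M UNIV V \<and>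
          (\<forall>n. \<exists>l. highest_weight_vector q (sub_rep M (V n)) l (y_pow n)) \<and>
          (\<forall>n\<ge>1. V n = generated_subrep (uq q) M {y_pow n}) \<and>
          (\<forall>n\<ge>1. simple_rep (uq q) (verma q (q powi (- int n))) \<and>
                 rep_iso (uq q) (sub_rep M (V n)) (verma q (q powi (- int n)))) \<and>
          composition_series (uq q) (sub_rep M (V 0)) [{\<zero>\<^bsub>M\<^esub>}, J0, V 0] \<and>
          \<not> direct_summand (uq q) (sub_rep M (V 0)) J0 \<and>
          simple_rep (uq q) (verma q (q powi (- 2))) \<and>
          rep_iso (uq q) (quot_rep (sub_rep M (V 0)) J0) (verma q (q powi (- 2)))"
proof -
  let ?M = "rep_of (quantum_plane q) \<pi>"
  interpret L: lowering_rep q ?M "qp_poly q"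
      "\<lambda>(m, n). a0 * inverse (q ^ n) * (\<Sum>j\<le>m. inverse (q\<^sup>2) ^ j)"
    by (rule lowering_rep_quantum_plane) fact+
  have J: "range (\<lambda>c. c \<odot>\<^bsub>quantum_plane q\<^esub> \<one>\<^bsub>quantum_plane q\<^esub>) = L.J"
    unfolding L.J_def qp_poly_one by simp
  have powi: "q powi (- int n) = inverse (q ^ n)" "q powi (- 2) = inverse (q ^ 2)" for n
    by (simp_all add: power_int_minus)
  show ?thesis
    unfolding Let_def J powi qp_y_pow
  proof (intro exI[of _ L.V] conjI allI impI)
    fix n :: nat
    show "subrep (uq q) ?M (L.V n)" by (rule L.subrep_V)
    show "\<exists>l. highest_weight_vector q (sub_rep ?M (L.V n)) l (L.mon 0 n)"
      using L.highest_weight_vector_V by (rule exI)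
    assume "n \<ge> 1"
    then have n: "n > 0" by simp
    show "L.V n = generated_subrep (uq q) ?M {L.mon 0 n}" using n by (rule L.V_generated)
    show "simple_rep (uq q) (verma q (inverse (q ^ n)))" using n by (rule L.simple_verma)
    show "rep_iso (uq q) (sub_rep ?M (L.V n)) (verma q (inverse (q ^ n)))"
      using n by (rule L.V_iso_verma)
  next
    show "simple_rep (uq q) (verma q (inverse (q ^ 2)))" by (rule L.simple_verma) simp
  qed (rule L.direct_sum_V L.composition_series_V L.J_not_direct_summand L.quotient_iso_verma)+
qed

end
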